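(* Let $\alpha\in(0,2)$, $\kappa_0>1$ and let $\kappa:\mathbb{R}_+\times\mathbb{R}^d\to\mathbb{R}$ be a Borel function with $\kappa_0^{-1}\le\kappa(t,z)\le\kappa_0$ and, when $\alpha=1$, $$\int_{R_0\le|z|\le R_1}\frac{z\,\kappa(t,z)}{|z|^{d+1}}\,dz=0\quad\text{for every }0<R_0<R_1<\infty.$$ Let $p^\kappa_{t,s}$ be the density defined in the context. Then there is a constant $c_0>1$ depending only on $\kappa_0,d,\alpha$ such that for all $0\le t<s$ and $x\in\mathbb{R}^d$, $$c_0^{-1}\varrho^0_\alpha(s-t,x)\le p^\kappa_{t,s}(x)\le c_0\,\varrho^0_\alpha(s-t,x).$$
   Context: Let $z^{(\alpha)}:=(1_{\alpha\in(1,2)}+1_{|z|\le1}1_{\alpha=1})z$. For $0\le t<s$, let $X^\kappa_{t,s}$ be the $\mathbb{R}^d$-valued random variable (increment over $[t,s]$ of the time-inhomogeneous additive process with jump intensity $\kappa(r,z)|z|^{-d-\alpha}\,dz\,dr$) with characteristic function $$\mathbb{E}e^{\mathrm{i}\xi\cdot X^\kappa_{t,s}}=\exp\left\{\int_t^s\int_{\mathbb{R}^d}\big(e^{\mathrm{i}\xi\cdot z}-1-\mathrm{i}\xi\cdot z^{(\alpha)}\big)\frac{\kappa(r,z)}{|z|^{d+\alpha}}\,dz\,dr\right\}.$$ $X^\kappa_{t,s}$ has a continuous density with respect to Lebesgue measure on $\mathbb{R}^d$, denoted $p^\kappa_{t,s}(x)$. Moreover $$\varrho^0_\alpha(t,x):=\frac{t}{(t^{1/\alpha}+|x|)^{d+\alpha}}.$$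 *)

theory Defs
  imports "HOL-Probability.Probability"
begin

text \<open>Throughout, \<open>\<real>\<^sup>d\<close> is \<^typ>\<open>real ^ 'd\<close>, so that \<open>d\<close> is \<open>CARD('d)\<close>.\<close>

definition compensator :: "real \<Rightarrow> real ^ 'd \<Rightarrow> real ^ 'd" where
  "compensator \<alpha> z =
     (indicator {1<..<2} \<alpha> + indicator {z. norm z \<le> 1} z * indicator {1} \<alpha>) *\<^sub>R z"

text \<open>The integrand at \<open>z = 0\<close> is \<open>0\<close> by the convention \<open>x / 0 = 0\<close>; this is a null set.\<close>

definition levy_exponent ::
    "real \<Rightarrow> (real \<Rightarrow> real ^ 'd \<Rightarrow> real) \<Rightarrow> real \<Rightarrow> real \<Rightarrow> real ^ 'd \<Rightarrow> complex" where
  "levy_exponent \<alpha> \<kappa> t s \<xi> =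
     (CLINT r:{t..s}|lborel. CLINT z|lborel.
        (exp (\<i> * of_real (\<xi> \<bullet> z)) - 1 - \<i> * of_real (\<xi> \<bullet> compensator \<alpha> z))
        * of_real (\<kappa> r z / norm z powr (real CARD('d) + \<alpha>)))"

text \<open>\<open>\<mu>\<close> is the law of the increment \<open>X\<close> over \<open>[t, s]\<close>, which is determined by its
  characteristic function.\<close>

definition increment_law ::
    "real \<Rightarrow> (real \<Rightarrow> real ^ 'd \<Rightarrow> real) \<Rightarrow> real \<Rightarrow> real \<Rightarrow> (real ^ 'd) measure \<Rightarrow> bool" where
  "increment_law \<alpha> \<kappa> t s \<mu> \<longleftrightarrow>
     prob_space \<mu> \<and> sets \<mu> = sets borel \<and>
     (\<forall>\<xi>. (CLINT x|\<mu>. exp (\<i> * of_real (\<xi> \<bullet> x))) = exp (levy_exponent \<alpha> \<kappa> t s \<xi>))"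

definition continuous_density :: "(real ^ 'd) measure \<Rightarrow> (real ^ 'd \<Rightarrow> real) \<Rightarrow> bool" where
  "continuous_density \<mu> p \<longleftrightarrow>
     continuous_on UNIV p \<and> (\<forall>x. 0 \<le> p x) \<and> \<mu> = density lborel (\<lambda>x. ennreal (p x))"

definition admissible_kernel :: "real \<Rightarrow> real \<Rightarrow> (real \<Rightarrow> real ^ 'd \<Rightarrow> real) \<Rightarrow> bool" where
  "admissible_kernel \<alpha> \<kappa>\<^sub>0 \<kappa> \<longleftrightarrow>
     (\<lambda>(t, z). \<kappa> t z) \<in> borel_measurable (restrict_space borel ({0..} \<times> UNIV)) \<and>
     (\<forall>t\<ge>0. \<forall>z. inverse \<kappa>\<^sub>0 \<le> \<kappa> t z \<and> \<kappa> t z \<le> \<kappa>\<^sub>0) \<and>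
     (\<alpha> = 1 \<longrightarrow> (\<forall>t\<ge>0. \<forall>R\<^sub>0 R\<^sub>1. 0 < R\<^sub>0 \<and> R\<^sub>0 < R\<^sub>1 \<longrightarrow>
        (LINT z:{z. R\<^sub>0 \<le> norm z \<and> norm z \<le> R\<^sub>1}|lborel.
           (\<kappa> t z / norm z ^ (CARD('d) + 1)) *\<^sub>R z) = 0))"

definition rho0 :: "real \<Rightarrow> real \<Rightarrow> real ^ 'd \<Rightarrow> real" where
  "rho0 \<alpha> t x = t / (t powr (1 / \<alpha>) + norm x) powr (real CARD('d) + \<alpha>)"

end

theory Submission
  imports Defs
begin

text \<open>
  Averaging \<open>\<kappa>\<close> over \<open>[t, s]\<close> shows that the increment is infinitely divisible with the
  Levy density \<open>g(z) = (\<integral> r\<in>[t, s]. \<kappa>(r, z)) / |z|^(d + \<alpha>)\<close>, and the scaling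
  \<open>z = R w\<close>, \<open>R = (s - t)^(1/\<alpha>)\<close>, turns it into a density \<open>k\<close> with
  \<open>\<kappa>\<^sub>0\<^sup>-\<^sup>1 |w|^(-d-\<alpha>) \<le> k(w) \<le> \<kappa>\<^sub>0 |w|^(-d-\<alpha>)\<close>, at unit time
  (\<open>levy_exponent_rescaled\<close>). For \<open>\<alpha> = 1\<close> the compensator is not scale invariant; the cancellation
  over annuli makes the change of cutoff from \<open>1\<close> to \<open>R\<close> cost nothing. After scaling, the
  compensator differs from the cutoff of the jumps at size \<open>1\<close> only by a drift, bounded in terms of
  \<open>\<alpha>\<close>, \<open>d\<close>, \<open>\<kappa>\<^sub>0\<close>, and a bounded shift does not change \<open>h(x) = (1 + |x|)^(-d-\<alpha>)\<close> by more than
  a constant factor. So it suffices to compare the density at unit time with \<open>h\<close>.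

  Split \<open>k\<close> into the jumps of size at most \<open>1\<close>, with exponent \<open>\<psi>\<close>, and the rest \<open>f\<close>, which is an
  integrable function of mass \<open>\<lambda>\<close>. Writing \<open>P\<close> for the inverse Fourier transform of \<open>exp \<psi>\<close>, the
  density is the series \<open>exp (-\<lambda>) \<Sum>n. P * f^(*n) / n!\<close>, because multiplying by the Fourier transform
  of \<open>f\<close> is convolving with \<open>f\<close>.

  \<^item> Upper bound (\<open>inv_fourier_exp_bound\<close>): \<open>f \<le> B h\<close> and \<open>h * h \<le> D h\<close>, so if also \<open>|P| \<le> A h\<close>, the
    \<open>n\<close>-th convolution is at most \<open>A (B D)^n h\<close>. The function \<open>P\<close> even decays exponentially
    (\<open>inv_fourier_small_decay\<close>): multiplying \<open>P\<close> by \<open>exp (\<eta> \<bullet> x)\<close>, \<open>|\<eta>| \<le> 1\<close>, amounts to tilting the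
    jump density to \<open>exp (\<eta> \<bullet> z) k(z)\<close>, and the tilted transform is still integrable, since
    \<open>Re \<psi>(\<xi>) \<le> C - c |\<xi>|^\<alpha>\<close> (\<open>Re_small_exponent_decay\<close>).

  \<^item> Lower bound: \<open>P\<close> is nonnegative and has total mass \<open>1\<close>, so the bound \<open>P \<le> A h\<close> forces half
    of the mass into a ball of fixed radius. All terms of the series are nonnegative, and the one with
    two large jumps is already at least a multiple of \<open>h\<close>: there is a set of first jumps, of volume
    bounded below, for which the second is neither too small nor longer than \<open>|x|\<close> by more than a
    constant.

  Positivity of \<open>P\<close> and the tilting identity are checked on compound Poisson approximations with a
  small Gaussian component, where they are statements about convolutions of explicit functions, and
  then passed to the limit. The given density is recovered from its characteristic function by
  Gaussian regularisation (\<open>fourier_inversion\<close>).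
\<close>

section \<open>Affine changes of variables and Gaussian integrals\<close>

lemmas lebesgue_integral_nonneg = Bochner_Integration.integral_nonneg

lemma integrable_norm_le:
  fixes f :: "'a \<Rightarrow> 'b::{banach, second_countable_topology}" and w :: "'a \<Rightarrow> real"
  assumes w: "integrable M w" and f: "f \<in> borel_measurable M" and le: "\<And>x. norm (f x) \<le> w x"
  shows "integrable M f"
proof (rule Bochner_Integration.integrable_bound[OF w f])
  show "AE x in M. norm (f x) \<le> norm (w x)"
    unfolding real_norm_def by (intro AE_I2 order_trans[OF le abs_ge_self])
qed

lemma integrable_scaleR_iff:
  fixes f :: "'a \<Rightarrow> 'b::{banach, second_countable_topology}"
  assumes "c \<noteq> 0"
  shows "integrable M (\<lambda>x. c *\<^sub>R f x) \<longleftrightarrow> integrable M f"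
  using integrable_scaleR_right[of "inverse c" M "\<lambda>x. c *\<^sub>R f x"] assms by auto

lemma lborel_integrable_affine:
  fixes f :: "'a::euclidean_space \<Rightarrow> 'b::{banach, second_countable_topology}"
  assumes f: "integrable lborel f" and c: "c \<noteq> 0"
  shows "integrable lborel (\<lambda>x. f (t + c *\<^sub>R x))"
proof -
  have [measurable]: "f \<in> borel_measurable borel"
    using f by (simp add: borel_measurable_integrable)
  have "integrable (density (distr lborel borel (\<lambda>x. t + c *\<^sub>R x)) (\<lambda>_. ennreal (\<bar>c\<bar>^DIM('a)))) f"
    using f lborel_affine[OF c, of t] by simp
  then have "integrable lborel (\<lambda>x. \<bar>c\<bar>^DIM('a) *\<^sub>R f (t + c *\<^sub>R x))"
    by (subst (asm) integrable_density) (auto simp: integrable_distr_eq)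
  then show ?thesis
    using c by (simp add: integrable_scaleR_iff)
qed

lemma lborel_integral_affine:
  fixes f :: "'a::euclidean_space \<Rightarrow> 'b::{banach, second_countable_topology}"
  assumes [measurable]: "f \<in> borel_measurable borel" and c: "c \<noteq> 0"
  shows "(\<integral>x. f x \<partial>lborel) = \<bar>c\<bar>^DIM('a) *\<^sub>R (\<integral>x. f (t + c *\<^sub>R x) \<partial>lborel)"
  by (subst lborel_affine[OF c, of t]) (simp add: integral_density integral_distr)

lemma integral_reflect:
  fixes f :: "'a::euclidean_space \<Rightarrow> 'b::{banach, second_countable_topology}"
  assumes "f \<in> borel_measurable borel"
  shows "(\<integral>y. f (x - y) \<partial>lborel) = (\<integral>y. f y \<partial>lborel)"
  using lborel_integral_affine[OF assms, of "-1" x] by simp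

lemma integrable_reflect:
  fixes f :: "'a::euclidean_space \<Rightarrow> 'b::{banach, second_countable_topology}"
  assumes "integrable lborel f"
  shows "integrable lborel (\<lambda>y. f (x - y))"
  using lborel_integrable_affine[OF assms, of "-1" x] by simp

lemma borel_measurable_cis [measurable (raw)]:
  "f \<in> borel_measurable M \<Longrightarrow> (\<lambda>x. cis (f x)) \<in> borel_measurable M"
  unfolding cis_conv_exp
  by (intro borel_measurable_continuous_on[of exp]) (auto intro!: continuous_intros)

lemma gaussian_integral_real:
  assumes d: "0 < \<delta>"
  shows "integrable lborel (\<lambda>t::real. cis (t * a) * of_real (exp (- \<delta> * t\<^sup>2 / 2)))" (is "integrable _ ?g")
    and "(\<integral>t. cis (t * a) * of_real (exp (- \<delta> * t\<^sup>2 / 2)) \<partial>lborel)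
         = of_real (sqrt (2 * pi / \<delta>) * exp (- a\<^sup>2 / (2 * \<delta>)))"
proof -
  let ?u = "a / sqrt \<delta>"
  let ?f = "\<lambda>x. std_normal_density x *\<^sub>R cis (?u * x)"
  have int: "integrable lborel ?f"
    by (rule Bochner_Integration.integrable_bound[of _ std_normal_density])
       (auto intro!: integrable_normal_density)
  have "(\<integral>x. ?f x \<partial>lborel) = char std_normal_distribution ?u"
    unfolding char_def by (subst integral_density) (auto simp: cis_conv_exp)
  then have val: "(\<integral>x. ?f x \<partial>lborel) = of_real (exp (- a\<^sup>2 / (2 * \<delta>)))"
    using d by (simp add: char_std_normal_distribution power_divide)
  have eq: "?f (0 + sqrt \<delta> * t) = (1 / sqrt (2 * pi)) *\<^sub>R ?g t" for t
    using d by (simp add: std_normal_density_def power_mult_distrib mult.commute scaleR_conv_of_real)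
  have "integrable lborel (\<lambda>t. ?f (0 + sqrt \<delta> * t))"
    by (intro lborel_integrable_real_affine[OF int]) (use d in simp)
  then have "integrable lborel (\<lambda>t. (1 / sqrt (2 * pi)) *\<^sub>R ?g t)"
    by (simp only: eq)
  then show "integrable lborel ?g"
    using integrable_scaleR_iff[of "1 / sqrt (2 * pi)" lborel ?g] by simp
  have "(\<integral>x. ?f x \<partial>lborel) = \<bar>sqrt \<delta>\<bar> *\<^sub>R (\<integral>t. ?f (0 + sqrt \<delta> * t) \<partial>lborel)"
    using d by (intro lborel_integral_real_affine) simp
  then have *: "of_real (exp (- a\<^sup>2 / (2 * \<delta>))) = sqrt \<delta> *\<^sub>R (1 / sqrt (2 * pi)) *\<^sub>R (\<integral>t. ?g t \<partial>lborel)"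
    unfolding val eq integral_scaleR_right using d by simp
  have "(\<integral>t. ?g t \<partial>lborel) = (sqrt (2 * pi) / sqrt \<delta>) *\<^sub>R of_real (exp (- a\<^sup>2 / (2 * \<delta>)))"
    unfolding * scaleR_scaleR using d by simp
  then show "(\<integral>t. ?g t \<partial>lborel) = of_real (sqrt (2 * pi / \<delta>) * exp (- a\<^sup>2 / (2 * \<delta>)))"
    by (simp only: scaleR_conv_of_real real_sqrt_divide of_real_mult)
qed

text \<open>Both factors of the integrand are products over the coordinates, and Lebesgue measure is a
  product measure, so the one-dimensional formula gives the general one.\<close>

lemma gaussian_integral:
  fixes a :: "'a::euclidean_space"
  assumes d: "0 < \<delta>"
  shows "integrable lborel (\<lambda>\<xi>::'a. cis (\<xi> \<bullet> a) * of_real (exp (- \<delta> * (norm \<xi>)\<^sup>2 / 2)))"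
    and "(\<integral>\<xi>. cis (\<xi> \<bullet> a) * of_real (exp (- \<delta> * (norm \<xi>)\<^sup>2 / 2)) \<partial>lborel)
         = of_real (sqrt (2 * pi / \<delta>) ^ DIM('a) * exp (- (norm a)\<^sup>2 / (2 * \<delta>)))"
proof -
  let ?P = "\<Pi>\<^sub>M b\<in>(Basis::'a set). (lborel :: real measure)"
  let ?T = "\<lambda>f. \<Sum>b\<in>(Basis::'a set). f b *\<^sub>R b"
  let ?h = "\<lambda>b t. cis (t * (a \<bullet> b)) * of_real (exp (- \<delta> * t\<^sup>2 / 2)) :: complex"
  let ?G = "\<lambda>\<xi>::'a. cis (\<xi> \<bullet> a) * of_real (exp (- \<delta> * (norm \<xi>)\<^sup>2 / 2)) :: complex"
  interpret product_sigma_finite "\<lambda>b::'a. lborel :: real measure" ..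
  have nrm: "(norm v)\<^sup>2 = (\<Sum>b\<in>Basis. (v \<bullet> b)\<^sup>2)" for v :: 'a
    unfolding power2_norm_eq_inner by (subst euclidean_inner) (simp add: power2_eq_square)
  have inner: "?T f \<bullet> b = f b" if "b \<in> Basis" for f and b :: 'a
    using that by simp
  have G: "?G (?T f) = (\<Prod>b\<in>Basis. ?h b (f b))" for f :: "'a \<Rightarrow> real"
  proof -
    have "cis (?T f \<bullet> a) = (\<Prod>b\<in>Basis. cis (f b * (a \<bullet> b)))"
      by (subst euclidean_inner) (simp add: cis_conv_exp sum_distrib_left exp_sum)
    moreover have "exp (- \<delta> * (norm (?T f))\<^sup>2 / 2) = (\<Prod>b\<in>Basis. exp (- \<delta> * (f b)\<^sup>2 / 2))"
      by (subst nrm) (simp add: sum_distrib_left exp_sum sum_divide_distrib flip: sum_negf)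
    ultimately show ?thesis
      by (simp add: prod.distrib flip: of_real_prod)
  qed
  have T[measurable]: "?T \<in> ?P \<rightarrow>\<^sub>M borel"
    by (auto intro!: borel_measurable_sum)
  have Gm[measurable]: "?G \<in> borel_measurable borel"
    by measurable
  have int: "integrable ?P (\<lambda>f. \<Prod>b\<in>Basis. ?h b (f b))"
    by (rule product_integrable_prod) (use gaussian_integral_real(1)[OF d] in auto)
  show "integrable lborel ?G"
    unfolding lborel_eq[where 'a='a] by (subst integrable_distr_eq[OF T Gm]) (simp only: G int)
  have "(\<integral>\<xi>. ?G \<xi> \<partial>lborel) = (\<integral>f. (\<Prod>b\<in>Basis. ?h b (f b)) \<partial>?P)"
    unfolding lborel_eq[where 'a='a] by (subst integral_distr[OF T Gm]) (simp only: G)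
  also have "\<dots> = (\<Prod>b\<in>Basis. integral\<^sup>L lborel (?h b))"
    by (rule product_integral_prod) (use gaussian_integral_real(1)[OF d] in auto)
  also have "\<dots> = (\<Prod>b\<in>(Basis::'a set). of_real (sqrt (2 * pi / \<delta>) * exp (- (a \<bullet> b)\<^sup>2 / (2 * \<delta>))))"
    by (simp only: gaussian_integral_real(2)[OF d])
  also have "\<dots> = of_real (sqrt (2 * pi / \<delta>) ^ DIM('a) * exp (- (norm a)\<^sup>2 / (2 * \<delta>)))"
    by (simp add: nrm prod.distrib exp_sum sum_divide_distrib flip: of_real_prod sum_negf)
  finally show "(\<integral>\<xi>. ?G \<xi> \<partial>lborel)
      = of_real (sqrt (2 * pi / \<delta>) ^ DIM('a) * exp (- (norm a)\<^sup>2 / (2 * \<delta>)))" .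
qed

section \<open>Inverse Fourier integrals\<close>

text \<open>The centred Gaussian density with covariance \<open>\<delta>\<close> times the identity.\<close>

definition heat :: "real \<Rightarrow> 'a::euclidean_space \<Rightarrow> real" where
  "heat \<delta> x = exp (- (norm x)\<^sup>2 / (2 * \<delta>)) / sqrt (2 * pi * \<delta>) ^ DIM('a)"

definition inv_fourier :: "('a::euclidean_space \<Rightarrow> complex) \<Rightarrow> 'a \<Rightarrow> complex" where
  "inv_fourier \<Phi> x = (\<integral>\<xi>. cis (- (\<xi> \<bullet> x)) * \<Phi> \<xi> \<partial>lborel) / of_real ((2 * pi) ^ DIM('a))"

definition fourier :: "('a::euclidean_space \<Rightarrow> real) \<Rightarrow> 'a \<Rightarrow> complex" where
  "fourier f \<xi> = (\<integral>y. cis (\<xi> \<bullet> y) * of_real (f y) \<partial>lborel)"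

text \<open>The Fourier transform of \<open>heat \<delta>\<close>, used as a convergence factor.\<close>

definition gauss_weight :: "real \<Rightarrow> 'a::euclidean_space \<Rightarrow> complex" where
  "gauss_weight \<delta> \<xi> = of_real (exp (- \<delta> * (norm \<xi>)\<^sup>2 / 2))"

lemma borel_measurable_gauss_weight [measurable]: "gauss_weight \<delta> \<in> borel_measurable borel"
  unfolding gauss_weight_def by measurable

lemma integrable_cis_mult:
  fixes \<Phi> :: "'a::euclidean_space \<Rightarrow> complex"
  assumes "integrable lborel \<Phi>"
  shows "integrable lborel (\<lambda>\<xi>. cis (\<xi> \<bullet> x) * \<Phi> \<xi>)"
  by (rule Bochner_Integration.integrable_bound[OF assms])
     (use borel_measurable_integrable[OF assms] in \<open>auto simp: norm_mult\<close>)

lemma integrable_cis_neg_mult: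
  fixes \<Phi> :: "'a::euclidean_space \<Rightarrow> complex"
  assumes "integrable lborel \<Phi>"
  shows "integrable lborel (\<lambda>\<xi>. cis (- (\<xi> \<bullet> x)) * \<Phi> \<xi>)"
  using integrable_cis_mult[OF assms, of "- x"] by simp

lemma integrable_gauss_weight:
  assumes "0 < \<delta>" shows "integrable lborel (gauss_weight \<delta> :: 'a::euclidean_space \<Rightarrow> complex)"
  using gaussian_integral(1)[OF assms, of "0::'a"] unfolding gauss_weight_def[abs_def] by simp

lemma heat_pos: "0 < \<delta> \<Longrightarrow> 0 < heat \<delta> x"
  unfolding heat_def by (intro divide_pos_pos) auto

lemma borel_measurable_heat [measurable]: "heat \<delta> \<in> borel_measurable borel"
  unfolding heat_def by measurable

lemma inv_fourier_gauss_shift: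
  fixes x b :: "'a::euclidean_space"
  assumes d: "0 < \<delta>"
  shows "inv_fourier (\<lambda>\<xi>. cis (\<xi> \<bullet> b) * gauss_weight \<delta> \<xi>) x = of_real (heat \<delta> (x - b))"
proof -
  have s: "sqrt (2 * pi / \<delta>) = 2 * pi / sqrt (2 * pi * \<delta>)"
    using d by (simp add: real_sqrt_divide real_sqrt_mult field_simps)
  have "inv_fourier (\<lambda>\<xi>. cis (\<xi> \<bullet> b) * gauss_weight \<delta> \<xi>) x
     = (\<integral>\<xi>. cis (\<xi> \<bullet> (b - x)) * of_real (exp (- \<delta> * (norm \<xi>)\<^sup>2 / 2)) \<partial>lborel) / of_real ((2 * pi) ^ DIM('a))"
    unfolding inv_fourier_def gauss_weight_def
    by (simp add: mult.assoc[symmetric] cis_mult inner_diff_right del: mult_minus_left)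
  also have "\<dots> = of_real (heat \<delta> (x - b))"
    unfolding gaussian_integral(2)[OF d] heat_def s norm_minus_commute[of b]
    by (simp add: power_divide field_simps)
  finally show ?thesis .
qed

lemma inv_fourier_gauss:
  fixes x :: "'a::euclidean_space"
  assumes d: "0 < \<delta>"
  shows "inv_fourier (gauss_weight \<delta>) x = of_real (heat \<delta> x)"
  using inv_fourier_gauss_shift[OF d, of 0 x] by simp

lemma integrable_heat:
  assumes "0 < \<delta>" shows "integrable lborel (heat \<delta> :: 'a::euclidean_space \<Rightarrow> real)"
proof -
  have "integrable lborel (\<lambda>x::'a. Re (gauss_weight (1 / \<delta>) x) / sqrt (2 * pi * \<delta>) ^ DIM('a))"
    using integrable_gauss_weight[of "1 / \<delta>"] assms by (intro integrable_divide integrable_Re) auto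
  moreover have "Re (gauss_weight (1 / \<delta>) x) / sqrt (2 * pi * \<delta>) ^ DIM('a) = heat \<delta> x" for x :: 'a
    by (simp add: gauss_weight_def heat_def mult.commute)
  ultimately show ?thesis by simp
qed

lemma integral_heat:
  assumes d: "0 < \<delta>" shows "(\<integral>x. heat \<delta> (x::'a::euclidean_space) \<partial>lborel) = 1"
proof -
  have "of_real (\<integral>x. heat \<delta> (x::'a) \<partial>lborel) = (\<integral>x. of_real (heat \<delta> (x::'a)) \<partial>lborel :: complex)"
    by simp
  also have "\<dots> = (\<integral>\<xi>. cis (\<xi> \<bullet> 0) * of_real (exp (- (1 / \<delta>) * (norm (\<xi>::'a))\<^sup>2 / 2)) \<partial>lborel)
       / of_real (sqrt (2 * pi * \<delta>) ^ DIM('a))"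
    by (simp add: heat_def mult.commute flip: of_real_power)
  also have "\<dots> = of_real (sqrt (2 * pi / (1 / \<delta>)) ^ DIM('a)) / of_real (sqrt (2 * pi * \<delta>) ^ DIM('a))"
    using gaussian_integral(2)[of "1 / \<delta>" "0::'a"] d by simp
  also have "\<dots> = 1"
    using d by simp
  finally show ?thesis
    by (metis of_real_eq_1_iff)
qed

section \<open>The heat kernel as an approximate identity\<close>

lemma exp_mult_power_tendsto_0:
  fixes a :: real assumes a: "0 < a"
  shows "(\<lambda>n. real (Suc n) ^ k * exp (- (a * real (Suc n)))) \<longlonglongrightarrow> 0"
proof -
  have "filterlim (\<lambda>n. a * real (Suc n)) at_top sequentially"
    by (intro filterlim_tendsto_pos_mult_at_top[OF tendsto_const a]
          filterlim_compose[OF filterlim_real_sequentially filterlim_Suc])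
  from filterlim_compose[OF tendsto_power_div_exp_0 this]
  have "(\<lambda>n. (a * real (Suc n)) ^ k / exp (a * real (Suc n))) \<longlonglongrightarrow> 0" .
  then have "(\<lambda>n. (1 / a ^ k) * ((a * real (Suc n)) ^ k / exp (a * real (Suc n)))) \<longlonglongrightarrow> (1 / a ^ k) * 0"
    by (intro tendsto_mult tendsto_const)
  moreover have "(1 / a ^ k) * ((a * real (Suc n)) ^ k / exp (a * real (Suc n)))
      = real (Suc n) ^ k * exp (- (a * real (Suc n)))" for n
    using a by (simp add: power_mult_distrib exp_minus divide_inverse del: of_nat_Suc)
  ultimately show ?thesis by simp
qed

text \<open>Away from the origin the heat kernel is small uniformly (the first bound, used against an
  integrable function) and in mass (the second bound, which trades half of the exponent for a
  heat kernel of twice the variance).\<close>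

lemma heat_le_off_ball:
  fixes w :: "'a::euclidean_space"
  assumes "r \<le> norm w" "0 \<le> r" and N: "1 \<le> N"
  shows "heat (1 / N) w \<le> N ^ DIM('a) * exp (- (r\<^sup>2 / 2 * N))"
    and "heat (1 / N) w \<le> sqrt 2 ^ DIM('a) * exp (- (r\<^sup>2 / 4 * N)) * heat (2 / N) w"
proof -
  have r: "r\<^sup>2 \<le> (norm w)\<^sup>2" using assms by (intro power_mono)
  have heat: "heat \<delta> w = (1 / sqrt (2 * pi * \<delta>)) ^ DIM('a) * exp (- ((norm w)\<^sup>2 / (2 * \<delta>)))" for \<delta>
    by (simp add: heat_def power_one_over)
  have "1 / (2 * pi * (1 / N)) = N / (2 * pi)" by simp
  also have "\<dots> \<le> N / 1"
    using pi_ge_two N by (intro divide_left_mono) auto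
  also have "\<dots> \<le> N\<^sup>2"
    using self_le_power[OF N, of 2] by simp
  finally have "1 / (2 * pi * (1 / N)) \<le> N\<^sup>2" .
  then have "sqrt (1 / (2 * pi * (1 / N))) \<le> N"
    using N by (intro real_le_lsqrt) auto
  then have 1: "1 / sqrt (2 * pi * (1 / N)) \<le> N"
    by (simp only: real_sqrt_divide real_sqrt_one)
  have "heat (1 / N) w = (1 / sqrt (2 * pi * (1 / N))) ^ DIM('a) * exp (- ((norm w)\<^sup>2 / 2 * N))"
    unfolding heat by simp
  also have "\<dots> \<le> N ^ DIM('a) * exp (- (r\<^sup>2 / 2 * N))"
    using r N 1 by (intro mult_mono power_mono) auto
  finally show "heat (1 / N) w \<le> N ^ DIM('a) * exp (- (r\<^sup>2 / 2 * N))" .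
  have s: "sqrt 2 * (1 / sqrt (2 * pi * (2 / N))) = 1 / sqrt (2 * pi * (1 / N))"
  proof -
    have "sqrt (2 * pi * (2 / N)) = sqrt 2 * sqrt (2 * pi * (1 / N))"
      unfolding real_sqrt_mult[symmetric] by simp
    then show ?thesis by simp
  qed
  have "heat (1 / N) w
      = sqrt 2 ^ DIM('a) * (1 / sqrt (2 * pi * (2 / N))) ^ DIM('a)
        * (exp (- ((norm w)\<^sup>2 / 4 * N)) * exp (- ((norm w)\<^sup>2 / (2 * (2 / N)))))"
    unfolding heat s[symmetric] power_mult_distrib by (simp flip: exp_add)
  also have "\<dots> = sqrt 2 ^ DIM('a) * exp (- ((norm w)\<^sup>2 / 4 * N)) * heat (2 / N) w"
    unfolding heat by (simp only: mult_ac)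
  also have "\<dots> \<le> sqrt 2 ^ DIM('a) * exp (- (r\<^sup>2 / 4 * N)) * heat (2 / N) w"
    using r N heat_pos[of "2 / N" w] by (intro mult_mono) auto
  finally show "heat (1 / N) w \<le> sqrt 2 ^ DIM('a) * exp (- (r\<^sup>2 / 4 * N)) * heat (2 / N) w" .
qed

text \<open>No boundedness of \<open>u\<close> is available, so the region away from \<open>x\<close> is treated with the uniform
  smallness of the heat kernel there, and the constant \<open>u x\<close> with the smallness of its mass.\<close>

lemma heat_approximate_identity:
  fixes u :: "'a::euclidean_space \<Rightarrow> complex"
  assumes u: "integrable lborel u" and cont: "isCont u x"
  shows "(\<lambda>n. \<integral>y. of_real (heat (1 / real (Suc n)) (x - y)) * u y \<partial>lborel) \<longlonglongrightarrow> u x"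
proof (rule LIMSEQ_I)
  fix e :: real assume "0 < e"
  then obtain r where r: "0 < r" "\<And>y. norm (y - x) < r \<Longrightarrow> norm (u y - u x) < e / 2"
    using cont unfolding continuous_at_eps_delta dist_norm by (metis half_gt_zero)
  have [measurable]: "u \<in> borel_measurable borel"
    using u by (simp add: borel_measurable_integrable)
  define N where "N n = real (Suc n)" for n
  have Np: "0 < N n" and N1: "1 \<le> N n" for n by (simp_all add: N_def)
  define A where "A n = N n ^ DIM('a) * exp (- (r\<^sup>2 / 2 * N n))" for n
  define B where "B n = sqrt 2 ^ DIM('a) * exp (- (r\<^sup>2 / 4 * N n))" for n
  have hu: "integrable lborel (\<lambda>y. heat (c / N n) (x - y))"
    "(\<integral>y. heat (c / N n) (x - y) \<partial>lborel) = 1" if "0 < c" for n c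
  proof -
    have c: "0 < c / N n" using that Np[of n] by simp
    show "integrable lborel (\<lambda>y. heat (c / N n) (x - y))"
      by (rule integrable_reflect[OF integrable_heat[OF c]])
    show "(\<integral>y. heat (c / N n) (x - y) \<partial>lborel) = 1"
      unfolding integral_reflect[OF borel_measurable_heat] by (rule integral_heat[OF c])
  qed
  have hb: "heat (1 / N n) w \<le> N n ^ DIM('a)" for w :: 'a and n
    using heat_le_off_ball(1)[of 0 w "N n"] N1 by simp
  have hb': "\<bar>heat (1 / N n) w\<bar> \<le> N n ^ DIM('a)" for w :: 'a and n
    using hb[of n w] heat_pos[of "1 / N n" w] Np[of n] by simp
  have hui: "integrable lborel (\<lambda>y. of_real (heat (1 / N n) (x - y)) * u y)" for n
    by (rule Bochner_Integration.integrable_bound[of _ "\<lambda>y. N n ^ DIM('a) *\<^sub>R u y"])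
       (use u hb' Np[of n] in \<open>auto simp: norm_mult intro!: mult_right_mono\<close>)
  have bound: "norm ((\<integral>y. of_real (heat (1 / N n) (x - y)) * u y \<partial>lborel) - u x)
      \<le> e / 2 + A n * (\<integral>y. norm (u y) \<partial>lborel) + B n * norm (u x)" (is "?L \<le> ?R") for n
  proof -
    let ?h = "\<lambda>y. heat (1 / N n) (x - y)"
    have hint: "integrable lborel (\<lambda>y. of_real (?h y) * u x)"
      using hu(1)[of 1 n] by (intro integrable_mult_left integrable_of_real) simp
    have "(\<integral>y. of_real (?h y) * u x \<partial>lborel) = u x"
      using hu[of 1 n] by simp
    then have "(\<integral>y. of_real (?h y) * u y \<partial>lborel) - u x = (\<integral>y. of_real (?h y) * (u y - u x) \<partial>lborel)"
      using Bochner_Integration.integral_diff[OF hui[of n] hint] by (simp add: right_diff_distrib)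
    also have "norm \<dots> \<le> (\<integral>y. norm (of_real (?h y) * (u y - u x)) \<partial>lborel)"
      by (rule integral_norm_bound)
    also have "\<dots> \<le> (\<integral>y. e / 2 * ?h y + A n * norm (u y) + B n * norm (u x) * heat (2 / N n) (x - y) \<partial>lborel)"
    proof (rule integral_mono)
      show "integrable lborel (\<lambda>y. norm (of_real (?h y) * (u y - u x)))"
        using Bochner_Integration.integrable_diff[OF hui[of n] hint] by (simp add: right_diff_distrib)
      show "integrable lborel (\<lambda>y. e / 2 * ?h y + A n * norm (u y) + B n * norm (u x) * heat (2 / N n) (x - y))"
        using hu(1)[of 1 n] hu(1)[of 2 n] u by auto
      fix y
      have h0: "0 \<le> ?h y" "0 \<le> heat (2 / N n) (x - y)" by (auto intro!: less_imp_le heat_pos divide_pos_pos Np)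
      show "norm (of_real (?h y) * (u y - u x))
          \<le> e / 2 * ?h y + A n * norm (u y) + B n * norm (u x) * heat (2 / N n) (x - y)"
      proof (cases "norm (y - x) < r")
        case True
        have "?h y * norm (u y - u x) \<le> ?h y * (e / 2)"
          using h0 r(2)[OF True] by (intro mult_left_mono) auto
        moreover have "0 \<le> A n * norm (u y)" "0 \<le> B n * norm (u x) * heat (2 / N n) (x - y)"
          using h0 Np[of n] by (auto simp: A_def B_def)
        ultimately show ?thesis
          using h0 by (simp add: norm_mult mult.commute)
      next
        case False
        then have w: "r \<le> norm (x - y)" by (simp add: norm_minus_commute)
        have "?h y \<le> A n" "?h y \<le> B n * heat (2 / N n) (x - y)"
          using heat_le_off_ball[OF w _ N1[of n]] r(1) by (simp_all add: A_def B_def)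
        then have "?h y * norm (u y) \<le> A n * norm (u y)"
            "?h y * norm (u x) \<le> B n * heat (2 / N n) (x - y) * norm (u x)"
          by (auto intro: mult_right_mono)
        moreover have "?h y * norm (u y - u x) \<le> ?h y * norm (u y) + ?h y * norm (u x)"
          using h0 norm_triangle_ineq4[of "u y" "u x"]
          by (simp flip: distrib_left add: mult_left_mono)
        moreover have "0 \<le> e / 2 * ?h y" using h0 \<open>0 < e\<close> by simp
        ultimately show ?thesis
          using h0 by (simp add: norm_mult mult.commute mult.left_commute)
      qed
    qed
    also have "\<dots> = ?R"
      using hu[of 1 n] hu[of 2 n] u by simp
    finally show ?thesis .
  qed
  have "A \<longlonglongrightarrow> 0"
    unfolding A_def[abs_def] N_def using r by (intro exp_mult_power_tendsto_0) simp
  moreover have "B \<longlonglongrightarrow> sqrt 2 ^ DIM('a) * 0"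
    unfolding B_def[abs_def] N_def
    using exp_mult_power_tendsto_0[of "r\<^sup>2 / 4" 0] r by (intro tendsto_mult tendsto_const) simp
  ultimately have "(\<lambda>n. e / 2 + A n * (\<integral>y. norm (u y) \<partial>lborel) + B n * norm (u x)) \<longlonglongrightarrow> e / 2 + 0 * (\<integral>y. norm (u y) \<partial>lborel) + (sqrt 2 ^ DIM('a) * 0) * norm (u x)"
    by (intro tendsto_intros)
  then have "\<forall>\<^sub>F n in sequentially. e / 2 + A n * (\<integral>y. norm (u y) \<partial>lborel) + B n * norm (u x) < e"
    by (rule order_tendstoD(2)) (use \<open>0 < e\<close> in simp)
  then obtain n0 where n0: "\<And>n. n \<ge> n0 \<Longrightarrow> e / 2 + A n * (\<integral>y. norm (u y) \<partial>lborel) + B n * norm (u x) < e"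
    by (auto simp: eventually_sequentially)
  show "\<exists>no. \<forall>n\<ge>no. norm ((\<integral>y. of_real (heat (1 / real (Suc n)) (x - y)) * u y \<partial>lborel) - u x) < e"
    using bound[unfolded N_def] n0 by (intro exI[of _ n0]) (meson le_less_trans)
qed

section \<open>Multiplying by a Fourier transform\<close>

lemma borel_measurable_fourier [measurable]:
  fixes f :: "'a::euclidean_space \<Rightarrow> real"
  assumes [measurable]: "f \<in> borel_measurable borel"
  shows "fourier f \<in> borel_measurable borel"
  unfolding fourier_def by measurable

lemma borel_measurable_inv_fourier [measurable]:
  fixes \<Phi> :: "'a::euclidean_space \<Rightarrow> complex"
  assumes [measurable]: "\<Phi> \<in> borel_measurable borel"
  shows "inv_fourier \<Phi> \<in> borel_measurable borel"
  unfolding inv_fourier_def by measurable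

lemma norm_fourier_le:
  fixes f :: "'a::euclidean_space \<Rightarrow> real"
  shows "norm (fourier f \<xi>) \<le> (\<integral>y. \<bar>f y\<bar> \<partial>lborel)"
  unfolding fourier_def by (rule order_trans[OF integral_norm_bound]) (simp add: norm_mult)

lemma norm_inv_fourier_le:
  fixes \<Phi> :: "'a::euclidean_space \<Rightarrow> complex"
  shows "norm (inv_fourier \<Phi> x) \<le> (\<integral>\<xi>. norm (\<Phi> \<xi>) \<partial>lborel) / (2 * pi) ^ DIM('a)"
proof -
  have "norm (\<integral>\<xi>. cis (- (\<xi> \<bullet> x)) * \<Phi> \<xi> \<partial>lborel) \<le> (\<integral>\<xi>. norm (\<Phi> \<xi>) \<partial>lborel)"
    by (rule order_trans[OF integral_norm_bound]) (simp add: norm_mult)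
  then show ?thesis
    by (simp add: inv_fourier_def norm_divide norm_power norm_mult divide_right_mono)
qed

lemma integrable_mult_bounded:
  fixes \<Phi> \<Psi> :: "'a::euclidean_space \<Rightarrow> complex"
  assumes \<Phi>: "integrable lborel \<Phi>" and [measurable]: "\<Psi> \<in> borel_measurable borel"
    and bd: "\<And>\<xi>. norm (\<Psi> \<xi>) \<le> C"
  shows "integrable lborel (\<lambda>\<xi>. \<Phi> \<xi> * \<Psi> \<xi>)"
proof (rule Bochner_Integration.integrable_bound[of _ "\<lambda>\<xi>. C *\<^sub>R \<Phi> \<xi>"])
  show "integrable lborel (\<lambda>\<xi>. C *\<^sub>R \<Phi> \<xi>)" using \<Phi> by auto
  show "(\<lambda>\<xi>. \<Phi> \<xi> * \<Psi> \<xi>) \<in> borel_measurable lborel"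
    using borel_measurable_integrable[OF \<Phi>] by simp
  have "norm (\<Psi> \<xi>) * norm (\<Phi> \<xi>) \<le> \<bar>C\<bar> * norm (\<Phi> \<xi>)" for \<xi>
    using bd[of \<xi>] by (intro mult_right_mono) auto
  then show "AE \<xi> in lborel. norm (\<Phi> \<xi> * \<Psi> \<xi>) \<le> norm (C *\<^sub>R \<Phi> \<xi>)"
    by (simp add: norm_mult mult.commute)
qed

lemma integrable_mult_fourier:
  fixes \<Phi> :: "'a::euclidean_space \<Rightarrow> complex"
  assumes "integrable lborel \<Phi>" and "integrable lborel f"
  shows "integrable lborel (\<lambda>\<xi>. \<Phi> \<xi> * fourier f \<xi>)"
  using borel_measurable_integrable[OF assms(2)]
  by (intro integrable_mult_bounded[OF assms(1) _ norm_fourier_le]) simp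

lemma integrable_mult_fourier_power:
  fixes \<Phi> :: "'a::euclidean_space \<Rightarrow> complex"
  assumes "integrable lborel \<Phi>" and "integrable lborel f"
  shows "integrable lborel (\<lambda>\<xi>. \<Phi> \<xi> * fourier f \<xi> ^ n)"
  using integrable_mult_fourier[OF _ assms(2)] assms(1)
  by (induction n) (auto simp: mult.assoc[symmetric] power_Suc2 simp del: power_Suc)

text \<open>Fubini's theorem: the convolution is read off on the Fourier side, before anything is known about
  the decay of \<open>inv_fourier \<Phi>\<close>.\<close>

lemma inv_fourier_mult_fourier:
  fixes \<Phi> :: "'a::euclidean_space \<Rightarrow> complex"
  assumes \<Phi>: "integrable lborel \<Phi>" and f: "integrable lborel f"
  shows "inv_fourier (\<lambda>\<xi>. \<Phi> \<xi> * fourier f \<xi>) x = (\<integral>y. inv_fourier \<Phi> (x - y) * of_real (f y) \<partial>lborel)"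
proof -
  let ?g = "\<lambda>\<xi> y. cis (- (\<xi> \<bullet> x)) * \<Phi> \<xi> * (cis (\<xi> \<bullet> y) * of_real (f y))"
  have [measurable]: "\<Phi> \<in> borel_measurable borel" "f \<in> borel_measurable borel"
    using \<Phi> f by (simp_all add: borel_measurable_integrable)
  have int: "integrable (lborel \<Otimes>\<^sub>M lborel) (case_prod ?g)"
  proof (rule lborel_pair.Fubini_integrable)
    show "case_prod ?g \<in> borel_measurable (lborel \<Otimes>\<^sub>M lborel)" by measurable
    show "integrable lborel (\<lambda>\<xi>. \<integral>y. norm (case (\<xi>, y) of (\<xi>, y) \<Rightarrow> ?g \<xi> y) \<partial>lborel)"
      using \<Phi> by (simp add: norm_mult)
    show "AE \<xi> in lborel. integrable lborel (\<lambda>y. case (\<xi>, y) of (\<xi>, y) \<Rightarrow> ?g \<xi> y)"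
      using integrable_cis_mult[OF integrable_of_real[OF f]] by (simp add: inner_commute)
  qed
  have "inv_fourier (\<lambda>\<xi>. \<Phi> \<xi> * fourier f \<xi>) x = (\<integral>\<xi>. \<integral>y. ?g \<xi> y \<partial>lborel \<partial>lborel) / of_real ((2 * pi) ^ DIM('a))"
    by (simp add: inv_fourier_def fourier_def mult.assoc)
  also have "\<dots> = (\<integral>y. (\<integral>\<xi>. ?g \<xi> y \<partial>lborel) / of_real ((2 * pi) ^ DIM('a)) \<partial>lborel)"
    by (simp add: lborel_pair.Fubini_integral[OF int])
  also have "\<dots> = (\<integral>y. inv_fourier \<Phi> (x - y) * of_real (f y) \<partial>lborel)"
  proof (rule Bochner_Integration.integral_cong[OF refl])
    fix y :: 'a
    have "?g \<xi> y = (cis (- (\<xi> \<bullet> (x - y))) * \<Phi> \<xi>) * of_real (f y)" for \<xi>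
      by (simp add: inner_diff_right cis_mult[symmetric] diff_conv_add_uminus[of "\<xi> \<bullet> y"] mult_ac
               del: add_uminus_conv_diff mult_minus_left)
    then have "(\<integral>\<xi>. ?g \<xi> y \<partial>lborel) = (\<integral>\<xi>. cis (- (\<xi> \<bullet> (x - y))) * \<Phi> \<xi> \<partial>lborel) * of_real (f y)"
      by (simp only: integral_mult_left_zero)
    then show "(\<integral>\<xi>. ?g \<xi> y \<partial>lborel) / of_real ((2 * pi) ^ DIM('a)) = inv_fourier \<Phi> (x - y) * of_real (f y)"
      by (simp only: inv_fourier_def times_divide_eq_left)
  qed
  finally show ?thesis .
qed

text \<open>The compound Poisson series: the exponential is expanded and integrated term by term. By
  \<open>inv_fourier_mult_fourier\<close>, the \<open>n\<close>-th term is an \<open>n\<close>-fold convolution with \<open>f\<close>, divided by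
  \<open>fact n\<close>; properties preserved by convolution with \<open>f\<close> are thus proved by induction on \<open>n\<close> and then
  summed.\<close>

lemma inv_fourier_mult_exp_sums:
  fixes \<Phi> :: "'a::euclidean_space \<Rightarrow> complex"
  assumes \<Phi>: "integrable lborel \<Phi>" and f: "integrable lborel f"
  shows "(\<lambda>n. inv_fourier (\<lambda>\<xi>. \<Phi> \<xi> * fourier f \<xi> ^ n) x / fact n)
      sums inv_fourier (\<lambda>\<xi>. \<Phi> \<xi> * exp (fourier f \<xi>)) x"
proof -
  let ?t = "\<lambda>n \<xi>. cis (- (\<xi> \<bullet> x)) * (\<Phi> \<xi> * fourier f \<xi> ^ n) / fact n"
  let ?A = "\<integral>y. \<bar>f y\<bar> \<partial>lborel"
  have [measurable]: "\<Phi> \<in> borel_measurable borel" "f \<in> borel_measurable borel"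
    using \<Phi> f by (simp_all add: borel_measurable_integrable)
  have nt: "norm (?t n \<xi>) \<le> norm (\<Phi> \<xi>) * (?A ^ n / fact n)" for n \<xi>
    by (auto simp: norm_mult norm_divide norm_power intro!: mult_left_mono divide_right_mono power_mono norm_fourier_le)
  have tint: "integrable lborel (?t n)" for n
    by (intro integrable_divide integrable_cis_neg_mult integrable_mult_fourier_power \<Phi> f)
  have sumA: "summable (\<lambda>n. ?A ^ n / fact n)"
    using summable_exp[of ?A] by (simp add: divide_inverse mult.commute)
  have sn: "summable (\<lambda>n. norm (?t n \<xi>))" for \<xi>
    by (rule summable_comparison_test'[OF summable_mult[OF sumA, of "norm (\<Phi> \<xi>)"]])
       (use nt in auto)
  have "(\<lambda>n. integral\<^sup>L lborel (?t n)) sums (\<integral>\<xi>. (\<Sum>n. ?t n \<xi>) \<partial>lborel)"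
  proof (rule sums_integral[OF tint])
    show "AE \<xi> in lborel. summable (\<lambda>n. norm (?t n \<xi>))" using sn by simp
    have "(\<integral>\<xi>. norm (?t n \<xi>) \<partial>lborel) \<le> (\<integral>\<xi>. norm (\<Phi> \<xi>) \<partial>lborel) * (?A ^ n / fact n)" for n
      using integral_mono[OF integrable_norm[OF tint] _ nt] \<Phi> by simp
    then show "summable (\<lambda>n. \<integral>\<xi>. norm (?t n \<xi>) \<partial>lborel)"
      by (intro summable_comparison_test'[OF summable_mult[OF sumA, of "\<integral>\<xi>. norm (\<Phi> \<xi>) \<partial>lborel"]])
         auto
  qed
  moreover have "(\<Sum>n. ?t n \<xi>) = cis (- (\<xi> \<bullet> x)) * (\<Phi> \<xi> * exp (fourier f \<xi>))" for \<xi>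
  proof -
    have "(\<lambda>n. cis (- (\<xi> \<bullet> x)) * \<Phi> \<xi> * (fourier f \<xi> ^ n /\<^sub>R fact n)) sums (cis (- (\<xi> \<bullet> x)) * \<Phi> \<xi> * exp (fourier f \<xi>))"
      by (intro sums_mult exp_converges)
    then show ?thesis
      by (intro sums_unique[symmetric]) (simp add: scaleR_conv_of_real divide_inverse mult_ac)
  qed
  ultimately have "(\<lambda>n. integral\<^sup>L lborel (?t n) / of_real ((2 * pi) ^ DIM('a)))
      sums ((\<integral>\<xi>. cis (- (\<xi> \<bullet> x)) * (\<Phi> \<xi> * exp (fourier f \<xi>)) \<partial>lborel) / of_real ((2 * pi) ^ DIM('a)))"
    by (intro sums_divide) simp
  then show ?thesis
    by (simp add: inv_fourier_def field_simps)
qed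

section \<open>Multiplying by the exponential of a Fourier transform\<close>

lemma integral_nonneg_Reals:
  fixes f :: "'b \<Rightarrow> complex"
  assumes "\<And>y. f y \<in> \<real>\<^sub>\<ge>\<^sub>0"
  shows "integral\<^sup>L M f \<in> \<real>\<^sub>\<ge>\<^sub>0"
proof -
  have f: "f y = of_real (Re (f y))" and "0 \<le> Re (f y)" for y
    using assms[of y] by (auto simp: complex_nonneg_Reals_iff complex_eq_iff)
  have "f = (\<lambda>y. of_real (Re (f y)))" using f by blast
  then have "integral\<^sup>L M f = of_real (\<integral>y. Re (f y) \<partial>M)"
    by (metis integral_complex_of_real)
  then show ?thesis
    using \<open>\<And>y. 0 \<le> Re (f y)\<close> by (simp add: integral_nonneg)
qed

lemma inv_fourier_power_Suc:
  fixes \<Phi> :: "'a::euclidean_space \<Rightarrow> complex"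
  assumes \<Phi>: "integrable lborel \<Phi>" and f: "integrable lborel f"
  shows "inv_fourier (\<lambda>\<xi>. \<Phi> \<xi> * fourier f \<xi> ^ Suc n) x
    = (\<integral>y. inv_fourier (\<lambda>\<xi>. \<Phi> \<xi> * fourier f \<xi> ^ n) (x - y) * of_real (f y) \<partial>lborel)"
  using inv_fourier_mult_fourier[OF integrable_mult_fourier_power[OF \<Phi> f, of n] f, of x]
  by (simp add: mult.assoc mult.commute[of "fourier f _"])

lemma inv_fourier_power_nonneg:
  fixes \<Phi> :: "'a::euclidean_space \<Rightarrow> complex"
  assumes \<Phi>: "integrable lborel \<Phi>" and f: "integrable lborel f"
    and nn: "\<And>x. inv_fourier \<Phi> x \<in> \<real>\<^sub>\<ge>\<^sub>0" "\<And>y. 0 \<le> f y"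
  shows "inv_fourier (\<lambda>\<xi>. \<Phi> \<xi> * fourier f \<xi> ^ n) x \<in> \<real>\<^sub>\<ge>\<^sub>0"
proof (induction n arbitrary: x)
  case 0
  then show ?case using nn by simp
next
  case (Suc n)
  show ?case
    unfolding inv_fourier_power_Suc[OF \<Phi> f]
    by (intro integral_nonneg_Reals nonneg_Reals_mult_I Suc) (simp add: nn)
qed

lemma inv_fourier_exp_nonneg:
  fixes \<Phi> :: "'a::euclidean_space \<Rightarrow> complex"
  assumes \<Phi>: "integrable lborel \<Phi>" and f: "integrable lborel f"
    and nn: "\<And>x. inv_fourier \<Phi> x \<in> \<real>\<^sub>\<ge>\<^sub>0" "\<And>y. 0 \<le> f y"
  shows "inv_fourier (\<lambda>\<xi>. \<Phi> \<xi> * exp (fourier f \<xi>)) x \<in> \<real>\<^sub>\<ge>\<^sub>0"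
    and "Re (inv_fourier (\<lambda>\<xi>. \<Phi> \<xi> * fourier f \<xi> ^ n) x) / fact n
      \<le> Re (inv_fourier (\<lambda>\<xi>. \<Phi> \<xi> * exp (fourier f \<xi>)) x)"
proof -
  let ?a = "\<lambda>n. inv_fourier (\<lambda>\<xi>. \<Phi> \<xi> * fourier f \<xi> ^ n) x / fact n"
  let ?s = "inv_fourier (\<lambda>\<xi>. \<Phi> \<xi> * exp (fourier f \<xi>)) x"
  have s: "?a sums ?s"
    by (rule inv_fourier_mult_exp_sums[OF \<Phi> f])
  have a: "0 \<le> Re (?a n) \<and> Im (?a n) = 0 \<and> Re (?a n) = Re (inv_fourier (\<lambda>\<xi>. \<Phi> \<xi> * fourier f \<xi> ^ n) x) / fact n" for n
    using inv_fourier_power_nonneg[OF assms, of n x]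
    by (auto simp: complex_nonneg_Reals_iff Re_divide_of_real[of _ "fact n", simplified] Im_divide_of_real[of _ "fact n", simplified])
  have re: "(\<lambda>n. Re (?a n)) sums Re ?s" and im: "(\<lambda>n. Im (?a n)) sums Im ?s"
    using s by (simp_all add: sums_complex_iff)
  have "0 \<le> Re ?s"
    by (rule sums_le[OF _ sums_zero re]) (use a in blast)
  moreover have "(\<lambda>n. 0) sums Im ?s"
    using im a by simp
  then have "Im ?s = 0"
    using sums_unique2 sums_zero by blast
  ultimately show "?s \<in> \<real>\<^sub>\<ge>\<^sub>0"
    by (simp add: complex_nonneg_Reals_iff)
  have "(\<Sum>k\<in>{n}. Re (?a k)) \<le> Re ?s"
    unfolding sums_unique[OF re] by (rule sum_le_suminf[OF sums_summable[OF re]]) (use a in blast)+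
  then show "Re (inv_fourier (\<lambda>\<xi>. \<Phi> \<xi> * fourier f \<xi> ^ n) x) / fact n \<le> Re ?s"
    using a[of n] by simp
qed

text \<open>The weight \<open>exp (\<eta> \<bullet> x)\<close> is multiplicative, so it can be distributed over the factors of every
  convolution in the series.\<close>

lemma inv_fourier_exp_tilt:
  fixes \<Phi> \<Phi>' :: "'a::euclidean_space \<Rightarrow> complex" and f :: "'a \<Rightarrow> real"
  assumes \<Phi>: "integrable lborel \<Phi>" "integrable lborel \<Phi>'"
    and f: "integrable lborel f" "integrable lborel (\<lambda>y. exp (\<eta> \<bullet> y) * f y)"
    and tilt: "\<And>x. of_real (exp (\<eta> \<bullet> x)) * inv_fourier \<Phi> x = inv_fourier \<Phi>' x"
  shows "of_real (exp (\<eta> \<bullet> x)) * inv_fourier (\<lambda>\<xi>. \<Phi> \<xi> * exp (fourier f \<xi>)) x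
    = inv_fourier (\<lambda>\<xi>. \<Phi>' \<xi> * exp (fourier (\<lambda>y. exp (\<eta> \<bullet> y) * f y) \<xi>)) x"
proof -
  let ?f = "\<lambda>y. exp (\<eta> \<bullet> y) * f y"
  have pow: "of_real (exp (\<eta> \<bullet> x)) * inv_fourier (\<lambda>\<xi>. \<Phi> \<xi> * fourier f \<xi> ^ n) x
    = inv_fourier (\<lambda>\<xi>. \<Phi>' \<xi> * fourier ?f \<xi> ^ n) x" for n x
  proof (induction n arbitrary: x)
    case 0
    then show ?case using tilt by simp
  next
    case (Suc n)
    have "of_real (exp (\<eta> \<bullet> x)) * (inv_fourier (\<lambda>\<xi>. \<Phi> \<xi> * fourier f \<xi> ^ n) (x - y) * of_real (f y))
      = inv_fourier (\<lambda>\<xi>. \<Phi>' \<xi> * fourier ?f \<xi> ^ n) (x - y) * of_real (?f y)" for y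
    proof -
      have "exp (\<eta> \<bullet> x) = exp (\<eta> \<bullet> (x - y)) * exp (\<eta> \<bullet> y)"
        by (simp add: inner_diff_right flip: exp_add)
      then have "of_real (exp (\<eta> \<bullet> x)) * (inv_fourier (\<lambda>\<xi>. \<Phi> \<xi> * fourier f \<xi> ^ n) (x - y) * of_real (f y))
        = (of_real (exp (\<eta> \<bullet> (x - y))) * inv_fourier (\<lambda>\<xi>. \<Phi> \<xi> * fourier f \<xi> ^ n) (x - y)) * of_real (?f y)"
        by simp
      then show ?thesis
        by (simp only: Suc)
    qed
    then show ?case
      unfolding inv_fourier_power_Suc[OF \<Phi>(1) f(1)] inv_fourier_power_Suc[OF \<Phi>(2) f(2)]
        integral_mult_right_zero[symmetric] by (simp only:)
  qed
  have "(\<lambda>n. of_real (exp (\<eta> \<bullet> x)) * (inv_fourier (\<lambda>\<xi>. \<Phi> \<xi> * fourier f \<xi> ^ n) x / fact n))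
      sums (of_real (exp (\<eta> \<bullet> x)) * inv_fourier (\<lambda>\<xi>. \<Phi> \<xi> * exp (fourier f \<xi>)) x)"
    by (intro sums_mult inv_fourier_mult_exp_sums \<Phi> f)
  then have "(\<lambda>n. inv_fourier (\<lambda>\<xi>. \<Phi>' \<xi> * fourier ?f \<xi> ^ n) x / fact n)
      sums (of_real (exp (\<eta> \<bullet> x)) * inv_fourier (\<lambda>\<xi>. \<Phi> \<xi> * exp (fourier f \<xi>)) x)"
    unfolding times_divide_eq_right pow .
  then show ?thesis
    using inv_fourier_mult_exp_sums[OF \<Phi>(2) f(2)] by (rule sums_unique2)
qed

text \<open>A profile \<open>h\<close> with \<open>h * h \<le> D h\<close> is stable under convolution up to a factor that grows only
  geometrically in the number of factors, which the factorials absorb.\<close>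

lemma inv_fourier_exp_bound:
  fixes \<Phi> :: "'a::euclidean_space \<Rightarrow> complex" and h :: "'a \<Rightarrow> real"
  assumes \<Phi>: "integrable lborel \<Phi>" and f: "integrable lborel f"
    and bd: "\<And>x. norm (inv_fourier \<Phi> x) \<le> A * h x" "\<And>y. \<bar>f y\<bar> \<le> B * h y"
    and h: "\<And>x. 0 \<le> h x" "\<And>x. integrable lborel (\<lambda>y. h (x - y) * h y)"
      "\<And>x. (\<integral>y. h (x - y) * h y \<partial>lborel) \<le> D * h x"
    and nn: "0 \<le> A" "0 \<le> B" "0 \<le> D"
  shows "norm (inv_fourier (\<lambda>\<xi>. \<Phi> \<xi> * exp (fourier f \<xi>)) x) \<le> A * exp (B * D) * h x"
proof -
  have pow: "norm (inv_fourier (\<lambda>\<xi>. \<Phi> \<xi> * fourier f \<xi> ^ n) x) \<le> A * (B * D) ^ n * h x" for n x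
  proof (induction n arbitrary: x)
    case 0
    then show ?case using bd by simp
  next
    case (Suc n)
    let ?I = "\<lambda>y. inv_fourier (\<lambda>\<xi>. \<Phi> \<xi> * fourier f \<xi> ^ n) (x - y) * of_real (f y)"
    have I: "norm (?I y) \<le> A * (B * D) ^ n * B * (h (x - y) * h y)" for y
    proof -
      have "norm (?I y) \<le> (A * (B * D) ^ n * h (x - y)) * (B * h y)"
        unfolding norm_mult using bd(2)[of y] nn h(1) by (intro mult_mono Suc) auto
      then show ?thesis by (simp only: mult_ac)
    qed
    have "norm (integral\<^sup>L lborel ?I) \<le> (\<integral>y. A * (B * D) ^ n * B * (h (x - y) * h y) \<partial>lborel)"
    proof (cases "integrable lborel ?I")
      case True
      then show ?thesis
        by (intro order_trans[OF integral_norm_bound] integral_mono) (use h(2) I in auto)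
    next
      case False
      then show ?thesis
        using h(1) nn by (auto simp: not_integrable_integral_eq intro!: integral_nonneg mult_nonneg_nonneg)
    qed
    also have "\<dots> \<le> A * (B * D) ^ n * B * (D * h x)"
      using nn h(3)[of x] by (simp add: mult_left_mono)
    finally show ?case
      unfolding inv_fourier_power_Suc[OF \<Phi> f] by (simp add: mult_ac)
  qed
  let ?a = "\<lambda>n. inv_fourier (\<lambda>\<xi>. \<Phi> \<xi> * fourier f \<xi> ^ n) x / fact n"
  have e: "(\<lambda>n. A * h x * ((B * D) ^ n /\<^sub>R fact n)) sums (A * h x * exp (B * D))"
    by (intro sums_mult exp_converges)
  have le: "norm (?a n) \<le> A * h x * ((B * D) ^ n /\<^sub>R fact n)" for n
    using pow[of n x] by (simp add: norm_divide field_simps)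
  have "norm (suminf ?a) \<le> (\<Sum>n. A * h x * ((B * D) ^ n /\<^sub>R fact n))"
    by (rule norm_suminf_le[OF le sums_summable[OF e]])
  then show ?thesis
    unfolding sums_unique[OF e, symmetric] sums_unique[OF inv_fourier_mult_exp_sums[OF \<Phi> f], symmetric]
    by (simp only: mult_ac)
qed

section \<open>Fourier inversion\<close>

lemma norm_gauss_weight_le_1: "0 < \<delta> \<Longrightarrow> norm (gauss_weight \<delta> \<xi>) \<le> 1"
  by (simp add: gauss_weight_def)

lemma norm_gauss_weight_mult_le: "0 < \<delta> \<Longrightarrow> norm (gauss_weight \<delta> \<xi>) * norm w \<le> norm w"
  by (intro mult_left_le_one_le norm_gauss_weight_le_1) auto

lemma gauss_weight_tendsto_1: "(\<lambda>n. gauss_weight (1 / real (Suc n)) \<xi>) \<longlonglongrightarrow> 1"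
proof -
  have "(\<lambda>n. 1 / real (Suc n)) \<longlonglongrightarrow> 0"
    using LIMSEQ_inverse_real_of_nat by (simp add: inverse_eq_divide)
  then have "(\<lambda>n. of_real (exp (- (1 / real (Suc n)) * (norm \<xi>)\<^sup>2 / 2)) :: complex)
      \<longlonglongrightarrow> of_real (exp (- 0 * (norm \<xi>)\<^sup>2 / 2))"
    by (intro tendsto_intros) simp_all
  then show ?thesis by (simp add: gauss_weight_def)
qed

lemma inv_fourier_gauss_limit:
  fixes \<Phi> :: "'a::euclidean_space \<Rightarrow> complex"
  assumes \<Phi>: "integrable lborel \<Phi>"
  shows "(\<lambda>n. inv_fourier (\<lambda>\<xi>. gauss_weight (1 / real (Suc n)) \<xi> * \<Phi> \<xi>) x) \<longlonglongrightarrow> inv_fourier \<Phi> x"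
proof -
  have [measurable]: "\<Phi> \<in> borel_measurable borel"
    using \<Phi> by (simp add: borel_measurable_integrable)
  have "(\<lambda>n. \<integral>\<xi>. cis (- (\<xi> \<bullet> x)) * (gauss_weight (1 / real (Suc n)) \<xi> * \<Phi> \<xi>) \<partial>lborel)
      \<longlonglongrightarrow> (\<integral>\<xi>. cis (- (\<xi> \<bullet> x)) * (1 * \<Phi> \<xi>) \<partial>lborel)"
  proof (rule integral_dominated_convergence[where w="\<lambda>\<xi>. norm (\<Phi> \<xi>)"])
    show "AE \<xi> in lborel. (\<lambda>n. cis (- (\<xi> \<bullet> x)) * (gauss_weight (1 / real (Suc n)) \<xi> * \<Phi> \<xi>))
        \<longlonglongrightarrow> cis (- (\<xi> \<bullet> x)) * (1 * \<Phi> \<xi>)"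
      by (intro AE_I2 tendsto_mult tendsto_const gauss_weight_tendsto_1)
    show "AE \<xi> in lborel. norm (cis (- (\<xi> \<bullet> x)) * (gauss_weight (1 / real (Suc n)) \<xi> * \<Phi> \<xi>)) \<le> norm (\<Phi> \<xi>)" for n
      unfolding norm_mult norm_cis mult_1_left by (intro AE_I2 norm_gauss_weight_mult_le) simp
  qed (use \<Phi> in auto)
  then show ?thesis
    unfolding inv_fourier_def by (intro tendsto_divide tendsto_const) auto
qed

text \<open>With the convergence factor \<open>gauss_weight\<close> the inverse transform of \<open>fourier p\<close> is the convolution
  of \<open>p\<close> with a heat kernel; both sides converge as the variance tends to \<open>0\<close>.\<close>

lemma fourier_inversion:
  fixes p :: "'a::euclidean_space \<Rightarrow> real"
  assumes p: "integrable lborel p" and hat: "integrable lborel (fourier p)" and cont: "isCont p x"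
  shows "inv_fourier (fourier p) x = of_real (p x)"
proof (rule LIMSEQ_unique[OF inv_fourier_gauss_limit[OF hat]])
  have "isCont (\<lambda>y. complex_of_real (p y)) x"
    using cont by (intro continuous_intros)
  from heat_approximate_identity[OF integrable_of_real[OF p] this]
  show "(\<lambda>n. inv_fourier (\<lambda>\<xi>. gauss_weight (1 / real (Suc n)) \<xi> * fourier p \<xi>) x) \<longlonglongrightarrow> of_real (p x)"
    by (simp add: inv_fourier_mult_fourier[OF integrable_gauss_weight p] inv_fourier_gauss del: of_nat_Suc)
qed

text \<open>The dual regularisation: integrating \<open>inv_fourier \<Phi>\<close> against a wide Gaussian is the same as
  averaging \<open>\<Phi>\<close> against a concentrated heat kernel.\<close>

lemma integral_inv_fourier:
  fixes \<Phi> :: "'a::euclidean_space \<Rightarrow> complex"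
  assumes \<Phi>: "integrable lborel \<Phi>" and cont: "isCont \<Phi> 0" and P: "integrable lborel (inv_fourier \<Phi>)"
  shows "(\<integral>x. inv_fourier \<Phi> x \<partial>lborel) = \<Phi> 0"
proof (rule LIMSEQ_unique)
  let ?g = "\<lambda>n (w::'a). exp (- (1 / real (Suc n)) * (norm w)\<^sup>2 / 2)"
  let ?J = "\<lambda>n. \<integral>w. gauss_weight (1 / real (Suc n)) w * inv_fourier \<Phi> w \<partial>lborel"
  have [measurable]: "\<Phi> \<in> borel_measurable borel"
    using \<Phi> by (simp add: borel_measurable_integrable)
  have "?J \<longlonglongrightarrow> (\<integral>w. 1 * inv_fourier \<Phi> w \<partial>lborel)"
  proof (rule integral_dominated_convergence[where w="\<lambda>w. norm (inv_fourier \<Phi> w)"])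
    show "AE w in lborel. (\<lambda>n. gauss_weight (1 / real (Suc n)) w * inv_fourier \<Phi> w) \<longlonglongrightarrow> 1 * inv_fourier \<Phi> w"
      by (intro AE_I2 tendsto_mult tendsto_const gauss_weight_tendsto_1)
    show "AE w in lborel. norm (gauss_weight (1 / real (Suc n)) w * inv_fourier \<Phi> w) \<le> norm (inv_fourier \<Phi> w)" for n
      unfolding norm_mult norm_cis mult_1_left by (intro AE_I2 norm_gauss_weight_mult_le) simp
  qed (use P in auto)
  then show "?J \<longlonglongrightarrow> (\<integral>w. inv_fourier \<Phi> w \<partial>lborel)" by simp
  have "?J n = (\<integral>\<xi>. of_real (heat (1 / real (Suc n)) (0 - \<xi>)) * \<Phi> \<xi> \<partial>lborel)" for n
  proof -
    define \<delta> where "\<delta> = 1 / real (Suc n)"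
    have d: "0 < \<delta>" by (simp add: \<delta>_def)
    let ?G = "\<lambda>w::'a. exp (- \<delta> * (norm w)\<^sup>2 / 2)"
    have Gint: "integrable lborel ?G"
      using integrable_Re[OF integrable_gauss_weight[OF d]] by (simp add: gauss_weight_def)
    have "inv_fourier (gauss_weight \<delta>) (- \<xi>) = fourier ?G \<xi> / of_real ((2 * pi) ^ DIM('a))" for \<xi> :: 'a
      by (simp add: inv_fourier_def fourier_def gauss_weight_def inner_commute)
    then have FG: "fourier ?G \<xi> / of_real ((2 * pi) ^ DIM('a)) = of_real (heat \<delta> (0 - \<xi>))" for \<xi> :: 'a
      using inv_fourier_gauss[OF d] by (metis diff_0)
    have "(\<integral>w. gauss_weight \<delta> w * inv_fourier \<Phi> w \<partial>lborel)
        = (\<integral>y. gauss_weight \<delta> (0 - y) * inv_fourier \<Phi> (0 - y) \<partial>lborel)"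
      by (rule integral_reflect[symmetric]) measurable
    also have "\<dots> = (\<integral>y. inv_fourier \<Phi> (0 - y) * of_real (?G y) \<partial>lborel)"
      by (simp add: gauss_weight_def mult.commute)
    also have "\<dots> = inv_fourier (\<lambda>\<xi>. \<Phi> \<xi> * fourier ?G \<xi>) 0"
      by (rule inv_fourier_mult_fourier[OF \<Phi> Gint, symmetric])
    also have "\<dots> = (\<integral>\<xi>. of_real (heat \<delta> (0 - \<xi>)) * \<Phi> \<xi> \<partial>lborel)"
      unfolding FG[symmetric] by (simp add: inv_fourier_def mult.commute)
    finally show ?thesis unfolding \<delta>_def .
  qed
  then show "?J \<longlonglongrightarrow> \<Phi> 0"
    using heat_approximate_identity[OF \<Phi> cont] by simp
qed

section \<open>Radial integrals\<close>

lemma dyadic_between: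
  fixes t :: real assumes "1 \<le> t"
  shows "\<exists>n::nat. 2 ^ n \<le> t \<and> t \<le> 2 ^ Suc n"
proof -
  have "0 \<le> log 2 t" using assms by simp
  then obtain n :: nat where "real n \<le> log 2 t" "log 2 t < real n + 1"
    by (metis floor_correct of_int_of_nat_eq zero_le_floor zero_le_imp_eq_int of_int_1 of_int_add)
  then have "2 powr real n \<le> t" "t \<le> 2 powr real (Suc n)"
    using assms by (auto simp: le_log_iff log_less_iff add.commute)
  then show ?thesis
    by (intro exI[of _ n]) (simp add: powr_realpow del: of_nat_Suc power_Suc)
qed

lemma cball_borel [measurable, simp]: "cball (c::'a::euclidean_space) r \<in> sets borel"
  by (intro borel_closed closed_cball)

text \<open>A radial integrability test that needs no polar coordinates: the function is dominated by a
  series of multiples of indicators of balls.\<close>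

lemma integrable_of_dyadic_bound:
  fixes g :: "'a::euclidean_space \<Rightarrow> real"
  assumes [measurable]: "g \<in> borel_measurable borel" and g0: "\<And>z. 0 \<le> g z"
    and rc: "\<And>n. 0 \<le> r n" "\<And>n. 0 \<le> c n"
    and g: "\<And>z. g z \<noteq> 0 \<Longrightarrow> \<exists>n. norm z \<le> r n \<and> g z \<le> c n"
    and sm: "summable (\<lambda>n. c n * r n ^ DIM('a))"
  shows "integrable lborel g"
proof (rule integrableI_bounded)
  have le: "ennreal (norm (g z)) \<le> (\<Sum>n. ennreal (c n) * indicator (cball 0 (r n)) z)" for z
  proof (cases "g z = 0")
    case False
    then obtain n where n: "norm z \<le> r n" "g z \<le> c n" using g by blast
    then have "ennreal (norm (g z)) \<le> (\<Sum>k\<in>{n}. ennreal (c k) * indicator (cball 0 (r k)) z)"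
      using g0[of z] by (simp add: ennreal_leI)
    also have "\<dots> \<le> (\<Sum>n. ennreal (c n) * indicator (cball 0 (r n)) z)"
      by (intro sum_le_suminf) auto
    finally show ?thesis .
  qed simp
  have "(\<integral>\<^sup>+ z. ennreal (norm (g z)) \<partial>lborel) \<le> (\<integral>\<^sup>+ z. (\<Sum>n. ennreal (c n) * indicator (cball 0 (r n)) z) \<partial>(lborel :: 'a measure))"
    by (intro nn_integral_mono le)
  also have "\<dots> = (\<Sum>n. ennreal (c n) * emeasure lborel (cball (0::'a) (r n)))"
    by (subst nn_integral_suminf) (measurable, simp add: nn_integral_cmult_indicator)
  also have "\<dots> = (\<Sum>n. ennreal (unit_ball_vol (real DIM('a)) * (c n * r n ^ DIM('a))))"
    using rc by (simp add: emeasure_cball ennreal_mult[symmetric] mult_ac)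
  also have "\<dots> < \<infinity>"
    using rc sm by (subst suminf_ennreal2) (auto intro!: summable_mult)
  finally show "(\<integral>\<^sup>+ z. ennreal (norm (g z)) \<partial>lborel) < \<infinity>" .
qed simp

lemma integrable_powr_unit_ball:
  fixes a :: real assumes a: "0 < a"
  shows "integrable lborel (\<lambda>z::'a::euclidean_space. indicator (cball 0 1) z * norm z powr (a - DIM('a)))"
proof (rule integrable_of_dyadic_bound)
  let ?p = "a - DIM('a)"
  let ?r = "\<lambda>n::nat. (1/2) ^ n :: real"
  let ?c = "\<lambda>n::nat. 2 powr \<bar>?p\<bar> * 2 powr (- (real n * ?p))"
  fix z :: 'a assume "indicator (cball 0 1) z * norm z powr ?p \<noteq> 0"
  then have z: "0 < norm z" "norm z \<le> 1" by (auto simp: indicator_def split: if_splits)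
  then obtain n where n: "2 ^ n \<le> 1 / norm z" "1 / norm z \<le> 2 ^ Suc n"
    using dyadic_between[of "1 / norm z"] by auto
  have "norm z powr ?p \<le> ?c n"
  proof -
    define s where "s = norm z * 2 ^ n"
    have s: "1 / 2 \<le> s" "s \<le> 1" using n z by (auto simp: s_def field_simps)
    have "norm z = s * 2 powr (- real n)" by (simp add: s_def powr_minus powr_realpow field_simps)
    then have "norm z powr ?p = s powr ?p * 2 powr (- (real n * ?p))"
      using s by (simp add: powr_mult powr_powr)
    moreover have "s powr ?p \<le> 2 powr \<bar>?p\<bar>"
    proof (cases "0 \<le> ?p")
      case True
      then have "s powr ?p \<le> 1 powr ?p" using s by (intro powr_mono2) auto
      also have "\<dots> \<le> 2 powr \<bar>?p\<bar>" by (simp add: ge_one_powr_ge_zero)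
      finally show ?thesis .
    next
      case False
      then have "s powr ?p \<le> (1/2) powr ?p" using s by (intro powr_mono2') auto
      also have "\<dots> = 2 powr (- ?p)"
        by (simp only: powr_divide powr_one_eq_one powr_minus_divide)
      also have "- ?p = \<bar>?p\<bar>" using False by simp
      finally show ?thesis .
    qed
    ultimately show ?thesis by (simp add: mult_right_mono)
  qed
  moreover have "norm z \<le> ?r n" using n(1) z by (simp add: field_simps power_divide)
  ultimately show "\<exists>n. norm z \<le> ?r n \<and> indicator (cball 0 1) z * norm z powr ?p \<le> ?c n"
    using z by (intro exI[of _ n]) auto
next
  have "2 powr \<bar>a - DIM('a)\<bar> * 2 powr (- (real n * (a - DIM('a)))) * ((1/2) ^ n) ^ DIM('a)
      = 2 powr \<bar>a - DIM('a)\<bar> * (2 powr (- a)) ^ n" for n :: nat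
  proof -
    have "((1/2::real) ^ n) ^ DIM('a) = 2 powr (- (real n * DIM('a)))"
      by (simp only: power_mult[symmetric] of_nat_mult[symmetric] powr_realpow zero_less_numeral
            powr_minus power_one_over inverse_eq_divide)
    moreover have "(2 powr (- a)) ^ n = 2 powr (- a * real n)"
      by (simp only: powr_powr powr_realpow[symmetric] powr_gt_zero)
    ultimately show ?thesis
      by (simp add: mult.assoc flip: powr_add) (simp add: algebra_simps)
  qed
  moreover have "summable (\<lambda>n. 2 powr \<bar>a - DIM('a)\<bar> * (2 powr (- a)) ^ n)"
    using a by (intro summable_mult summable_geometric) (simp add: powr_less_one)
  ultimately show "summable (\<lambda>n. 2 powr \<bar>a - DIM('a)\<bar> * 2 powr (- (real n * (a - DIM('a)))) * ((1/2) ^ n) ^ DIM('a))"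
    by (simp only:)
qed auto

lemma integrable_powr_outside_ball:
  fixes a :: real assumes a: "0 < a"
  shows "integrable lborel (\<lambda>z::'a::euclidean_space. indicator {z. 1 < norm z} z * norm z powr (- a - DIM('a)))"
proof (rule integrable_of_dyadic_bound)
  let ?p = "- a - DIM('a)"
  let ?r = "\<lambda>n::nat. 2 ^ Suc n :: real"
  let ?c = "\<lambda>n::nat. 2 powr (real n * ?p)"
  fix z :: 'a assume "indicator {z. 1 < norm z} z * norm z powr ?p \<noteq> 0"
  then have z: "1 < norm z" by (auto simp: indicator_def split: if_splits)
  then obtain n where n: "2 ^ n \<le> norm z" "norm z \<le> 2 ^ Suc n"
    using dyadic_between[of "norm z"] by auto
  have "norm z powr ?p \<le> (2 ^ n) powr ?p"
    using n a by (intro powr_mono2') auto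
  also have "\<dots> = ?c n" by (simp add: powr_powr flip: powr_realpow)
  finally show "\<exists>n. norm z \<le> ?r n \<and> indicator {z. 1 < norm z} z * norm z powr ?p \<le> ?c n"
    using n z by (intro exI[of _ n]) auto
next
  have "2 powr (real n * (- a - DIM('a))) * (2 ^ Suc n) ^ DIM('a) = 2 ^ DIM('a) * (2 powr (- a)) ^ n" for n :: nat
  proof -
    have "((2::real) ^ n) ^ DIM('a) = 2 powr (real n * DIM('a))"
      by (simp only: power_mult[symmetric] of_nat_mult[symmetric] powr_realpow zero_less_numeral)
    moreover have "(2 powr (- a)) ^ n = 2 powr (- a * real n)"
      by (simp only: powr_powr powr_realpow[symmetric] powr_gt_zero)
    moreover have "real n * (- a - DIM('a)) + real n * DIM('a) = - a * real n"
      by (simp add: algebra_simps)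
    ultimately show ?thesis
      by (simp add: power_mult_distrib mult.left_commute flip: powr_add)
  qed
  moreover have "summable (\<lambda>n. 2 ^ DIM('a) * (2 powr (- a)) ^ n)"
    using a by (intro summable_mult summable_geometric) (simp add: powr_less_one)
  ultimately show "summable (\<lambda>n. 2 powr (real n * (- a - DIM('a))) * (2 ^ Suc n) ^ DIM('a))"
    by (simp only:)
qed auto

definition poly_weight :: "real \<Rightarrow> 'a::euclidean_space \<Rightarrow> real" where
  "poly_weight q x = (1 + norm x) powr (- q)"

lemma poly_weight_pos: "0 < poly_weight q x"
  by (simp add: poly_weight_def add_pos_nonneg) (metis add_pos_nonneg less_irrefl norm_ge_zero zero_less_one)

lemma borel_measurable_poly_weight [measurable]: "poly_weight q \<in> borel_measurable borel"
  unfolding poly_weight_def by measurable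

lemma integrable_poly_weight:
  fixes q :: real
  assumes q: "DIM('a) < q"
  shows "integrable lborel (poly_weight q :: 'a::euclidean_space \<Rightarrow> real)"
proof (rule integrable_norm_le)
  show "integrable lborel (\<lambda>z::'a. indicator (cball 0 1) z + indicator {z. 1 < norm z} z * norm z powr (- q))"
    using integrable_powr_outside_ball[where 'a='a, of "q - DIM('a)"] q
    by (intro Bochner_Integration.integrable_add integrable_real_indicator emeasure_lborel_cball_finite) auto
  have "poly_weight q z \<le> indicator (cball 0 1) z + indicator {z. 1 < norm z} z * norm z powr (- q)" for z :: 'a
  proof (cases "norm z \<le> 1")
    case True
    have "poly_weight q z \<le> 1 powr (- q)"
      unfolding poly_weight_def using q by (intro powr_mono2') auto
    then show ?thesis using True by simp
  next
    case False
    have "poly_weight q z \<le> norm z powr (- q)"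
      unfolding poly_weight_def using q False by (intro powr_mono2') auto
    then show ?thesis using False by simp
  qed
  then show "norm (poly_weight q z) \<le> indicator (cball 0 1) z + indicator {z. 1 < norm z} z * norm z powr (- q)" for z :: 'a
    by (simp only: real_norm_def abs_of_pos[OF poly_weight_pos])
qed simp

text \<open>One of \<open>x - y\<close> and \<open>y\<close> has norm at least half that of \<open>x\<close>, and its weight is then comparable to
  the weight of \<open>x\<close>. Integrating over \<open>y\<close> gives the stability of the weight under convolution.\<close>

lemma poly_weight_mult_le:
  fixes x y :: "'a::euclidean_space"
  assumes q: "0 < q"
  shows "poly_weight q (x - y) * poly_weight q y \<le> 2 powr q * poly_weight q x * (poly_weight q (x - y) + poly_weight q y)"
proof -
  have *: "poly_weight q w \<le> 2 powr q * poly_weight q x" if "norm x \<le> 1 + 2 * norm w" for w :: 'a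
  proof -
    have "(1 + norm w) powr (- q) \<le> ((1 + norm x) / 2) powr (- q)"
      using q that by (intro powr_mono2') (auto intro: add_pos_nonneg)
    also have "\<dots> = 2 powr q * (1 + norm x) powr (- q)"
      by (simp only: powr_divide powr_minus inverse_divide) (simp only: divide_inverse)
    finally show ?thesis by (simp add: poly_weight_def)
  qed
  have p: "0 \<le> poly_weight q z" for z :: 'a using poly_weight_pos[of q z] by simp
  have "norm x \<le> norm (x - y) + norm y" using norm_triangle_ineq[of "x - y" y] by simp
  then consider "norm x \<le> 1 + 2 * norm (x - y)" | "norm x \<le> 1 + 2 * norm y" by linarith
  then show ?thesis
  proof cases
    case 1
    have "poly_weight q (x - y) * poly_weight q y \<le> 2 powr q * poly_weight q x * poly_weight q y"
      using *[OF 1] p by (intro mult_right_mono) auto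
    then show ?thesis using p by (simp add: distrib_left add_increasing)
  next
    case 2
    have "poly_weight q (x - y) * poly_weight q y \<le> poly_weight q (x - y) * (2 powr q * poly_weight q x)"
      using *[OF 2] p by (intro mult_left_mono) auto
    also have "\<dots> = 2 powr q * poly_weight q x * poly_weight q (x - y)" by (simp only: mult_ac)
    finally show ?thesis using p by (simp add: distrib_left add_increasing2)
  qed
qed

lemma poly_weight_convolution:
  fixes x :: "'a::euclidean_space" and q :: real
  assumes q: "DIM('a) < q"
  shows "integrable lborel (\<lambda>y. poly_weight q (x - y) * poly_weight q y)"
    and "(\<integral>y. poly_weight q (x - y) * poly_weight q y \<partial>lborel)
      \<le> 2 powr q * 2 * (\<integral>y. poly_weight q (y::'a) \<partial>lborel) * poly_weight q x"
proof -
  have q0: "0 < q" using q by (meson le_less_trans of_nat_0_le_iff)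
  let ?R = "\<lambda>y. 2 powr q * poly_weight q x * (poly_weight q (x - y) + poly_weight q y)"
  have i: "integrable lborel (\<lambda>y. poly_weight q (x - y))" "integrable lborel (poly_weight q :: 'a \<Rightarrow> real)"
    using integrable_poly_weight[OF q] integrable_reflect by auto
  have R: "integrable lborel ?R" using i by auto
  have nn: "0 \<le> poly_weight q z" for z :: 'a using poly_weight_pos[of q z] by simp
  show L: "integrable lborel (\<lambda>y. poly_weight q (x - y) * poly_weight q y)"
    by (rule Bochner_Integration.integrable_bound[OF R])
       (use poly_weight_mult_le[OF q0, of x] nn in \<open>auto simp: abs_mult\<close>)
  have "(\<integral>y. poly_weight q (x - y) * poly_weight q y \<partial>lborel) \<le> integral\<^sup>L lborel ?R"
    by (intro integral_mono L R poly_weight_mult_le q0)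
  also have "\<dots> = 2 powr q * 2 * (\<integral>y. poly_weight q (y::'a) \<partial>lborel) * poly_weight q x"
    using i integral_reflect[of "poly_weight q" x] by simp
  finally show "(\<integral>y. poly_weight q (x - y) * poly_weight q y \<partial>lborel)
      \<le> 2 powr q * 2 * (\<integral>y. poly_weight q (y::'a) \<partial>lborel) * poly_weight q x" .
qed

section \<open>The exponent of the small jumps\<close>

abbreviation stable_weight :: "real \<Rightarrow> 'a::euclidean_space \<Rightarrow> real" where
  "stable_weight \<alpha> z \<equiv> norm z powr (- \<alpha> - DIM('a))"

text \<open>As \<open>0 powr a = 0\<close>, the bounds include \<open>k 0 = 0\<close>.\<close>

definition kernel_le :: "real \<Rightarrow> real \<Rightarrow> ('a::euclidean_space \<Rightarrow> real) \<Rightarrow> bool" where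
  "kernel_le \<alpha> c k \<longleftrightarrow> k \<in> borel_measurable borel \<and>
     (\<forall>z. 0 \<le> k z \<and> k z \<le> c * stable_weight \<alpha> z)"

definition stable_like :: "real \<Rightarrow> real \<Rightarrow> ('a::euclidean_space \<Rightarrow> real) \<Rightarrow> bool" where
  "stable_like \<alpha> c k \<longleftrightarrow> kernel_le \<alpha> c k \<and> (\<forall>z. inverse c * stable_weight \<alpha> z \<le> k z)"

text \<open>The value at \<open>z\<close> of the linear form with the complex frequency \<open>\<i>\<xi> + \<eta>\<close>. The exponent at such a
  frequency belongs to the density \<open>exp (\<eta> \<bullet> z) k z\<close>, up to normalisation.\<close>

definition tilted_phase :: "'a::euclidean_space \<Rightarrow> 'a \<Rightarrow> 'a \<Rightarrow> complex" where
  "tilted_phase \<eta> \<xi> z = Complex (\<eta> \<bullet> z) (\<xi> \<bullet> z)"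

abbreviation small_integrand :: "('a::euclidean_space \<Rightarrow> real) \<Rightarrow> 'a \<Rightarrow> 'a \<Rightarrow> 'a \<Rightarrow> complex" where
  "small_integrand k \<eta> \<xi> z \<equiv> of_real (indicator (cball 0 1) z * k z)
     * (exp (tilted_phase \<eta> \<xi> z) - 1 - tilted_phase \<eta> \<xi> z)"

definition small_exponent :: "('a::euclidean_space \<Rightarrow> real) \<Rightarrow> 'a \<Rightarrow> 'a \<Rightarrow> complex" where
  "small_exponent k \<eta> \<xi> = (\<integral>z. small_integrand k \<eta> \<xi> z \<partial>lborel)"

text \<open>A bound for \<open>|z|\<^sup>2 k(z)\<close> on the unit ball, up to a constant; its integral \<open>small_moment\<close> controls
  the second moment of the small jumps.\<close>

abbreviation small_weight :: "real \<Rightarrow> 'a::euclidean_space \<Rightarrow> real" where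
  "small_weight \<alpha> z \<equiv> indicator (cball 0 1) z * norm z powr (2 - \<alpha> - DIM('a))"

definition small_moment :: "real \<Rightarrow> 'a::euclidean_space itself \<Rightarrow> real" where
  "small_moment \<alpha> T = (\<integral>z. small_weight \<alpha> (z::'a) \<partial>lborel)"

lemma tilted_phase_simps [simp]:
  "Re (tilted_phase \<eta> \<xi> z) = \<eta> \<bullet> z" "Im (tilted_phase \<eta> \<xi> z) = \<xi> \<bullet> z"
  by (simp_all add: tilted_phase_def)

lemma borel_measurable_tilted_phase [measurable]: "tilted_phase \<eta> \<xi> \<in> borel_measurable borel"
proof -
  have "tilted_phase \<eta> \<xi> = (\<lambda>z. of_real (\<eta> \<bullet> z) + \<i> * of_real (\<xi> \<bullet> z))"
    by (auto simp: fun_eq_iff complex_eq_iff)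
  then show ?thesis by simp
qed

lemma borel_measurable_exp_complex [measurable (raw)]:
  "f \<in> borel_measurable M \<Longrightarrow> (\<lambda>x. exp (f x :: complex)) \<in> borel_measurable M"
  by (intro borel_measurable_continuous_on[of exp]) (auto intro!: continuous_intros)

lemma norm_tilted_phase_le: "norm (tilted_phase \<eta> \<xi> z) \<le> (norm \<eta> + norm \<xi>) * norm z"
proof -
  have "norm (tilted_phase \<eta> \<xi> z) \<le> \<bar>\<eta> \<bullet> z\<bar> + \<bar>\<xi> \<bullet> z\<bar>"
    using cmod_le[of "tilted_phase \<eta> \<xi> z"] by simp
  also have "\<dots> \<le> norm \<eta> * norm z + norm \<xi> * norm z"
    by (intro add_mono Cauchy_Schwarz_ineq2)
  finally show ?thesis by (simp add: distrib_right)
qed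

lemma norm_exp_minus_linear_le:
  fixes w :: complex shows "norm (exp w - 1 - w) \<le> exp \<bar>Re w\<bar> * (norm w)\<^sup>2"
  using Taylor_exp[of w 1] by (simp add: algebra_simps power2_eq_square numeral_2_eq_2)

lemma integrable_small_moment:
  fixes \<alpha> :: real
  assumes "\<alpha> < 2"
  shows "integrable lborel (\<lambda>z::'a::euclidean_space. small_weight \<alpha> z)"
  using integrable_powr_unit_ball[of "2 - \<alpha>", where 'a='a] assms by simp

lemma small_moment_nonneg: "0 \<le> small_moment \<alpha> TYPE('a::euclidean_space)"
  unfolding small_moment_def by (intro lebesgue_integral_nonneg) auto

lemma norm2_mult_powr:
  "(norm z)\<^sup>2 * norm z powr (- \<alpha> - D) = norm (z::'a::real_normed_vector) powr (2 - \<alpha> - D)"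
proof (cases "z = 0")
  case False
  then have "(norm z)\<^sup>2 = norm z powr 2" by simp
  then show ?thesis by (simp only: powr_add[symmetric]) (simp add: algebra_simps)
qed simp

lemma small_integrand_bound:
  fixes k :: "'a::euclidean_space \<Rightarrow> real"
  assumes k: "kernel_le \<alpha> c k"
  shows "norm (small_integrand k \<eta> \<xi> z)
    \<le> exp (norm \<eta>) * (norm \<eta> + norm \<xi>)\<^sup>2 * c * small_weight \<alpha> z"
proof (cases "norm z \<le> 1")
  case True
  have kz: "0 \<le> k z" "k z \<le> c * stable_weight \<alpha> z"
    using k by (auto simp: kernel_le_def)
  have "\<bar>\<eta> \<bullet> z\<bar> \<le> norm \<eta>"
    using Cauchy_Schwarz_ineq2[of \<eta> z] mult_left_mono[OF True, of "norm \<eta>"] by simp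
  then have "norm (exp (tilted_phase \<eta> \<xi> z) - 1 - tilted_phase \<eta> \<xi> z) \<le> exp (norm \<eta>) * ((norm \<eta> + norm \<xi>) * norm z)\<^sup>2"
    by (intro order_trans[OF norm_exp_minus_linear_le] mult_mono power_mono norm_tilted_phase_le) auto
  then have "k z * norm (exp (tilted_phase \<eta> \<xi> z) - 1 - tilted_phase \<eta> \<xi> z)
      \<le> (c * stable_weight \<alpha> z) * (exp (norm \<eta>) * ((norm \<eta> + norm \<xi>) * norm z)\<^sup>2)"
    using kz by (intro mult_mono) auto
  also have "\<dots> = exp (norm \<eta>) * (norm \<eta> + norm \<xi>)\<^sup>2 * c * ((norm z)\<^sup>2 * stable_weight \<alpha> z)"
    by (simp only: power_mult_distrib mult_ac)
  finally show ?thesis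
    using True kz by (simp add: norm_mult norm2_mult_powr)
qed simp

lemma integrable_small_integrand:
  fixes k :: "'a::euclidean_space \<Rightarrow> real"
  assumes k: "kernel_le \<alpha> c k" and \<alpha>: "\<alpha> < 2"
  shows "integrable lborel (\<lambda>z. small_integrand k \<eta> \<xi> z)"
proof (rule integrable_norm_le[OF _ _ small_integrand_bound[OF k]])
  have [measurable]: "k \<in> borel_measurable borel" using k by (simp add: kernel_le_def)
  show "small_integrand k \<eta> \<xi> \<in> borel_measurable lborel"
    by measurable
  show "integrable lborel (\<lambda>z::'a. exp (norm \<eta>) * (norm \<eta> + norm \<xi>)\<^sup>2 * c * small_weight \<alpha> z)"
    by (intro integrable_mult_right integrable_small_moment \<alpha>)
qed

lemma norm_small_exponent_le:
  fixes k :: "'a::euclidean_space \<Rightarrow> real"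
  assumes k: "kernel_le \<alpha> c k" and \<alpha>: "\<alpha> < 2"
  shows "norm (small_exponent k \<eta> \<xi>) \<le> exp (norm \<eta>) * (norm \<eta> + norm \<xi>)\<^sup>2 * c * small_moment \<alpha> TYPE('a)"
proof -
  have "norm (small_exponent k \<eta> \<xi>) \<le> (\<integral>z. exp (norm \<eta>) * (norm \<eta> + norm \<xi>)\<^sup>2 * c
      * small_weight \<alpha> (z::'a) \<partial>lborel)"
    unfolding small_exponent_def
    by (intro order_trans[OF integral_norm_bound] integral_mono integrable_norm integrable_small_integrand[OF k \<alpha>]
          small_integrand_bound[OF k] integrable_mult_right integrable_small_moment \<alpha>)
  then show ?thesis unfolding small_moment_def by simp
qed

lemma borel_measurable_small_exponent [measurable]:
  fixes k :: "'a::euclidean_space \<Rightarrow> real"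
  assumes "kernel_le \<alpha> c k"
  shows "small_exponent k \<eta> \<in> borel_measurable borel"
proof -
  have [measurable]: "k \<in> borel_measurable borel" using assms by (simp add: kernel_le_def)
  have [measurable]: "case_prod (tilted_phase \<eta>) \<in> borel_measurable (borel \<Otimes>\<^sub>M borel)"
  proof -
    have "case_prod (tilted_phase \<eta>) = (\<lambda>(\<xi>, z). of_real (\<eta> \<bullet> z) + \<i> * of_real (\<xi> \<bullet> z))"
      by (auto simp: fun_eq_iff complex_eq_iff)
    then show ?thesis by simp
  qed
  show ?thesis unfolding small_exponent_def by measurable
qed

lemma Re_small_exponent_le:
  fixes k :: "'a::euclidean_space \<Rightarrow> real"
  assumes k: "kernel_le \<alpha> c k" and \<alpha>: "\<alpha> < 2" and \<eta>: "norm \<eta> \<le> 1" and c: "0 \<le> c"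
  shows "Re (small_exponent k \<eta> \<xi>) \<le> exp 1 * c * small_moment \<alpha> TYPE('a)"
proof -
  have "Re (small_exponent k \<eta> \<xi>) \<le> Re (small_exponent k \<eta> 0)"
  proof -
    let ?g = "\<lambda>\<xi> z. small_integrand k \<eta> \<xi> z"
    have "Re (?g \<xi> z) \<le> Re (?g 0 z)" for z
    proof -
      have "exp (\<eta> \<bullet> z) * cos (\<xi> \<bullet> z) \<le> exp (\<eta> \<bullet> z) * 1" by (intro mult_left_mono) auto
      then have "(indicator (cball 0 1) z * k z) * (exp (\<eta> \<bullet> z) * cos (\<xi> \<bullet> z) - 1 - \<eta> \<bullet> z)
        \<le> (indicator (cball 0 1) z * k z) * (exp (\<eta> \<bullet> z) - 1 - \<eta> \<bullet> z)"
        using k by (intro mult_left_mono) (auto simp: kernel_le_def)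
      then show ?thesis by (simp add: Re_exp)
    qed
    then have "(\<integral>z. Re (?g \<xi> z) \<partial>lborel) \<le> (\<integral>z. Re (?g 0 z) \<partial>lborel)"
      by (intro integral_mono integrable_Re integrable_small_integrand[OF k \<alpha>])
    then show ?thesis
      unfolding small_exponent_def by (simp only: integral_Re integrable_small_integrand[OF k \<alpha>])
  qed
  also have "\<dots> \<le> norm (small_exponent k \<eta> 0)" by (rule complex_Re_le_cmod)
  also have "\<dots> \<le> exp (norm \<eta>) * (norm \<eta>)\<^sup>2 * c * small_moment \<alpha> TYPE('a)"
    using norm_small_exponent_le[OF k \<alpha>, of \<eta> 0] by simp
  also have "\<dots> \<le> exp 1 * 1 * c * small_moment \<alpha> TYPE('a)"
    using \<eta> c small_moment_nonneg[of \<alpha>, where 'a='a] by (intro mult_right_mono mult_mono) (auto simp: power_le_one)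
  finally show ?thesis by simp
qed

text \<open>The real part at \<open>\<xi>\<close> is the value at \<open>\<xi> = 0\<close>, which is bounded by the second moment, minus the
  integral of \<open>exp (\<eta> \<bullet> z) (1 - cos (\<xi> \<bullet> z)) k z\<close>. The latter is bounded below by its part over a
  ball of radius \<open>1 / (4 |\<xi>|)\<close> around \<open>\<xi> / (2 |\<xi>|\<^sup>2)\<close>: there \<open>\<xi> \<bullet> z\<close> stays in \<open>[1/4, 3/4]\<close> and
  \<open>|z| \<le> 1 / |\<xi>|\<close>, so the density is at least a multiple of \<open>|\<xi>|^(d + \<alpha>)\<close>, and the volume is
  proportional to \<open>|\<xi>|^(-d)\<close>.\<close>

lemma Re_small_exponent_decay:
  fixes k :: "'a::euclidean_space \<Rightarrow> real"
  assumes k: "stable_like \<alpha> c k" and \<alpha>: "0 < \<alpha>" "\<alpha> < 2" and \<eta>: "norm \<eta> \<le> 1" and c: "0 < c"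
    and \<xi>: "1 \<le> norm \<xi>"
  shows "Re (small_exponent k \<eta> \<xi>) \<le> exp 1 * c * small_moment \<alpha> TYPE('a)
    - exp (- 1) * (1 - cos (1/4)) * inverse c * measure lborel (ball (0::'a) 1) / 4 ^ DIM('a) * norm \<xi> powr \<alpha>"
proof -
  let ?D = "real DIM('a)"
  let ?g = "\<lambda>z. small_integrand k \<eta> \<xi> z"
  define A where "A = ball ((1 / (2 * (norm \<xi>)\<^sup>2)) *\<^sub>R \<xi>) (1 / (4 * norm \<xi>))"
  define e where "e = exp (- 1) * (1 - cos (1/4)) * inverse c * norm \<xi> powr (\<alpha> + ?D)"
  have kl: "kernel_le \<alpha> c k" using k by (simp add: stable_like_def)
  have n0: "0 < norm \<xi>" using \<xi> by linarith
  have c14: "0 < 1 - cos (1/4 :: real)"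
    using cos_monotone_0_pi[of 0 "1/4"] pi_gt3 by simp
  have e0: "0 \<le> e" using c c14 by (simp add: e_def)
  have A: "norm z \<le> 1 / norm \<xi> \<and> 1/4 \<le> \<xi> \<bullet> z \<and> \<xi> \<bullet> z \<le> 3/4" if "z \<in> A" for z
  proof -
    define v where "v = z - (1 / (2 * (norm \<xi>)\<^sup>2)) *\<^sub>R \<xi>"
    have v: "norm v \<le> 1 / (4 * norm \<xi>)"
      using that by (simp add: A_def v_def dist_norm norm_minus_commute)
    have z: "z = (1 / (2 * (norm \<xi>)\<^sup>2)) *\<^sub>R \<xi> + v" by (simp add: v_def)
    have "norm z \<le> 1 / (2 * norm \<xi>) + 1 / (4 * norm \<xi>)"
      unfolding z using v n0 by (intro order_trans[OF norm_triangle_ineq] add_mono) (auto simp: power2_eq_square)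
    also have "\<dots> \<le> 1 / norm \<xi>" using n0 by (simp add: field_simps)
    finally have 1: "norm z \<le> 1 / norm \<xi>" .
    have "\<bar>\<xi> \<bullet> v\<bar> \<le> norm \<xi> * (1 / (4 * norm \<xi>))"
      using v by (intro order_trans[OF Cauchy_Schwarz_ineq2] mult_left_mono) auto
    then have "\<bar>\<xi> \<bullet> v\<bar> \<le> 1/4" using n0 by simp
    moreover have "\<xi> \<bullet> z = 1/2 + \<xi> \<bullet> v"
      unfolding z using n0 by (simp add: inner_add_right power2_norm_eq_inner)
    ultimately show ?thesis using 1 by auto
  qed
  have pt: "Re (?g z) \<le> exp 1 * c * small_weight \<alpha> z - e * indicator A z" for z
  proof (cases "norm z \<le> 1")
    case False
    have "1 / norm \<xi> \<le> 1" using \<xi> n0 by simp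
    then have "z \<notin> A" using A[of z] False by linarith
    then show ?thesis using False by simp
  next
    case True
    have kz: "0 \<le> k z" "k z \<le> c * norm z powr (- \<alpha> - ?D)"
      using kl by (auto simp: kernel_le_def)
    let ?a = "\<eta> \<bullet> z"
    have "\<bar>?a\<bar> \<le> norm \<eta> * norm z" by (rule Cauchy_Schwarz_ineq2)
    also have "\<dots> \<le> 1 * norm z" using \<eta> by (intro mult_right_mono) auto
    finally have a: "\<bar>?a\<bar> \<le> norm z" by simp
    have nn: "0 \<le> exp ?a - 1 - ?a" using exp_ge_add_one_self[of ?a] by linarith
    have "exp ?a - 1 - ?a \<le> norm (exp (of_real ?a) - 1 - of_real ?a :: complex)"
      using complex_Re_le_cmod[of "exp (of_real ?a) - 1 - of_real ?a"] by (simp add: Re_exp)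
    also have "\<dots> \<le> exp \<bar>?a\<bar> * \<bar>?a\<bar>\<^sup>2"
      using norm_exp_minus_linear_le[of "of_real ?a"] by simp
    also have "\<dots> \<le> exp 1 * (norm z)\<^sup>2"
      using a True by (intro mult_mono power_mono) auto
    finally have "k z * (exp ?a - 1 - ?a) \<le> (c * norm z powr (- \<alpha> - ?D)) * (exp 1 * (norm z)\<^sup>2)"
      using kz nn by (intro mult_mono) auto
    also have "\<dots> = exp 1 * c * ((norm z)\<^sup>2 * norm z powr (- \<alpha> - ?D))" by (simp only: mult_ac)
    finally have 1: "k z * (exp ?a - 1 - ?a) \<le> exp 1 * c * norm z powr (2 - \<alpha> - ?D)"
      by (simp only: norm2_mult_powr)
    \<comment> \<open>on A the density is at least a multiple of the power of the frequency, and the cosine stays away from 1\<close>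
    have 2: "e * indicator A z \<le> k z * (exp ?a * (1 - cos (\<xi> \<bullet> z)))"
    proof (cases "z \<in> A")
      case False
      then show ?thesis using kz by simp
    next
      case zA: True
      note Az = A[OF zA]
      have z0: "z \<noteq> 0" using Az by auto
      have "norm \<xi> powr (\<alpha> + ?D) = (1 / norm \<xi>) powr (- \<alpha> - ?D)"
        using n0 by (simp add: powr_divide powr_minus_divide[of _ "\<alpha> + ?D", simplified] )
      also have "\<dots> \<le> norm z powr (- \<alpha> - ?D)"
        using Az z0 \<alpha> by (intro powr_mono2') auto
      finally have "inverse c * norm \<xi> powr (\<alpha> + ?D) \<le> inverse c * norm z powr (- \<alpha> - ?D)"
        using c by (intro mult_left_mono) auto
      also have "\<dots> \<le> k z" using k by (simp add: stable_like_def)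
      finally have 3: "inverse c * norm \<xi> powr (\<alpha> + ?D) \<le> k z" .
      have 4: "exp (- 1) \<le> exp ?a" using a True by simp
      have "cos (\<xi> \<bullet> z) \<le> cos (1/4)"
        using Az pi_gt3 by (intro cos_monotone_0_pi_le) auto
      then have "exp (- 1) * (1 - cos (1/4)) \<le> exp ?a * (1 - cos (\<xi> \<bullet> z))"
        using 4 c14 by (intro mult_mono) auto
      then have "(inverse c * norm \<xi> powr (\<alpha> + ?D)) * (exp (- 1) * (1 - cos (1/4))) \<le> k z * (exp ?a * (1 - cos (\<xi> \<bullet> z)))"
        by (rule mult_mono[OF 3]) (use c14 kz in auto)
      then show ?thesis using zA by (simp add: e_def mult_ac)
    qed
    have "Re (?g z) = k z * (exp ?a - 1 - ?a) - k z * (exp ?a * (1 - cos (\<xi> \<bullet> z)))"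
      using True by (simp add: Re_exp algebra_simps)
    then show ?thesis using 1 2 True by simp
  qed
  have Ai: "integrable lborel (\<lambda>z. e * indicator A z :: real)"
    unfolding A_def by (intro integrable_mult_right integrable_real_indicator emeasure_lborel_ball_finite) simp
  have "Re (small_exponent k \<eta> \<xi>) = (\<integral>z. Re (?g z) \<partial>lborel)"
    unfolding small_exponent_def by (simp only: integral_Re integrable_small_integrand[OF kl \<alpha>(2)])
  also have "\<dots> \<le> (\<integral>z. exp 1 * c * small_weight \<alpha> z - e * indicator A z \<partial>lborel)"
    by (intro integral_mono pt integrable_Re integrable_small_integrand[OF kl \<alpha>(2)]
        Bochner_Integration.integrable_diff Ai integrable_mult_right integrable_small_moment \<alpha>)
  also have "\<dots> = exp 1 * c * small_moment \<alpha> TYPE('a) - e * measure lborel A"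
    unfolding small_moment_def
    by (subst Bochner_Integration.integral_diff[OF integrable_mult_right[OF integrable_small_moment[OF \<alpha>(2)]] Ai])
       (simp add: A_def)
  also have "measure lborel A = (1 / (4 * norm \<xi>)) ^ DIM('a) * measure lborel (ball (0::'a) 1)"
    unfolding A_def using n0 content_ball_conv_unit_ball[of "1 / (4 * norm \<xi>)"] by simp
  also have "e * \<dots> = exp (- 1) * (1 - cos (1/4)) * inverse c * measure lborel (ball (0::'a) 1) / 4 ^ DIM('a) * norm \<xi> powr \<alpha>"
    using n0 by (simp add: e_def powr_add powr_realpow power_divide power_mult_distrib)
  finally show ?thesis .
qed

section \<open>Integrability of the transform of the small jumps\<close>

lemma power_le_fact_exp:
  fixes u :: real assumes "0 \<le> u"
  shows "u ^ m \<le> fact m * exp u"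
proof -
  have "(\<Sum>n\<in>{m}. u ^ n /\<^sub>R fact n) \<le> (\<Sum>n. u ^ n /\<^sub>R fact n)"
    using assms by (intro sum_le_suminf summable_exp_generic) auto
  then have "u ^ m / fact m \<le> exp u"
    by (simp add: exp_def divide_inverse mult.commute)
  then show ?thesis by (simp add: field_simps)
qed

text \<open>The exponential beats every power: with \<open>u = c |x|^\<alpha>\<close> and \<open>m \<ge> q / \<alpha>\<close>, one has
  \<open>u ^ m \<le> fact m * exp u\<close>, and \<open>u ^ m\<close> dominates \<open>|x| powr q\<close> for \<open>|x| \<ge> 1\<close>.\<close>

lemma exp_powr_le_poly_weight:
  assumes "0 < \<alpha>" "0 < c" "0 < q"
  shows "\<exists>K>0. \<forall>x::'a::euclidean_space. exp (- (c * norm x powr \<alpha>)) \<le> K * poly_weight q x"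
proof -
  obtain m :: nat where m: "q / \<alpha> \<le> real m" using real_arch_simple by blast
  define K where "K = 2 powr q * (1 + fact m / c ^ m)"
  have Kc: "0 \<le> fact m / c ^ m" using assms by simp
  have bnd: "exp (- (c * norm x powr \<alpha>)) \<le> K * poly_weight q x" for x :: 'a
  proof (cases "norm x \<le> 1")
    case True
    have "exp (- (c * norm x powr \<alpha>)) \<le> 2 powr q * 2 powr (- q)"
      using assms by (simp flip: powr_add)
    also have "\<dots> \<le> K * poly_weight q x"
      unfolding K_def poly_weight_def using True assms Kc
      by (intro mult_mono powr_mono2') (auto simp: distrib_left intro: add_pos_nonneg)
    finally show ?thesis .
  next
    case False
    define t where "t = norm x"
    have t: "1 < t" using False by (simp add: t_def)
    have u: "0 < c * t powr \<alpha>" using assms t by simp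
    have "(c * t powr \<alpha>) ^ m \<le> fact m * exp (c * t powr \<alpha>)"
      using u by (intro power_le_fact_exp) simp
    then have "c ^ m * exp (- (c * t powr \<alpha>)) * (t powr \<alpha>) ^ m \<le> fact m"
      by (simp add: exp_minus field_simps)
    moreover have "t powr q \<le> (t powr \<alpha>) ^ m"
    proof -
      have "t powr q \<le> t powr (\<alpha> * m)"
        using t m assms by (intro powr_mono) (auto simp: field_simps)
      then show ?thesis using t by (simp add: powr_powr flip: powr_realpow)
    qed
    then have "c ^ m * exp (- (c * t powr \<alpha>)) * t powr q \<le> c ^ m * exp (- (c * t powr \<alpha>)) * (t powr \<alpha>) ^ m"
      using assms by (intro mult_left_mono) auto
    ultimately have "c ^ m * exp (- (c * t powr \<alpha>)) * t powr q \<le> fact m" by linarith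
    then have 1: "exp (- (c * t powr \<alpha>)) \<le> fact m / c ^ m * t powr (- q)"
      using assms t by (simp add: powr_minus field_simps)
    have "t powr (- q) \<le> ((1 + t) / 2) powr (- q)"
      using t assms by (intro powr_mono2') auto
    also have "\<dots> = 2 powr q * (1 + t) powr (- q)"
      by (simp only: powr_divide powr_minus inverse_divide) (simp only: divide_inverse)
    finally have "fact m / c ^ m * t powr (- q) \<le> fact m / c ^ m * (2 powr q * (1 + t) powr (- q))"
      using Kc by (intro mult_left_mono) auto
    also have "\<dots> = (2 powr q * (1 + t) powr (- q)) * (fact m / c ^ m)" by (simp only: mult_ac)
    also have "\<dots> \<le> (2 powr q * (1 + t) powr (- q)) * (1 + fact m / c ^ m)"
      by (intro mult_left_mono) auto
    also have "\<dots> = K * poly_weight q x"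
      unfolding K_def poly_weight_def t_def[symmetric] by (simp only: mult_ac)
    finally show ?thesis using 1 unfolding t_def by linarith
  qed
  have "0 < K" using assms Kc by (simp add: K_def add_pos_nonneg)
  with bnd show ?thesis by blast
qed

text \<open>The constant in front of \<open>|\<xi>|^\<alpha>\<close> in \<open>Re_small_exponent_decay\<close>.\<close>

definition decay_const :: "real \<Rightarrow> real \<Rightarrow> 'a::euclidean_space itself \<Rightarrow> real" where
  "decay_const \<alpha> c T = exp (- 1) * (1 - cos (1/4)) * inverse c * measure lborel (ball (0::'a) 1) / 4 ^ DIM('a)"

text \<open>Adding \<open>decay_const\<close> to the exponent extends the bound from \<open>|\<xi>| \<ge> 1\<close> to all \<open>\<xi>\<close>. The majorant
  depends neither on the kernel nor on the tilt, which is the source of uniformity of the final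
  constants.\<close>

definition exp_majorant :: "real \<Rightarrow> real \<Rightarrow> 'a::euclidean_space \<Rightarrow> real" where
  "exp_majorant \<alpha> c \<xi> = exp (exp 1 * c * small_moment \<alpha> TYPE('a) + decay_const \<alpha> c TYPE('a))
     * exp (- (decay_const \<alpha> c TYPE('a) * norm \<xi> powr \<alpha>))"

lemma decay_const_pos: "0 < c \<Longrightarrow> 0 < decay_const \<alpha> c TYPE('a::euclidean_space)"
proof -
  assume "0 < c"
  moreover have "0 < 1 - cos (1/4 :: real)"
    using cos_monotone_0_pi[of 0 "1/4"] pi_gt3 by simp
  moreover have "0 < measure lborel (ball (0::'a) 1)" by (simp add: content_ball_pos)
  ultimately show ?thesis by (simp add: decay_const_def)
qed

abbreviation small_char :: "('a::euclidean_space \<Rightarrow> real) \<Rightarrow> 'a \<Rightarrow> complex" where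
  "small_char k \<equiv> \<lambda>\<xi>. exp (small_exponent k 0 \<xi>)"

lemma norm_exp_small_exponent_le:
  fixes k :: "'a::euclidean_space \<Rightarrow> real"
  assumes k: "stable_like \<alpha> c k" and \<alpha>: "0 < \<alpha>" "\<alpha> < 2" and c: "0 < c" and \<eta>: "norm \<eta> \<le> 1"
  shows "norm (exp (small_exponent k \<eta> \<xi>)) \<le> exp_majorant \<alpha> c \<xi>"
proof -
  let ?d = "decay_const \<alpha> c TYPE('a)"
  have kl: "kernel_le \<alpha> c k" using k by (simp add: stable_like_def)
  have d: "0 < ?d" using c by (rule decay_const_pos)
  have "Re (small_exponent k \<eta> \<xi>) \<le> exp 1 * c * small_moment \<alpha> TYPE('a) + ?d - ?d * norm \<xi> powr \<alpha>"
  proof (cases "1 \<le> norm \<xi>")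
    case True
    show ?thesis
      using Re_small_exponent_decay[OF k \<alpha> \<eta> c True] d by (simp add: decay_const_def)
  next
    case False
    have "norm \<xi> powr \<alpha> \<le> 1 powr \<alpha>" using False \<alpha> by (intro powr_mono2) auto
    then have "?d * norm \<xi> powr \<alpha> \<le> ?d * 1" using d by (intro mult_left_mono) auto
    then show ?thesis
      using Re_small_exponent_le[OF kl \<alpha>(2) \<eta>, of \<xi>] c by simp
  qed
  then show ?thesis
    by (simp add: exp_majorant_def flip: exp_add)
qed

lemma integrable_exp_majorant:
  assumes "0 < \<alpha>" "0 < c"
  shows "integrable lborel (exp_majorant \<alpha> c :: 'a::euclidean_space \<Rightarrow> real)"
proof -
  obtain K where K: "0 < K" "\<And>x::'a. exp (- (decay_const \<alpha> c TYPE('a) * norm x powr \<alpha>)) \<le> K * poly_weight (DIM('a) + 1) x"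
    using exp_powr_le_poly_weight[OF assms(1) decay_const_pos[OF assms(2)], of "DIM('a) + 1"] by auto
  have "integrable lborel (\<lambda>x::'a. exp (- (decay_const \<alpha> c TYPE('a) * norm x powr \<alpha>)))"
  proof (rule integrable_norm_le)
    show "integrable lborel (\<lambda>x::'a. K * poly_weight (DIM('a) + 1) x)"
      by (intro integrable_mult_right integrable_poly_weight) simp
    show "norm (exp (- (decay_const \<alpha> c TYPE('a) * norm x powr \<alpha>))) \<le> K * poly_weight (DIM('a) + 1) x" for x :: 'a
      unfolding real_norm_def abs_exp_cancel by (rule K(2))
  qed simp
  then show ?thesis unfolding exp_majorant_def[abs_def] by (rule integrable_mult_right)
qed

lemma integrable_exp_small_exponent:
  fixes k :: "'a::euclidean_space \<Rightarrow> real"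
  assumes k: "stable_like \<alpha> c k" and \<alpha>: "0 < \<alpha>" "\<alpha> < 2" and c: "0 < c" and \<eta>: "norm \<eta> \<le> 1"
  shows "integrable lborel (\<lambda>\<xi>. exp (small_exponent k \<eta> \<xi>))"
proof (rule integrable_norm_le[OF integrable_exp_majorant[OF \<alpha>(1) c] _ norm_exp_small_exponent_le[OF assms]])
  have [measurable]: "small_exponent k \<eta> \<in> borel_measurable borel"
    using k by (intro borel_measurable_small_exponent[of \<alpha> c]) (simp add: stable_like_def)
  show "(\<lambda>\<xi>. exp (small_exponent k \<eta> \<xi>)) \<in> borel_measurable lborel" by measurable
qed

section \<open>Compound Poisson approximation of the small jumps\<close>

definition cut_below :: "real \<Rightarrow> ('a::euclidean_space \<Rightarrow> real) \<Rightarrow> 'a \<Rightarrow> real" where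
  "cut_below \<epsilon> k z = indicator {z. \<epsilon> < norm z} z * k z"

abbreviation cut_seq :: "('a::euclidean_space \<Rightarrow> real) \<Rightarrow> nat \<Rightarrow> 'a \<Rightarrow> real" where
  "cut_seq k n \<equiv> cut_below (1 / real (Suc n)) k"

lemma kernel_le_cut_below: "kernel_le \<alpha> c k \<Longrightarrow> kernel_le \<alpha> c (cut_below \<epsilon> k)"
  unfolding kernel_le_def cut_below_def
  by (auto simp: indicator_def intro: order_trans)

lemma small_exponent_cut_below_tendsto:
  fixes k :: "'a::euclidean_space \<Rightarrow> real"
  assumes k: "kernel_le \<alpha> c k" and \<alpha>: "\<alpha> < 2"
  shows "(\<lambda>n. small_exponent (cut_seq k n) \<eta> \<xi>) \<longlonglongrightarrow> small_exponent k \<eta> \<xi>"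
  unfolding small_exponent_def
proof (rule integral_dominated_convergence)
  have [measurable]: "k \<in> borel_measurable borel" "cut_seq k n \<in> borel_measurable borel" for n
    using k kernel_le_cut_below[OF k] by (simp_all add: kernel_le_def)
  let ?w = "\<lambda>z::'a. exp (norm \<eta>) * (norm \<eta> + norm \<xi>)\<^sup>2 * c * small_weight \<alpha> z"
  show "integrable lborel ?w"
    by (intro integrable_mult_right integrable_small_moment \<alpha>)
  show "AE z in lborel. norm (small_integrand (cut_seq k n) \<eta> \<xi> z) \<le> ?w z" for n
    by (intro AE_I2 small_integrand_bound kernel_le_cut_below k)
  show "AE z in lborel. (\<lambda>n. small_integrand (cut_seq k n) \<eta> \<xi> z) \<longlonglongrightarrow>
      small_integrand k \<eta> \<xi> z"
  proof (intro AE_I2 tendsto_mult tendsto_const tendsto_of_real)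
    fix z :: 'a
    show "(\<lambda>n. cut_seq k n z) \<longlonglongrightarrow> k z"
    proof (cases "z = 0")
      case True
      then have "k z = 0" using k by (force simp: kernel_le_def dest: spec[of _ 0])
      then show ?thesis by (simp add: cut_below_def)
    next
      case False
      have "(\<lambda>n. 1 / real (Suc n)) \<longlonglongrightarrow> 0"
        using LIMSEQ_inverse_real_of_nat by (simp add: inverse_eq_divide)
      then have "\<forall>\<^sub>F n in sequentially. 1 / real (Suc n) < norm z"
        using False by (intro order_tendstoD(2)) auto
      then have "\<forall>\<^sub>F n in sequentially. cut_seq k n z = k z"
        by eventually_elim (simp add: cut_below_def)
      then show ?thesis by (rule tendsto_eventually)
    qed
  qed
  show "(\<lambda>z. small_integrand k \<eta> \<xi> z) \<in> borel_measurable lborel"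
    by measurable
  show "(\<lambda>z. small_integrand (cut_seq k n) \<eta> \<xi> z) \<in> borel_measurable lborel" for n
    by measurable
qed

lemma inv_fourier_cut_below_limit:
  fixes k :: "'a::euclidean_space \<Rightarrow> real"
  assumes k: "kernel_le \<alpha> c k" and \<alpha>: "\<alpha> < 2" and c: "0 \<le> c" and \<eta>: "norm \<eta> \<le> 1"
    and G: "integrable lborel G"
  shows "(\<lambda>n. inv_fourier (\<lambda>\<xi>. G \<xi> * exp (small_exponent (cut_seq k n) \<eta> \<xi>)) x)
    \<longlonglongrightarrow> inv_fourier (\<lambda>\<xi>. G \<xi> * exp (small_exponent k \<eta> \<xi>)) x"
proof -
  have [measurable]: "small_exponent k \<eta> \<in> borel_measurable borel"
    "small_exponent (cut_seq k n) \<eta> \<in> borel_measurable borel" "G \<in> borel_measurable borel" for n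
    using G borel_measurable_small_exponent[OF k] borel_measurable_small_exponent[OF kernel_le_cut_below[OF k]]
    by (auto simp: borel_measurable_integrable)
  let ?C = "exp (exp 1 * c * small_moment \<alpha> TYPE('a))"
  have "(\<lambda>n. \<integral>\<xi>. cis (- (\<xi> \<bullet> x)) * (G \<xi> * exp (small_exponent (cut_seq k n) \<eta> \<xi>)) \<partial>lborel)
      \<longlonglongrightarrow> (\<integral>\<xi>. cis (- (\<xi> \<bullet> x)) * (G \<xi> * exp (small_exponent k \<eta> \<xi>)) \<partial>lborel)"
  proof (rule integral_dominated_convergence[where w="\<lambda>\<xi>. ?C * norm (G \<xi>)"])
    show "integrable lborel (\<lambda>\<xi>. ?C * norm (G \<xi>))"
      using G by (intro integrable_mult_right integrable_norm)
    show "AE \<xi> in lborel. (\<lambda>n. cis (- (\<xi> \<bullet> x)) * (G \<xi> * exp (small_exponent (cut_seq k n) \<eta> \<xi>)))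
        \<longlonglongrightarrow> cis (- (\<xi> \<bullet> x)) * (G \<xi> * exp (small_exponent k \<eta> \<xi>))"
      by (intro AE_I2 tendsto_mult tendsto_const tendsto_exp small_exponent_cut_below_tendsto[OF k \<alpha>])
    show "AE \<xi> in lborel. norm (cis (- (\<xi> \<bullet> x)) * (G \<xi> * exp (small_exponent (cut_seq k n) \<eta> \<xi>)))
        \<le> ?C * norm (G \<xi>)" for n
    proof (intro AE_I2)
      fix \<xi> :: 'a
      have "norm (exp (small_exponent (cut_seq k n) \<eta> \<xi>)) \<le> ?C"
        using Re_small_exponent_le[OF kernel_le_cut_below[OF k] \<alpha> \<eta> c, of "1 / real (Suc n)" \<xi>] by simp
      then show "norm (cis (- (\<xi> \<bullet> x)) * (G \<xi> * exp (small_exponent (cut_seq k n) \<eta> \<xi>)))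
        \<le> ?C * norm (G \<xi>)"
        unfolding norm_mult norm_cis mult_1_left by (subst mult.commute) (intro mult_right_mono norm_ge_zero)
    qed
  qed (measurable)
  then show ?thesis
    unfolding inv_fourier_def by (intro tendsto_divide tendsto_const) auto
qed

lemma inv_fourier_cmult: "inv_fourier (\<lambda>\<xi>. c * \<Phi> \<xi>) x = c * inv_fourier \<Phi> x"
proof -
  have "cis (- (\<xi> \<bullet> x)) * (c * \<Phi> \<xi>) = c * (cis (- (\<xi> \<bullet> x)) * \<Phi> \<xi>)" for \<xi> by (simp only: mult_ac)
  then show ?thesis unfolding inv_fourier_def by (simp only: integral_mult_right_zero times_divide_eq_right)
qed

text \<open>Completing the square: tilting a Gaussian by \<open>exp (\<eta> \<bullet> y)\<close> shifts its mean by \<open>\<delta> \<eta>\<close>.\<close>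

lemma heat_tilt:
  assumes "0 < \<delta>"
  shows "exp (\<delta> * (norm \<eta>)\<^sup>2 / 2) * heat \<delta> (y - \<delta> *\<^sub>R \<eta>) = exp (\<eta> \<bullet> y) * heat \<delta> y"
proof -
  have n: "(norm (y - \<delta> *\<^sub>R \<eta>))\<^sup>2 = (norm y)\<^sup>2 - 2 * \<delta> * (\<eta> \<bullet> y) + \<delta>\<^sup>2 * (norm \<eta>)\<^sup>2"
    unfolding power2_norm_eq_inner by (simp add: inner_simps inner_commute power2_eq_square algebra_simps)
  have "\<delta> * (norm \<eta>)\<^sup>2 / 2 + - (norm (y - \<delta> *\<^sub>R \<eta>))\<^sup>2 / (2 * \<delta>) = \<eta> \<bullet> y + - (norm y)\<^sup>2 / (2 * \<delta>)"
    unfolding n using assms by (simp add: field_simps power2_eq_square)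
  then show ?thesis
    unfolding heat_def times_divide_eq_right by (simp only: exp_add[symmetric])
qed

text \<open>Without the jumps shorter than \<open>\<epsilon>\<close> the kernel is integrable, and the three terms of the integrand
  can be integrated separately: the exponent is a Fourier transform plus a normalisation and a drift.\<close>

lemma small_exponent_cut_below_eq:
  fixes k :: "'a::euclidean_space \<Rightarrow> real"
  assumes k: "kernel_le \<alpha> c k" and \<alpha>: "\<alpha> < 2" and \<epsilon>: "0 < \<epsilon>"
  defines "f \<equiv> \<lambda>z. indicator (cball 0 1) z * cut_below \<epsilon> k z"
  shows "integrable lborel (\<lambda>z. exp (\<eta> \<bullet> z) * f z)"
    and "small_exponent (cut_below \<epsilon> k) \<eta> \<xi> = fourier (\<lambda>z. exp (\<eta> \<bullet> z) * f z) \<xi>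
      - of_real ((\<integral>z. f z \<partial>lborel) + \<eta> \<bullet> (\<integral>z. f z *\<^sub>R z \<partial>lborel)) - \<i> * of_real (\<xi> \<bullet> (\<integral>z. f z *\<^sub>R z \<partial>lborel))"
proof -
  have [measurable]: "k \<in> borel_measurable borel"
    using k by (simp add: kernel_le_def)
  have [measurable]: "f \<in> borel_measurable borel"
    unfolding f_def cut_below_def by measurable
  have f0: "0 \<le> f z" for z using k by (simp add: f_def cut_below_def kernel_le_def)
  have fle: "f z \<le> c / \<epsilon>\<^sup>2 * small_weight \<alpha> z" for z
  proof (cases "norm z \<le> 1 \<and> \<epsilon> < norm z")
    case True
    have p: "0 \<le> stable_weight \<alpha> z" by simp
    have "f z \<le> c * stable_weight \<alpha> z"
      using True k by (simp add: f_def cut_below_def kernel_le_def)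
    moreover from this f0[of z] have "0 \<le> c * stable_weight \<alpha> z" by linarith
    moreover have "1 \<le> (norm z)\<^sup>2 / \<epsilon>\<^sup>2"
      using True \<epsilon> by (simp add: power_mono)
    ultimately have "f z \<le> (norm z)\<^sup>2 / \<epsilon>\<^sup>2 * (c * stable_weight \<alpha> z)"
      by (meson order_trans mult_le_cancel_right1 not_le)
    also have "\<dots> = c / \<epsilon>\<^sup>2 * norm z powr (2 - \<alpha> - DIM('a))"
      unfolding norm2_mult_powr[symmetric] by simp
    finally show ?thesis using True by simp
  next
    case False
    have "0 \<le> c"
    proof -
      obtain b :: 'a where b: "b \<in> Basis" using nonempty_Basis by blast
      then have "0 \<le> c * norm b powr (- \<alpha> - DIM('a))" using k unfolding kernel_le_def by (meson order_trans)
      then show ?thesis using b by simp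
    qed
    then have "0 \<le> c / \<epsilon>\<^sup>2 * small_weight \<alpha> z" by simp
    moreover have "f z = 0" using False by (auto simp: f_def cut_below_def)
    ultimately show ?thesis by simp
  qed
  have fint: "integrable lborel f"
    by (rule integrable_norm_le[OF integrable_mult_right[OF integrable_small_moment[OF \<alpha>], of "c / \<epsilon>\<^sup>2"]])
       (use fle f0 in auto)
  have supp: "norm z \<le> 1" if "f z \<noteq> 0" for z using that by (auto simp: f_def indicator_def split: if_splits)
  have "norm (exp (\<eta> \<bullet> z) * f z) \<le> exp (norm \<eta>) * f z" for \<eta> z
  proof (cases "f z = 0")
    case False
    have "\<eta> \<bullet> z \<le> norm \<eta> * norm z" by (rule norm_cauchy_schwarz)
    also have "\<dots> \<le> norm \<eta> * 1" using supp[OF False] by (intro mult_left_mono) auto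
    finally show ?thesis using f0[of z] by (simp add: abs_mult mult_right_mono)
  qed simp
  then show ei: "integrable lborel (\<lambda>z. exp (\<eta> \<bullet> z) * f z)" for \<eta>
    by (intro Bochner_Integration.integrable_bound[OF integrable_mult_right[OF fint, of "exp (norm \<eta>)"]])
       (auto simp: f0)
  have "norm (f z *\<^sub>R z) \<le> f z" for z
    using supp[of z] f0[of z] by (cases "f z = 0") (auto simp: mult_left_le)
  then have zi: "integrable lborel (\<lambda>z. f z *\<^sub>R z)"
    by (intro Bochner_Integration.integrable_bound[OF fint]) (auto simp: f0)
  have iz: "integrable lborel (\<lambda>z. v \<bullet> (f z *\<^sub>R z))" "(\<integral>z. v \<bullet> (f z *\<^sub>R z) \<partial>lborel) = v \<bullet> (\<integral>z. f z *\<^sub>R z \<partial>lborel)" for v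
    by (rule integrable_inner_right, rule zi) (rule integral_inner_right, rule zi)
  have "of_real (f z) * (exp (tilted_phase \<eta> \<xi> z) - 1 - tilted_phase \<eta> \<xi> z)
      = cis (\<xi> \<bullet> z) * of_real (exp (\<eta> \<bullet> z) * f z) - of_real (f z + \<eta> \<bullet> (f z *\<^sub>R z)) - \<i> * of_real (\<xi> \<bullet> (f z *\<^sub>R z))" for z
  proof -
    have "exp (tilted_phase \<eta> \<xi> z) = of_real (exp (\<eta> \<bullet> z)) * cis (\<xi> \<bullet> z)"
      by (simp add: exp_eq_polar)
    moreover have "tilted_phase \<eta> \<xi> z = of_real (\<eta> \<bullet> z) + \<i> * of_real (\<xi> \<bullet> z)"
      by (simp add: complex_eq_iff)
    ultimately show ?thesis by (simp add: ring_distribs mult_ac)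
  qed
  then have "small_exponent (cut_below \<epsilon> k) \<eta> \<xi> = (\<integral>z. cis (\<xi> \<bullet> z) * of_real (exp (\<eta> \<bullet> z) * f z)
       - of_real (f z + \<eta> \<bullet> (f z *\<^sub>R z)) - \<i> * of_real (\<xi> \<bullet> (f z *\<^sub>R z)) \<partial>lborel)"
    unfolding small_exponent_def f_def[symmetric] by (simp only: f_def)
  also have "\<dots> = (\<integral>z. cis (\<xi> \<bullet> z) * of_real (exp (\<eta> \<bullet> z) * f z) \<partial>lborel)
       - (\<integral>z. of_real (f z + \<eta> \<bullet> (f z *\<^sub>R z)) \<partial>lborel) - (\<integral>z. \<i> * of_real (\<xi> \<bullet> (f z *\<^sub>R z)) \<partial>lborel)"
  proof -
    have 1: "integrable lborel (\<lambda>z. cis (\<xi> \<bullet> z) * of_real (exp (\<eta> \<bullet> z) * f z))"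
      using integrable_cis_mult[OF integrable_of_real[OF ei[of \<eta>]], of \<xi>] by (simp only: inner_commute[of \<xi>])
    have 2: "integrable lborel (\<lambda>z. of_real (f z + \<eta> \<bullet> (f z *\<^sub>R z)) :: complex)"
      by (intro integrable_of_real Bochner_Integration.integrable_add fint iz)
    have 3: "integrable lborel (\<lambda>z. \<i> * of_real (\<xi> \<bullet> (f z *\<^sub>R z)))"
      by (intro integrable_mult_right integrable_of_real iz)
    show ?thesis
      by (simp only: Bochner_Integration.integral_diff 1 2 3 Bochner_Integration.integrable_diff)
  qed
  also have "\<dots> = fourier (\<lambda>z. exp (\<eta> \<bullet> z) * f z) \<xi>
      - of_real ((\<integral>z. f z \<partial>lborel) + \<eta> \<bullet> (\<integral>z. f z *\<^sub>R z \<partial>lborel)) - \<i> * of_real (\<xi> \<bullet> (\<integral>z. f z *\<^sub>R z \<partial>lborel))"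
    by (simp only: fourier_def integral_complex_of_real integral_mult_right_zero Bochner_Integration.integral_add fint iz)
  finally show "small_exponent (cut_below \<epsilon> k) \<eta> \<xi> = fourier (\<lambda>z. exp (\<eta> \<bullet> z) * f z) \<xi>
      - of_real ((\<integral>z. f z \<partial>lborel) + \<eta> \<bullet> (\<integral>z. f z *\<^sub>R z \<partial>lborel)) - \<i> * of_real (\<xi> \<bullet> (\<integral>z. f z *\<^sub>R z \<partial>lborel))" .
qed

text \<open>The transform is that of a shifted Gaussian times the exponential of a Fourier transform, so
  positivity and the effect of a tilt follow from the explicit Gaussian and the convolution
  series.\<close>

lemma cut_below_tilt:
  fixes k :: "'a::euclidean_space \<Rightarrow> real"
  assumes k: "kernel_le \<alpha> c k" and \<alpha>: "\<alpha> < 2" and \<epsilon>: "0 < \<epsilon>" and \<delta>: "0 < \<delta>"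
  shows "inv_fourier (\<lambda>\<xi>. gauss_weight \<delta> \<xi> * exp (small_exponent (cut_below \<epsilon> k) 0 \<xi>)) x \<in> \<real>\<^sub>\<ge>\<^sub>0"
    and "of_real (exp (\<eta> \<bullet> x)) * inv_fourier (\<lambda>\<xi>. gauss_weight \<delta> \<xi> * exp (small_exponent (cut_below \<epsilon> k) 0 \<xi>)) x
      = inv_fourier (\<lambda>\<xi>. of_real (exp (\<delta> * (norm \<eta>)\<^sup>2 / 2)) * (cis (\<xi> \<bullet> (\<delta> *\<^sub>R \<eta>)) * gauss_weight \<delta> \<xi>)
          * exp (small_exponent (cut_below \<epsilon> k) \<eta> \<xi>)) x"
proof -
  define f where "f = (\<lambda>z::'a. indicator (cball 0 1) z * cut_below \<epsilon> k z)"
  define l where "l = (\<integral>z. f z \<partial>lborel)"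
  define b where "b = (\<integral>z. f z *\<^sub>R z \<partial>lborel)"
  have eq: "integrable lborel (\<lambda>z. exp (\<eta> \<bullet> z) * f z)"
    "small_exponent (cut_below \<epsilon> k) \<eta> \<xi> = fourier (\<lambda>z. exp (\<eta> \<bullet> z) * f z) \<xi>
      - of_real (l + \<eta> \<bullet> b) - \<i> * of_real (\<xi> \<bullet> b)" for \<eta> \<xi>
    using small_exponent_cut_below_eq[OF k \<alpha> \<epsilon>, of \<eta>] by (simp_all only: f_def l_def b_def)
  define \<Phi> where "\<Phi> = (\<lambda>\<eta> \<xi>. of_real (exp (\<delta> * (norm \<eta>)\<^sup>2 / 2 - l - \<eta> \<bullet> b)) * (cis (\<xi> \<bullet> (\<delta> *\<^sub>R \<eta> - b)) * gauss_weight \<delta> \<xi>))"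
  have \<Phi>int: "integrable lborel (\<Phi> \<eta>)" for \<eta>
    unfolding \<Phi>_def by (intro integrable_mult_right integrable_cis_mult integrable_gauss_weight \<delta>)
  have f0: "0 \<le> f z" for z using k by (simp add: f_def cut_below_def kernel_le_def)
  have split: "of_real (exp (\<delta> * (norm \<eta>)\<^sup>2 / 2)) * (cis (\<xi> \<bullet> (\<delta> *\<^sub>R \<eta>)) * gauss_weight \<delta> \<xi>)
        * exp (small_exponent (cut_below \<epsilon> k) \<eta> \<xi>) = \<Phi> \<eta> \<xi> * exp (fourier (\<lambda>z. exp (\<eta> \<bullet> z) * f z) \<xi>)" for \<eta> \<xi>
  proof -
    have "exp (small_exponent (cut_below \<epsilon> k) \<eta> \<xi>)
      = exp (fourier (\<lambda>z. exp (\<eta> \<bullet> z) * f z) \<xi>) * (of_real (exp (- l - \<eta> \<bullet> b)) * cis (- (\<xi> \<bullet> b)))"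
      unfolding eq(2) cis_conv_exp exp_of_real[symmetric] mult_exp_exp by (simp add: algebra_simps)
    moreover have "exp (\<delta> * (norm \<eta>)\<^sup>2 / 2 - l - \<eta> \<bullet> b) = exp (\<delta> * (norm \<eta>)\<^sup>2 / 2) * exp (- l - \<eta> \<bullet> b)"
      by (simp flip: exp_add)
    moreover have "cis (\<xi> \<bullet> (\<delta> *\<^sub>R \<eta> - b)) = cis (\<xi> \<bullet> (\<delta> *\<^sub>R \<eta>)) * cis (- (\<xi> \<bullet> b))"
      by (simp add: cis_mult inner_diff_right)
    ultimately show ?thesis by (simp only: \<Phi>_def of_real_mult mult_ac)
  qed
  have inv\<Phi>: "inv_fourier (\<Phi> \<eta>) x = of_real (exp (- l) * exp (\<eta> \<bullet> x) * heat \<delta> (x + b))" for \<eta> x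
  proof -
    have "inv_fourier (\<Phi> \<eta>) x = of_real (exp (\<delta> * (norm \<eta>)\<^sup>2 / 2 - l - \<eta> \<bullet> b) * heat \<delta> (x + b - \<delta> *\<^sub>R \<eta>))"
      unfolding \<Phi>_def inv_fourier_cmult inv_fourier_gauss_shift[OF \<delta>]
      by (simp add: algebra_simps)
    also have "exp (\<delta> * (norm \<eta>)\<^sup>2 / 2 - l - \<eta> \<bullet> b) * heat \<delta> (x + b - \<delta> *\<^sub>R \<eta>)
      = exp (- l - \<eta> \<bullet> b) * (exp (\<delta> * (norm \<eta>)\<^sup>2 / 2) * heat \<delta> (x + b - \<delta> *\<^sub>R \<eta>))"
      by (simp add: mult.assoc[symmetric] flip: exp_add)
    also have "\<dots> = exp (- l) * exp (\<eta> \<bullet> x) * heat \<delta> (x + b)"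
      unfolding heat_tilt[OF \<delta>] mult.assoc[symmetric] exp_add[symmetric] by (simp add: inner_add_right)
    finally show ?thesis .
  qed
  have z: "gauss_weight \<delta> \<xi> * exp (small_exponent (cut_below \<epsilon> k) 0 \<xi>) = \<Phi> 0 \<xi> * exp (fourier f \<xi>)" for \<xi>
    using split[of 0 \<xi>] by simp
  show "inv_fourier (\<lambda>\<xi>. gauss_weight \<delta> \<xi> * exp (small_exponent (cut_below \<epsilon> k) 0 \<xi>)) x \<in> \<real>\<^sub>\<ge>\<^sub>0"
    unfolding z
  proof (rule inv_fourier_exp_nonneg(1)[OF \<Phi>int _ _ f0])
    show "integrable lborel f" using eq(1)[of 0] by simp
    show "inv_fourier (\<Phi> 0) x \<in> \<real>\<^sub>\<ge>\<^sub>0" for x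
      unfolding inv\<Phi> using heat_pos[OF \<delta>, of "x + b"] by simp
  qed
  show "of_real (exp (\<eta> \<bullet> x)) * inv_fourier (\<lambda>\<xi>. gauss_weight \<delta> \<xi> * exp (small_exponent (cut_below \<epsilon> k) 0 \<xi>)) x
      = inv_fourier (\<lambda>\<xi>. of_real (exp (\<delta> * (norm \<eta>)\<^sup>2 / 2)) * (cis (\<xi> \<bullet> (\<delta> *\<^sub>R \<eta>)) * gauss_weight \<delta> \<xi>)
          * exp (small_exponent (cut_below \<epsilon> k) \<eta> \<xi>)) x"
    unfolding z split
  proof (rule inv_fourier_exp_tilt[OF \<Phi>int \<Phi>int _ eq(1)])
    show "integrable lborel f" using eq(1)[of 0] by simp
    show "of_real (exp (\<eta> \<bullet> x)) * inv_fourier (\<Phi> 0) x = inv_fourier (\<Phi> \<eta>) x" for x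
      unfolding inv\<Phi> by simp
  qed
qed

section \<open>The density of the small jumps\<close>

lemma inv_fourier_small_nonneg:
  fixes k :: "'a::euclidean_space \<Rightarrow> real"
  assumes k: "stable_like \<alpha> c k" and \<alpha>: "0 < \<alpha>" "\<alpha> < 2" and c: "0 < c"
  shows "inv_fourier (small_char k) x \<in> \<real>\<^sub>\<ge>\<^sub>0"
proof -
  have kl: "kernel_le \<alpha> c k" using k by (simp add: stable_like_def)
  have "inv_fourier (\<lambda>\<xi>. gauss_weight \<delta> \<xi> * exp (small_exponent k 0 \<xi>)) x \<in> \<real>\<^sub>\<ge>\<^sub>0" if \<delta>: "0 < \<delta>" for \<delta>
    using inv_fourier_cut_below_limit[OF kl \<alpha>(2) less_imp_le[OF c] _ integrable_gauss_weight[OF \<delta>], of 0 x]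
    by (rule closed_sequentially[OF closed_nonneg_Reals_complex, rotated])
       (auto intro!: cut_below_tilt(1)[OF kl \<alpha>(2) _ \<delta>])
  then have "inv_fourier (\<lambda>\<xi>. gauss_weight (1 / real (Suc n)) \<xi> * exp (small_exponent k 0 \<xi>)) x \<in> \<real>\<^sub>\<ge>\<^sub>0" for n
    by simp
  with inv_fourier_gauss_limit[OF integrable_exp_small_exponent[OF k \<alpha> c], of 0 x] show ?thesis
    by (rule closed_sequentially[OF closed_nonneg_Reals_complex, rotated]) simp
qed

text \<open>For a unit vector \<open>\<eta>\<close> in the direction of \<open>x\<close> the factor \<open>exp (\<eta> \<bullet> x)\<close> is \<open>exp |x|\<close>, and the
  product with the density is the inverse transform of a function with an integrable majorant. The
  two limits remove first the truncation of the jumps and then the Gaussian factor.\<close>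

lemma inv_fourier_small_decay:
  fixes k :: "'a::euclidean_space \<Rightarrow> real"
  assumes k: "stable_like \<alpha> c k" and \<alpha>: "0 < \<alpha>" "\<alpha> < 2" and c: "0 < c"
  shows "norm (inv_fourier (small_char k) x)
    \<le> (exp (1/2) * (\<integral>\<xi>. exp_majorant \<alpha> c (\<xi>::'a) \<partial>lborel) / (2 * pi) ^ DIM('a)) * exp (- norm x)"
proof -
  let ?M = "\<integral>\<xi>. exp_majorant \<alpha> c (\<xi>::'a) \<partial>lborel"
  let ?\<Phi> = "\<lambda>\<eta> \<xi>. exp (small_exponent k \<eta> \<xi>)"
  have kl: "kernel_le \<alpha> c k" using k by (simp add: stable_like_def)
  \<comment> \<open>the unit vector in the direction of x, or 0 at the origin\<close>
  obtain \<eta> :: 'a where \<eta>: "norm \<eta> \<le> 1" "\<eta> \<bullet> x = norm x"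
  proof (cases "x = 0")
    case True then show ?thesis using that[of 0] by simp
  next
    case False
    then show ?thesis using that[of "(1 / norm x) *\<^sub>R x"] by (simp add: power2_norm_eq_inner[symmetric] power2_eq_square)
  qed
  have step: "norm (of_real (exp (\<eta> \<bullet> x)) * inv_fourier (\<lambda>\<xi>. gauss_weight \<delta> \<xi> * ?\<Phi> 0 \<xi>) x)
      \<le> exp (1/2) * ?M / (2 * pi) ^ DIM('a)" if \<delta>: "0 < \<delta>" "\<delta> \<le> 1" for \<delta>
  proof -
    let ?G = "\<lambda>\<xi>. of_real (exp (\<delta> * (norm \<eta>)\<^sup>2 / 2)) * (cis (\<xi> \<bullet> (\<delta> *\<^sub>R \<eta>)) * gauss_weight \<delta> \<xi>)"
    have G: "integrable lborel ?G"
      by (intro integrable_mult_right integrable_cis_mult integrable_gauss_weight \<delta>)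
    have "(\<lambda>n. of_real (exp (\<eta> \<bullet> x)) * inv_fourier (\<lambda>\<xi>. gauss_weight \<delta> \<xi> * exp (small_exponent (cut_seq k n) 0 \<xi>)) x)
        \<longlonglongrightarrow> of_real (exp (\<eta> \<bullet> x)) * inv_fourier (\<lambda>\<xi>. gauss_weight \<delta> \<xi> * ?\<Phi> 0 \<xi>) x"
      by (intro tendsto_mult tendsto_const inv_fourier_cut_below_limit[OF kl \<alpha>(2) less_imp_le[OF c]] integrable_gauss_weight \<delta>) simp
    moreover have "(\<lambda>n. of_real (exp (\<eta> \<bullet> x)) * inv_fourier (\<lambda>\<xi>. gauss_weight \<delta> \<xi> * exp (small_exponent (cut_seq k n) 0 \<xi>)) x)
        \<longlonglongrightarrow> inv_fourier (\<lambda>\<xi>. ?G \<xi> * ?\<Phi> \<eta> \<xi>) x"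
      using inv_fourier_cut_below_limit[OF kl \<alpha>(2) less_imp_le[OF c] \<eta>(1) G, of x]
      by (subst cut_below_tilt(2)[OF kl \<alpha>(2) _ \<delta>(1)]) auto
    ultimately have "of_real (exp (\<eta> \<bullet> x)) * inv_fourier (\<lambda>\<xi>. gauss_weight \<delta> \<xi> * ?\<Phi> 0 \<xi>) x = inv_fourier (\<lambda>\<xi>. ?G \<xi> * ?\<Phi> \<eta> \<xi>) x"
      by (rule LIMSEQ_unique)
    also have "norm \<dots> \<le> (\<integral>\<xi>. norm (?G \<xi> * ?\<Phi> \<eta> \<xi>) \<partial>lborel) / (2 * pi) ^ DIM('a)"
      by (rule norm_inv_fourier_le)
    also have "(\<integral>\<xi>. norm (?G \<xi> * ?\<Phi> \<eta> \<xi>) \<partial>lborel) \<le> (\<integral>\<xi>. exp (1/2) * exp_majorant \<alpha> c (\<xi>::'a) \<partial>lborel)"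
    proof (rule integral_mono')
      show "integrable lborel (\<lambda>\<xi>. exp (1/2) * exp_majorant \<alpha> c (\<xi>::'a))"
        by (intro integrable_mult_right integrable_exp_majorant \<alpha> c)
      fix \<xi> :: 'a
      have "\<delta> * (norm \<eta>)\<^sup>2 \<le> 1 * 1" using \<delta> \<eta> by (intro mult_mono) (auto simp: power_le_one)
      then have "norm (?G \<xi>) \<le> exp (1/2) * 1"
        unfolding norm_mult norm_cis mult_1_left using \<delta>(1)
        by (intro mult_mono norm_gauss_weight_le_1) auto
      then show "norm (?G \<xi> * ?\<Phi> \<eta> \<xi>) \<le> exp (1/2) * exp_majorant \<alpha> c \<xi>"
        unfolding norm_mult[of "?G \<xi>"] using norm_exp_small_exponent_le[OF k \<alpha> c \<eta>(1), of \<xi>]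
        by (intro mult_mono) auto
    qed (simp add: exp_majorant_def)
    finally show ?thesis
      by (simp add: divide_right_mono)
  qed
  have "(\<lambda>n. norm (of_real (exp (\<eta> \<bullet> x)) * inv_fourier (\<lambda>\<xi>. gauss_weight (1 / real (Suc n)) \<xi> * ?\<Phi> 0 \<xi>) x))
      \<longlonglongrightarrow> norm (of_real (exp (\<eta> \<bullet> x)) * inv_fourier (?\<Phi> 0) x)"
    by (intro tendsto_norm tendsto_mult tendsto_const inv_fourier_gauss_limit integrable_exp_small_exponent[OF k \<alpha> c]) simp
  then have "norm (of_real (exp (\<eta> \<bullet> x)) * inv_fourier (?\<Phi> 0) x) \<le> exp (1/2) * ?M / (2 * pi) ^ DIM('a)"
    by (rule LIMSEQ_le_const2) (intro exI[of _ 0] allI impI step, auto)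
  then have "exp (norm x) * norm (inv_fourier (?\<Phi> 0) x) \<le> exp (1/2) * ?M / (2 * pi) ^ DIM('a)"
    by (simp add: norm_mult \<eta>)
  then have "exp (- norm x) * (exp (norm x) * norm (inv_fourier (?\<Phi> 0) x)) \<le> exp (- norm x) * (exp (1/2) * ?M / (2 * pi) ^ DIM('a))"
    by (intro mult_left_mono) auto
  then show ?thesis
    by (simp add: mult.assoc[symmetric] mult.commute flip: exp_add)
qed

text \<open>The density of the small jumps: nonnegativity aside, what the large jumps need to know about it,
  with a constant uniform over all kernels. The mass is the value of the transform at \<open>0\<close>.\<close>

lemma small_jump_density:
  assumes \<alpha>: "0 < \<alpha>" "\<alpha> < 2" and c: "0 < c" and q: "real DIM('a) < q"
  shows "\<exists>A>0. \<forall>k :: 'a::euclidean_space \<Rightarrow> real. stable_like \<alpha> c k \<longrightarrow>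
    (\<forall>x. norm (inv_fourier (small_char k) x) \<le> A * poly_weight q x)
    \<and> integrable lborel (inv_fourier (small_char k))
    \<and> (\<integral>x. inv_fourier (small_char k) x \<partial>lborel) = 1"
proof -
  let ?M = "\<integral>\<xi>. exp_majorant \<alpha> c (\<xi>::'a) \<partial>lborel"
  define B where "B = exp (1/2) * ?M / (2 * pi) ^ DIM('a)"
  have "0 \<le> ?M" by (intro lebesgue_integral_nonneg) (simp add: exp_majorant_def)
  then have B: "0 \<le> B" by (simp add: B_def)
  obtain K where K: "0 < K" "\<And>x::'a. exp (- (1 * norm x powr 1)) \<le> K * poly_weight q x"
    using exp_powr_le_poly_weight[of 1 1 q] q by (metis less_trans of_nat_0_less_iff DIM_positive zero_less_one)
  define A where "A = B * K + 1"
  have A: "0 < A" using B K by (simp add: A_def add_nonneg_pos)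
  have "(\<forall>x. norm (inv_fourier (small_char k) x) \<le> A * poly_weight q x)
    \<and> integrable lborel (inv_fourier (small_char k))
    \<and> (\<integral>x. inv_fourier (small_char k) x \<partial>lborel) = 1"
    if k: "stable_like \<alpha> c k" for k :: "'a \<Rightarrow> real"
  proof -
    let ?\<Phi> = "small_char k"
    have kl: "kernel_le \<alpha> c k" using k by (simp add: stable_like_def)
    have \<Phi>: "integrable lborel ?\<Phi>" by (rule integrable_exp_small_exponent[OF k \<alpha> c]) simp
    have bd: "norm (inv_fourier ?\<Phi> x) \<le> A * poly_weight q x" for x
    proof -
      have "norm (inv_fourier ?\<Phi> x) \<le> B * exp (- norm x)"
        using inv_fourier_small_decay[OF k \<alpha> c] by (simp add: B_def)
      also have "\<dots> \<le> B * (K * poly_weight q x)"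
        using B K(2)[of x] by (intro mult_left_mono) auto
      also have "\<dots> \<le> A * poly_weight q x"
        using poly_weight_pos[of q x] by (simp add: A_def distrib_right)
      finally show ?thesis .
    qed
    have int: "integrable lborel (inv_fourier ?\<Phi>)"
    proof (rule integrable_norm_le[OF _ _ bd])
      show "integrable lborel (\<lambda>x::'a. A * poly_weight q x)"
        by (intro integrable_mult_right integrable_poly_weight q)
      show "inv_fourier ?\<Phi> \<in> borel_measurable lborel"
        using borel_measurable_inv_fourier[OF borel_measurable_integrable[OF \<Phi>, simplified]] by simp
    qed
    have "isCont ?\<Phi> 0"
    proof -
      have z: "small_exponent k 0 0 = 0"
        using norm_small_exponent_le[OF kl \<alpha>(2), of 0 0] by simp
      have "((\<lambda>\<xi>::'a. (norm \<xi>)\<^sup>2 * c * small_moment \<alpha> TYPE('a)) \<longlongrightarrow> (norm (0::'a))\<^sup>2 * c * small_moment \<alpha> TYPE('a)) (at 0)"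
        by (intro tendsto_intros)
      then have "(small_exponent k 0 \<longlongrightarrow> 0) (at 0)"
        by (intro Lim_null_comparison[of "small_exponent k 0" "\<lambda>\<xi>. (norm \<xi>)\<^sup>2 * c * small_moment \<alpha> TYPE('a)"])
           (use norm_small_exponent_le[OF kl \<alpha>(2), of 0] in \<open>auto intro!: always_eventually\<close>)
      then have "isCont (small_exponent k 0) 0" by (simp add: isCont_def z)
      then show ?thesis by (intro continuous_intros)
    qed
    from integral_inv_fourier[OF \<Phi> this int]
    have "(\<integral>x. inv_fourier ?\<Phi> x \<partial>lborel) = 1"
      using norm_small_exponent_le[OF kl \<alpha>(2), of 0 0] by simp
    with bd int show ?thesis by blast
  qed
  with A show ?thesis by blast
qed

section \<open>Two-sided bounds for the full jump kernel\<close>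

definition large_part :: "('a::euclidean_space \<Rightarrow> real) \<Rightarrow> 'a \<Rightarrow> real" where
  "large_part k z = indicator {z. 1 < norm z} z * k z"

text \<open>Jumps of norm at most \<open>1\<close> are fully compensated and the others are not compensated at all,
  whatever \<open>\<alpha>\<close> is.\<close>

definition jump_exponent :: "('a::euclidean_space \<Rightarrow> real) \<Rightarrow> 'a \<Rightarrow> complex" where
  "jump_exponent k \<xi> = small_exponent k 0 \<xi> + (fourier (large_part k) \<xi> - of_real (\<integral>z. large_part k z \<partial>lborel))"

lemma large_part_bounds:
  fixes k :: "'a::euclidean_space \<Rightarrow> real"
  assumes k: "kernel_le \<alpha> c k" and \<alpha>: "0 < \<alpha>" and c: "0 < c"
  shows "0 \<le> large_part k z" and "large_part k z \<le> c"
    and "large_part k z \<le> c * 2 powr (\<alpha> + DIM('a)) * poly_weight (\<alpha> + DIM('a)) z"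
    and "large_part k \<in> borel_measurable borel"
    and "integrable lborel (large_part k)"
    and "(\<integral>z. large_part k z \<partial>lborel) \<le> c * (\<integral>z. indicator {z. 1 < norm z} z * stable_weight \<alpha> (z::'a) \<partial>lborel)"
proof -
  have [measurable]: "k \<in> borel_measurable borel" using k by (simp add: kernel_le_def)
  have kz: "0 \<le> k z" "k z \<le> c * stable_weight \<alpha> z" for z
    using k by (auto simp: kernel_le_def)
  show nn: "0 \<le> large_part k z" for z using kz by (simp add: large_part_def)
  show m[measurable]: "large_part k \<in> borel_measurable borel"
    unfolding large_part_def by measurable
  show "large_part k z \<le> c"
  proof (cases "1 < norm z")
    case True
    have "stable_weight \<alpha> z \<le> 1 powr (- \<alpha> - DIM('a))"
      using True \<alpha> by (intro powr_mono2') auto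
    then have "c * stable_weight \<alpha> z \<le> c * 1" using c by (intro mult_left_mono) auto
    then show ?thesis using True kz(2)[of z] by (simp add: large_part_def)
  qed (use c in \<open>simp add: large_part_def\<close>)
  show "large_part k z \<le> c * 2 powr (\<alpha> + DIM('a)) * poly_weight (\<alpha> + DIM('a)) z"
  proof (cases "1 < norm z")
    case True
    have "stable_weight \<alpha> z \<le> ((1 + norm z) / 2) powr (- \<alpha> - DIM('a))"
      using True \<alpha> by (intro powr_mono2') auto
    also have "- \<alpha> - DIM('a) = - (\<alpha> + DIM('a))" by simp
    also have "((1 + norm z) / 2) powr (- (\<alpha> + DIM('a))) = 2 powr (\<alpha> + DIM('a)) * poly_weight (\<alpha> + DIM('a)) z"
      unfolding poly_weight_def
      by (simp only: powr_divide powr_minus inverse_divide) (simp only: divide_inverse)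
    finally have "c * stable_weight \<alpha> z \<le> c * (2 powr (\<alpha> + DIM('a)) * poly_weight (\<alpha> + DIM('a)) z)"
      using c by (intro mult_left_mono) auto
    then show ?thesis using True kz(2)[of z] by (simp add: large_part_def)
  next
    case False
    then show ?thesis using c poly_weight_pos[of "\<alpha> + DIM('a)" z] by (simp add: large_part_def)
  qed
  have le: "large_part k z \<le> c * (indicator {z. 1 < norm z} z * stable_weight \<alpha> z)" for z
    using kz by (simp add: large_part_def indicator_def)
  have oi: "integrable lborel (\<lambda>z::'a. c * (indicator {z. 1 < norm z} z * stable_weight \<alpha> z))"
    by (intro integrable_mult_right integrable_powr_outside_ball \<alpha>)
  show int: "integrable lborel (large_part k)"
    by (rule integrable_norm_le[OF oi]) (simp_all only: real_norm_def abs_of_nonneg[OF nn] le, simp)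
  show "(\<integral>z. large_part k z \<partial>lborel) \<le> c * (\<integral>z. indicator {z. 1 < norm z} z * stable_weight \<alpha> (z::'a) \<partial>lborel)"
    using integral_mono[OF int oi le] by simp
qed

lemma exp_jump_exponent:
  "exp (jump_exponent k \<xi>) = of_real (exp (- (\<integral>z. large_part k z \<partial>lborel)))
     * (exp (small_exponent k 0 \<xi>) * exp (fourier (large_part k) \<xi>))"
  unfolding jump_exponent_def by (simp add: exp_add exp_diff exp_minus exp_of_real divide_inverse mult_ac)

lemma inv_fourier_exp_jump_exponent:
  "inv_fourier (\<lambda>\<xi>. exp (jump_exponent k \<xi>)) x = of_real (exp (- (\<integral>z. large_part k z \<partial>lborel)))
     * inv_fourier (\<lambda>\<xi>. exp (small_exponent k 0 \<xi>) * exp (fourier (large_part k) \<xi>)) x"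
  unfolding exp_jump_exponent by (rule inv_fourier_cmult)

lemma poly_weight_tail:
  assumes q: "real DIM('a) < q" and e: "0 < e"
  shows "\<exists>\<rho>\<ge>1. (\<integral>w. indicator {w. \<rho> < norm w} w * poly_weight q (w::'a::euclidean_space) \<partial>lborel) < e"
proof -
  have "(\<lambda>n. \<integral>w. indicator {w. real (Suc n) < norm w} w * poly_weight q (w::'a) \<partial>lborel) \<longlonglongrightarrow> (\<integral>w. 0 \<partial>(lborel :: 'a measure))"
  proof (rule integral_dominated_convergence[where w="poly_weight q"])
    show "integrable lborel (poly_weight q :: 'a \<Rightarrow> real)" by (rule integrable_poly_weight[OF q])
    show "AE w in lborel. (\<lambda>n. indicator {w. real (Suc n) < norm w} w * poly_weight q (w::'a)) \<longlonglongrightarrow> 0"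
    proof (intro AE_I2)
      fix w :: 'a
      obtain N :: nat where N: "norm w \<le> real N" using real_arch_simple by blast
      have "indicator {w. real (Suc n) < norm w} w * poly_weight q w = 0" if "N \<le> n" for n
        using N that by (auto simp: indicator_def)
      then have "\<forall>\<^sub>F n in sequentially. indicator {w. real (Suc n) < norm w} w * poly_weight q w = 0"
        by (auto simp: eventually_sequentially)
      then show "(\<lambda>n. indicator {w. real (Suc n) < norm w} w * poly_weight q w) \<longlonglongrightarrow> 0"
        by (rule tendsto_eventually)
    qed
    show "AE w in lborel. norm (indicator {w. real (Suc n) < norm w} w * poly_weight q (w::'a)) \<le> poly_weight q w" for n
      using less_imp_le[OF poly_weight_pos[of q]] by (intro AE_I2) (auto simp: indicator_def)
  qed measurable
  then have "\<forall>\<^sub>F n in sequentially. (\<integral>w. indicator {w. real (Suc n) < norm w} w * poly_weight q (w::'a) \<partial>lborel) < e"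
    using e by (intro order_tendstoD(2)) auto
  then obtain n where "(\<integral>w. indicator {w. real (Suc n) < norm w} w * poly_weight q (w::'a) \<partial>lborel) < e"
    by (auto simp: eventually_sequentially)
  then show ?thesis by (intro exI[of _ "real (Suc n)"]) auto
qed

text \<open>A uniform pointwise upper bound by an integrable function is tightness: the choice of \<open>\<rho>\<close> depends
  on \<open>A\<close> and \<open>q\<close> only.\<close>

lemma mass_in_ball:
  fixes P :: "'a::euclidean_space \<Rightarrow> real"
  assumes P: "integrable lborel P" "(\<integral>x. P x \<partial>lborel) = 1" "\<And>x. P x \<le> A * poly_weight q x" "0 < A"
    and q: "real DIM('a) < q"
    and \<rho>: "(\<integral>w. indicator {w. \<rho> < norm w} w * poly_weight q (w::'a) \<partial>lborel) < 1 / (2 * A)"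
  shows "1 / 2 \<le> (\<integral>w. indicator (cball 0 \<rho>) w * P w \<partial>lborel)"
proof -
  have [measurable]: "P \<in> borel_measurable borel" using P(1) by (simp add: borel_measurable_integrable)
  have i1: "integrable lborel (\<lambda>w. indicator (cball 0 \<rho>) w * P w)"
    using integrable_mult_indicator[OF _ P(1), of "cball 0 \<rho>"] by simp
  have i2: "integrable lborel (\<lambda>w::'a. indicator {w. \<rho> < norm w} w * poly_weight q w)"
    using integrable_mult_indicator[OF _ integrable_poly_weight[OF q], of "{w::'a. \<rho> < norm w}"] by simp
  have "(\<integral>x. P x \<partial>lborel) \<le> (\<integral>w. indicator (cball 0 \<rho>) w * P w + A * (indicator {w. \<rho> < norm w} w * poly_weight q w) \<partial>lborel)"
    using P(3) by (intro integral_mono P Bochner_Integration.integrable_add i1 integrable_mult_right i2)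
      (auto simp: indicator_def)
  also have "\<dots> = (\<integral>w. indicator (cball 0 \<rho>) w * P w \<partial>lborel) + A * (\<integral>w. indicator {w. \<rho> < norm w} w * poly_weight q (w::'a) \<partial>lborel)"
    using i1 i2 by simp
  also have "A * (\<integral>w. indicator {w. \<rho> < norm w} w * poly_weight q (w::'a) \<partial>lborel) \<le> A * (1 / (2 * A))"
    using P(4) \<rho> by (intro mult_left_mono) auto
  finally show ?thesis using P(2,4) by simp
qed

text \<open>If the small jumps end within \<open>\<rho>\<close> of the origin, a single jump \<open>y\<close> to the vicinity of \<open>x\<close> has
  length between \<open>1\<close> and \<open>|x| + \<rho>\<close>. This needs \<open>x\<close> to be far from the origin.\<close>

lemma one_large_jump_lower:
  fixes P f :: "'a::euclidean_space \<Rightarrow> real"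
  assumes P: "integrable lborel P" "\<And>x. 0 \<le> P x" "1 / 2 \<le> (\<integral>w. indicator (cball 0 \<rho>) w * P w \<partial>lborel)"
    and f: "f \<in> borel_measurable borel" "\<And>y. 0 \<le> f y" "\<And>y. f y \<le> c"
      "\<And>y. 1 < norm y \<Longrightarrow> a * norm y powr (- q) \<le> f y"
    and a: "0 \<le> a" and q: "0 < q" and x: "\<rho> + 1 < norm x"
  shows "a / 2 * (norm x + \<rho>) powr (- q) \<le> (\<integral>y. P (x - y) * f y \<partial>lborel)"
proof -
  have [measurable]: "P \<in> borel_measurable borel" using P(1) by (simp add: borel_measurable_integrable)
  note [measurable] = f(1)
  let ?s = "a * (norm x + \<rho>) powr (- q)"
  have s0: "0 \<le> ?s" using a by simp
  have i1: "integrable lborel (\<lambda>w. indicator (cball 0 \<rho>) w * P w)"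
    using integrable_mult_indicator[OF _ P(1), of "cball 0 \<rho>"] by simp
  have iP: "integrable lborel (\<lambda>y. P (x - y))" using P(1) by (rule integrable_reflect)
  have "1 / 2 * ?s \<le> (\<integral>w. indicator (cball 0 \<rho>) w * P w \<partial>lborel) * ?s"
    using P(3) s0 by (rule mult_right_mono)
  also have "(\<integral>w. indicator (cball 0 \<rho>) w * P w \<partial>lborel) = (\<integral>y. indicator (cball 0 \<rho>) (x - y) * P (x - y) \<partial>lborel)"
    by (rule integral_reflect[symmetric]) measurable
  also have "\<dots> * ?s = (\<integral>y. indicator (cball 0 \<rho>) (x - y) * P (x - y) * ?s \<partial>lborel)"
    by (rule integral_mult_left_zero[symmetric])
  also have "\<dots> \<le> (\<integral>y. P (x - y) * f y \<partial>lborel)"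
  proof (rule integral_mono)
    show "integrable lborel (\<lambda>y. indicator (cball 0 \<rho>) (x - y) * P (x - y) * ?s)"
      using integrable_reflect[OF i1, of x] by (rule integrable_mult_left)
    show "integrable lborel (\<lambda>y. P (x - y) * f y)"
      by (rule Bochner_Integration.integrable_bound[OF integrable_mult_left[OF iP, of c]])
         (use f P(2) in \<open>auto simp: abs_mult intro!: mult_left_mono order_trans[OF f(3) abs_ge_self]\<close>)
    fix y
    show "indicator (cball 0 \<rho>) (x - y) * P (x - y) * ?s \<le> P (x - y) * f y"
    proof (cases "norm (x - y) \<le> \<rho>")
      case True
      have 1: "1 < norm y" using norm_triangle_ineq2[of x y] True x by linarith
      have 2: "norm y \<le> norm x + \<rho>" using norm_triangle_ineq3[of x y] True by linarith
      have "?s \<le> a * norm y powr (- q)"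
        using a q 1 2 by (intro mult_left_mono powr_mono2') auto
      also have "\<dots> \<le> f y" by (rule f(4)[OF 1])
      finally show ?thesis using True P(2) by (simp add: mult_left_mono)
    qed (use P(2) f(2) in simp)
  qed
  finally show ?thesis by simp
qed

text \<open>The room for a first large jump \<open>y\<close> of bounded length after which \<open>x - y\<close> is far from the origin.
  Comparing volumes suffices: \<open>(\<rho> + 3)^d \<ge> (\<rho> + 1)^d + 1 + 1\<close>, so removing two balls of radii
  \<open>1\<close> and \<open>\<rho> + 1\<close> from one of radius \<open>\<rho> + 3\<close> leaves at least the volume of a unit ball, wherever the
  second one is.\<close>

lemma annulus_off_ball_volume:
  fixes x :: "'a::euclidean_space"
  assumes \<rho>: "0 \<le> \<rho>"
  shows "measure lborel (ball (0::'a) 1)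
    \<le> (\<integral>y. indicator {y::'a. 1 < norm y \<and> norm y \<le> \<rho> + 3 \<and> \<rho> + 1 < norm (x - y)} y \<partial>lborel)"
proof -
  let ?V = "measure lborel (ball (0::'a) 1)"
  let ?E = "{y::'a. 1 < norm y \<and> norm y \<le> \<rho> + 3 \<and> \<rho> + 1 < norm (x - y)}"
  have ci: "integrable lborel (indicator (cball z r) :: 'a \<Rightarrow> real)" for z r
    by (intro integrable_real_indicator emeasure_lborel_cball_finite) simp
  have cv: "measure lborel (cball z r) = r ^ DIM('a) * ?V" if "0 \<le> r" for z :: 'a and r
    using content_ball_conv_unit_ball[of r z] content_cball[of r z] content_ball[of r z] that by simp
  have E: "?E \<subseteq> cball 0 (\<rho> + 3)" by auto
  have Em: "?E \<in> sets borel" by measurable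
  have Ei: "integrable lborel (indicator ?E :: 'a \<Rightarrow> real)"
    using le_less_trans[OF emeasure_mono[OF E] emeasure_lborel_cball_finite] Em
    by (intro integrable_real_indicator) auto
  \<comment> \<open>the strict gap in the volumes; the factor 2 is the difference of the radii\<close>
  have pw: "(\<rho> + 1) ^ DIM('a) + 2 \<le> (\<rho> + 3) ^ DIM('a)"
  proof -
    obtain n where n: "DIM('a) = Suc n" using DIM_positive[where 'a='a] by (metis gr0_implies_Suc)
    have "(\<rho> + 1) ^ Suc n + 2 \<le> (\<rho> + 1) ^ Suc n + 2 * (\<rho> + 1) ^ n"
      using \<rho> by (simp add: one_le_power)
    also have "\<dots> = (\<rho> + 3) * (\<rho> + 1) ^ n" by (simp add: algebra_simps)
    also have "\<dots> \<le> (\<rho> + 3) * (\<rho> + 3) ^ n"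
      using \<rho> by (intro mult_left_mono power_mono) auto
    finally show ?thesis by (simp add: n)
  qed
  have "?V * 1 \<le> ?V * ((\<rho> + 3) ^ DIM('a) - 1 - (\<rho> + 1) ^ DIM('a))"
    using pw by (intro mult_left_mono) auto
  also have "\<dots> = (\<integral>y. indicator (cball 0 (\<rho> + 3)) y - indicator (cball 0 1) y - indicator (cball x (\<rho> + 1)) y \<partial>lborel)"
    using \<rho> by (simp add: Bochner_Integration.integral_diff Bochner_Integration.integrable_diff ci cv algebra_simps)
  also have "\<dots> \<le> (\<integral>y. indicator ?E y \<partial>lborel)"
    by (intro integral_mono Bochner_Integration.integrable_diff ci Ei) (auto simp: indicator_def dist_norm)
  finally show ?thesis by simp
qed

text \<open>The core of the theorem. The lower bound keeps only the term of the series with two large jumps;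
  a single one would not cover the points near the origin, where the density of the small jumps has
  no pointwise lower bound at hand.\<close>

lemma jump_density_bounds:
  assumes \<alpha>: "0 < \<alpha>" "\<alpha> < 2" and c: "0 < c"
  defines "q \<equiv> \<alpha> + real DIM('a::euclidean_space)"
  shows "\<exists>U L. 0 < U \<and> 0 < L \<and> (\<forall>k :: 'a \<Rightarrow> real. stable_like \<alpha> c k \<longrightarrow>
    (\<forall>x. norm (inv_fourier (\<lambda>\<xi>. exp (jump_exponent k \<xi>)) x) \<le> U * poly_weight q x
       \<and> L * poly_weight q x \<le> Re (inv_fourier (\<lambda>\<xi>. exp (jump_exponent k \<xi>)) x)))"
proof -
  have q: "real DIM('a) < q" "0 < q" using \<alpha> by (auto simp: q_def add_pos_nonneg)
  obtain A where A: "0 < A" and small: "\<And>k :: 'a \<Rightarrow> real. stable_like \<alpha> c k \<Longrightarrow>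
      (\<forall>x. norm (inv_fourier (small_char k) x) \<le> A * poly_weight q x)
      \<and> integrable lborel (inv_fourier (small_char k))
      \<and> (\<integral>x. inv_fourier (small_char k) x \<partial>lborel) = 1"
    using small_jump_density[OF \<alpha> c q(1)] by blast
  obtain \<rho> where \<rho>: "1 \<le> \<rho>" "(\<integral>w. indicator {w. \<rho> < norm w} w * poly_weight q (w::'a) \<partial>lborel) < 1 / (2 * A)"
    using poly_weight_tail[where 'a='a, OF q(1), of "1 / (2 * A)"] A by auto
  define B where "B = c * 2 powr q"
  define D where "D = 2 powr q * 2 * (\<integral>y. poly_weight q (y::'a) \<partial>lborel)"
  define \<Lambda> where "\<Lambda> = c * (\<integral>z. indicator {z. 1 < norm z} z * stable_weight \<alpha> (z::'a) \<partial>lborel)"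
  define V where "V = measure lborel (ball (0::'a) 1)"
  define U where "U = A * exp (B * D)"
  define L where "L = exp (- \<Lambda>) * (V * (inverse c / 2 * (2 * \<rho> + 3) powr (- q) * (inverse c * (\<rho> + 3) powr (- q)))) / 2"
  have V: "0 < V" by (simp add: V_def content_ball_pos)
  have U: "0 < U" using A by (simp add: U_def)
  have L: "0 < L" using c V \<rho> by (simp add: L_def)
  have "norm (inv_fourier (\<lambda>\<xi>. exp (jump_exponent k \<xi>)) x) \<le> U * poly_weight q x
       \<and> L * poly_weight q x \<le> Re (inv_fourier (\<lambda>\<xi>. exp (jump_exponent k \<xi>)) x)"
    if k: "stable_like \<alpha> c k" for k :: "'a \<Rightarrow> real" and x
  proof
    let ?\<Phi> = "small_char k"
    let ?f = "large_part k"
    let ?l = "\<integral>z. large_part k z \<partial>lborel"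
    have kl: "kernel_le \<alpha> c k" using k by (simp add: stable_like_def)
    note lp = large_part_bounds[OF kl \<alpha>(1) c]
    note [measurable] = lp(4)
    have \<Phi>: "integrable lborel ?\<Phi>" by (rule integrable_exp_small_exponent[OF k \<alpha> c]) simp
    have pw0: "0 \<le> poly_weight q y" for y :: 'a using poly_weight_pos[of q y] by simp
    have D0: "0 \<le> D" unfolding D_def by (intro mult_nonneg_nonneg lebesgue_integral_nonneg pw0) auto
    have l0: "0 \<le> ?l" by (intro lebesgue_integral_nonneg lp(1))
    have "norm (inv_fourier (\<lambda>\<xi>. ?\<Phi> \<xi> * exp (fourier ?f \<xi>)) x) \<le> A * exp (B * D) * poly_weight q x"
    proof (rule inv_fourier_exp_bound[OF \<Phi> lp(5)])
      show "norm (inv_fourier ?\<Phi> x) \<le> A * poly_weight q x" for x using small[OF k] by blast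
      show "\<bar>?f y\<bar> \<le> B * poly_weight q y" for y
        using lp(1)[of y] lp(3)[of y] by (simp add: B_def q_def)
    qed (use A c D0 pw0 poly_weight_convolution[OF q(1)] in \<open>auto simp: B_def D_def\<close>)
    then have "exp (- ?l) * norm (inv_fourier (\<lambda>\<xi>. ?\<Phi> \<xi> * exp (fourier ?f \<xi>)) x) \<le> 1 * (U * poly_weight q x)"
      unfolding U_def using l0 by (intro mult_mono) auto
    then show "norm (inv_fourier (\<lambda>\<xi>. exp (jump_exponent k \<xi>)) x) \<le> U * poly_weight q x"
      unfolding inv_fourier_exp_jump_exponent by (simp add: norm_mult)

    have nnR: "inv_fourier ?\<Phi> y \<in> \<real>\<^sub>\<ge>\<^sub>0" for y by (rule inv_fourier_small_nonneg[OF k \<alpha> c])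
    define P where "P y = Re (inv_fourier ?\<Phi> y)" for y
    have P: "inv_fourier ?\<Phi> y = of_real (P y)" "0 \<le> P y" for y
      using nnR[of y] by (auto simp: P_def complex_nonneg_Reals_iff complex_eq_iff)
    have Pint: "integrable lborel P" unfolding P_def using small[OF k] by (intro integrable_Re) auto
    have "complex_of_real (\<integral>y. P y \<partial>lborel) = 1"
      using small[OF k] unfolding P(1) by simp
    then have P1: "(\<integral>y. P y \<partial>lborel) = 1" by (simp only: of_real_eq_1_iff)
    have Ple: "P y \<le> A * poly_weight q y" for y
      using small[OF k] complex_Re_le_cmod[of "inv_fourier ?\<Phi> y"] unfolding P_def by (meson order_trans)
    note mass = mass_in_ball[OF Pint P1 Ple A q(1) \<rho>(2)]
    have flow: "inverse c * norm y powr (- q) \<le> ?f y" if "1 < norm y" for y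
      using k that by (auto simp: stable_like_def large_part_def q_def)
    define v where "v = (\<lambda>y. Re (inv_fourier (\<lambda>\<xi>. ?\<Phi> \<xi> * fourier ?f \<xi>) y))"
    have veq: "inv_fourier (\<lambda>\<xi>. ?\<Phi> \<xi> * fourier ?f \<xi>) y = of_real (\<integral>z. P (y - z) * ?f z \<partial>lborel)" for y
      unfolding inv_fourier_mult_fourier[OF \<Phi> lp(5)] P(1) of_real_mult[symmetric] by (rule integral_complex_of_real)
    have v1: "v y = (\<integral>z. P (y - z) * ?f z \<partial>lborel)" for y by (simp only: v_def veq Re_complex_of_real)
    have v0: "0 \<le> v y" for y unfolding v1 by (intro lebesgue_integral_nonneg mult_nonneg_nonneg P lp)
    have vlow: "inverse c / 2 * (norm y + \<rho>) powr (- q) \<le> v y" if "\<rho> + 1 < norm y" for y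
      unfolding v1 using c by (intro one_large_jump_lower[OF Pint P(2) mass lp(4,1,2) flow _ q(2) that]) auto
    \<comment> \<open>first large jumps y after which x is reached by one more large jump\<close>
    let ?E = "{y::'a. 1 < norm y \<and> norm y \<le> \<rho> + 3 \<and> \<rho> + 1 < norm (x - y)}"
    let ?s = "inverse c / 2 * ((2 * \<rho> + 3) powr (- q) * poly_weight q x) * (inverse c * (\<rho> + 3) powr (- q))"
    have s0: "0 \<le> ?s" using c pw0[of x] by simp
    have vm[measurable]: "v \<in> borel_measurable borel"
    proof -
      have [measurable]: "?\<Phi> \<in> borel_measurable borel" using \<Phi> by (simp add: borel_measurable_integrable)
      show ?thesis unfolding v_def by measurable
    qed
    have vb: "v y \<le> (\<integral>\<xi>. norm (?\<Phi> \<xi> * fourier ?f \<xi>) \<partial>lborel) / (2 * pi) ^ DIM('a)" for y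
      unfolding v_def by (intro order_trans[OF complex_Re_le_cmod norm_inv_fourier_le])
    have vint: "integrable lborel (\<lambda>y. v (x - y) * ?f y)"
    proof (rule integrable_norm_le)
      show "integrable lborel (\<lambda>y. (\<integral>\<xi>. norm (?\<Phi> \<xi> * fourier ?f \<xi>) \<partial>lborel) / (2 * pi) ^ DIM('a) * ?f y)"
        by (intro integrable_mult_right lp(5))
      show "norm (v (x - y) * ?f y) \<le> (\<integral>\<xi>. norm (?\<Phi> \<xi> * fourier ?f \<xi>) \<partial>lborel) / (2 * pi) ^ DIM('a) * ?f y" for y
        unfolding real_norm_def abs_mult abs_of_nonneg[OF v0] abs_of_nonneg[OF lp(1)]
        by (intro mult_right_mono vb lp(1))
    qed measurable
    have "inv_fourier (\<lambda>\<xi>. ?\<Phi> \<xi> * fourier ?f \<xi> ^ 2) x = (\<integral>y. of_real (v (x - y) * ?f y) \<partial>lborel)"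
      using inv_fourier_power_Suc[OF \<Phi> lp(5), of 1 x] unfolding v1 of_real_mult
      by (simp add: veq numeral_2_eq_2)
    then have v2: "Re (inv_fourier (\<lambda>\<xi>. ?\<Phi> \<xi> * fourier ?f \<xi> ^ 2) x) = (\<integral>y. v (x - y) * ?f y \<partial>lborel)"
      by (simp only: integral_complex_of_real Re_complex_of_real)
    have "V * ?s \<le> (\<integral>y. indicator ?E y \<partial>lborel) * ?s"
      using annulus_off_ball_volume[of \<rho> x] \<rho>(1) s0 unfolding V_def by (intro mult_right_mono) auto
    also have "\<dots> = (\<integral>y. indicator ?E y * ?s \<partial>lborel)"
      by (rule integral_mult_left_zero[symmetric])
    also have "\<dots> \<le> (\<integral>y. v (x - y) * ?f y \<partial>lborel)"
    proof (rule integral_mono'[OF vint])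
      fix y
      show "0 \<le> v (x - y) * ?f y" by (intro mult_nonneg_nonneg v0 lp)
      show "indicator ?E y * ?s \<le> v (x - y) * ?f y"
      proof (cases "y \<in> ?E")
        case True
        then have y: "1 < norm y" "norm y \<le> \<rho> + 3" "\<rho> + 1 < norm (x - y)" by auto
        have "norm (x - y) + \<rho> \<le> norm x + (2 * \<rho> + 3)" using norm_triangle_ineq4[of x y] y by linarith
        also have "\<dots> \<le> (2 * \<rho> + 3) * (1 + norm x)"
          using \<rho>(1) mult_right_mono[of 1 "2 * \<rho> + 3" "norm x"] by (simp add: distrib_left)
        finally have le: "norm (x - y) + \<rho> \<le> (2 * \<rho> + 3) * (1 + norm x)" .
        have "(2 * \<rho> + 3) powr (- q) * poly_weight q x = ((2 * \<rho> + 3) * (1 + norm x)) powr (- q)"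
          using \<rho>(1) by (simp add: poly_weight_def powr_mult)
        also have "\<dots> \<le> (norm (x - y) + \<rho>) powr (- q)"
          using le \<rho>(1) q y by (intro powr_mono2') auto
        finally have "inverse c / 2 * ((2 * \<rho> + 3) powr (- q) * poly_weight q x) \<le> inverse c / 2 * (norm (x - y) + \<rho>) powr (- q)"
          using c by (intro mult_left_mono) auto
        also have "\<dots> \<le> v (x - y)" by (rule vlow[OF y(3)])
        finally have 1: "inverse c / 2 * ((2 * \<rho> + 3) powr (- q) * poly_weight q x) \<le> v (x - y)" .
        have "inverse c * (\<rho> + 3) powr (- q) \<le> inverse c * norm y powr (- q)"
          using c y q by (intro mult_left_mono powr_mono2') auto
        also have "\<dots> \<le> ?f y" by (rule flow[OF y(1)])
        finally have 2: "inverse c * (\<rho> + 3) powr (- q) \<le> ?f y" .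
        have "?s \<le> v (x - y) * ?f y"
          by (rule mult_mono[OF 1 2]) (use c v0 in auto)
        then show ?thesis using True by simp
      qed (use v0 lp(1) in simp)
    qed
    finally have "V * ?s \<le> (\<integral>y. v (x - y) * ?f y \<partial>lborel)" .
    then have "V * ?s / 2 \<le> Re (inv_fourier (\<lambda>\<xi>. ?\<Phi> \<xi> * fourier ?f \<xi> ^ 2) x) / fact 2"
      unfolding v2 fact_2 by (rule divide_right_mono) simp
    also have "\<dots> \<le> Re (inv_fourier (\<lambda>\<xi>. ?\<Phi> \<xi> * exp (fourier ?f \<xi>)) x)"
      by (rule inv_fourier_exp_nonneg(2)[OF \<Phi> lp(5) nnR lp(1)])
    finally have fin: "exp (- \<Lambda>) * (V * ?s / 2) \<le> exp (- ?l) * Re (inv_fourier (\<lambda>\<xi>. ?\<Phi> \<xi> * exp (fourier ?f \<xi>)) x)"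
      using lp(6) V s0 unfolding \<Lambda>_def by (intro mult_mono) auto
    have "exp (- \<Lambda>) * (V * ?s / 2) = L * poly_weight q x"
      unfolding L_def by (simp only: times_divide_eq_left times_divide_eq_right mult_ac)
    from fin[unfolded this] show "L * poly_weight q x \<le> Re (inv_fourier (\<lambda>\<xi>. exp (jump_exponent k \<xi>)) x)"
      unfolding inv_fourier_exp_jump_exponent by simp
  qed
  with U L show ?thesis by blast
qed

lemma inv_fourier_drift:
  "inv_fourier (\<lambda>\<xi>. exp (\<i> * of_real (\<xi> \<bullet> b)) * \<Phi> \<xi>) x = inv_fourier \<Phi> (x - b)"
proof -
  have "cis (- (\<xi> \<bullet> x)) * (cis (\<xi> \<bullet> b) * \<Phi> \<xi>) = cis (- (\<xi> \<bullet> (x - b))) * \<Phi> \<xi>" for \<xi>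
    by (simp add: mult.assoc[symmetric] cis_mult inner_diff_right del: mult_minus_left)
  then show ?thesis by (simp only: inv_fourier_def cis_conv_exp[symmetric])
qed

lemma poly_weight_shift:
  fixes x b :: "'a::euclidean_space"
  assumes b: "norm b \<le> B" and q: "0 < q"
  shows "poly_weight q (x - b) \<le> (1 + B) powr q * poly_weight q x"
    and "(1 + B) powr (- q) * poly_weight q x \<le> poly_weight q (x - b)"
proof -
  have *: "(1 + B) powr (- q) * poly_weight q u \<le> poly_weight q w" if "norm w \<le> norm u + B" for u w :: 'a
  proof -
    have B: "0 \<le> B" using b norm_ge_zero order_trans by blast
    have "1 + norm w \<le> (1 + B) * (1 + norm u)"
    proof -
      have "(1 + B) * (1 + norm u) = 1 + norm u + B + B * norm u" by (simp add: algebra_simps)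
      then show ?thesis using that mult_nonneg_nonneg[OF B norm_ge_zero[of u]] by linarith
    qed
    then have "((1 + B) * (1 + norm u)) powr (- q) \<le> (1 + norm w) powr (- q)"
      using q by (intro powr_mono2') (auto intro: add_pos_nonneg)
    then show ?thesis using B by (simp add: poly_weight_def powr_mult)
  qed
  have B: "0 < 1 + B" using b norm_ge_zero[of b] by linarith
  show "(1 + B) powr (- q) * poly_weight q x \<le> poly_weight q (x - b)"
    by (rule *) (use b norm_triangle_ineq4[of x b] in linarith)
  have "(1 + B) powr (- q) * poly_weight q (x - b) \<le> poly_weight q x"
    by (rule *) (use b norm_triangle_ineq[of "x - b" b] in simp)
  then have "(1 + B) powr q * ((1 + B) powr (- q) * poly_weight q (x - b)) \<le> (1 + B) powr q * poly_weight q x"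
    by (intro mult_left_mono) auto
  moreover have "(1 + B) powr q * (1 + B) powr (- q) = 1"
    using B by (simp flip: powr_add)
  ultimately show "poly_weight q (x - b) \<le> (1 + B) powr q * poly_weight q x"
    by (simp add: mult.assoc[symmetric])
qed

section \<open>Compensators and drift\<close>

text \<open>The scalar factor of the compensator.\<close>

definition cutoff :: "real \<Rightarrow> 'a::euclidean_space \<Rightarrow> real" where
  "cutoff \<alpha> z = indicator {1<..<2} \<alpha> + indicator {z. norm z \<le> 1} z * indicator {1} \<alpha>"

definition comp_phase :: "real \<Rightarrow> 'a::euclidean_space \<Rightarrow> 'a \<Rightarrow> complex" where
  "comp_phase \<alpha> \<xi> z = exp (\<i> * of_real (\<xi> \<bullet> z)) - 1 - \<i> * of_real (\<xi> \<bullet> (cutoff \<alpha> z *\<^sub>R z))"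

text \<open>The difference between the compensation in \<open>jump_exponent\<close> and the one prescribed for \<open>\<alpha>\<close>: for
  \<open>\<alpha> < 1\<close> it is the mean of the small jumps, for \<open>\<alpha> > 1\<close> minus the mean of the large ones, and for
  \<open>\<alpha> = 1\<close> it vanishes.\<close>

definition drift :: "real \<Rightarrow> ('a::euclidean_space \<Rightarrow> real) \<Rightarrow> 'a" where
  "drift \<alpha> k = (\<integral>z. ((indicator (cball 0 1) z - cutoff \<alpha> z) * k z) *\<^sub>R z \<partial>lborel)"

definition drift_bound :: "real \<Rightarrow> 'a::euclidean_space itself \<Rightarrow> real" where
  "drift_bound \<alpha> T = (\<integral>z. \<bar>indicator (cball 0 1) z - cutoff \<alpha> z\<bar> * norm (z::'a) powr (1 - \<alpha> - DIM('a)) \<partial>lborel)"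

lemma borel_measurable_cutoff [measurable]: "cutoff \<alpha> \<in> borel_measurable borel"
  unfolding cutoff_def by measurable

lemma borel_measurable_comp_phase [measurable]: "comp_phase \<alpha> \<xi> \<in> borel_measurable borel"
  unfolding comp_phase_def by measurable

lemma integrable_drift_bound:
  assumes \<alpha>: "0 < \<alpha>" "\<alpha> < 2"
  shows "integrable lborel (\<lambda>z::'a::euclidean_space. \<bar>indicator (cball 0 1) z - cutoff \<alpha> z\<bar> * norm z powr (1 - \<alpha> - DIM('a)))"
proof -
  consider "\<alpha> < 1" | "\<alpha> = 1" | "1 < \<alpha>" by linarith
  then show ?thesis
  proof cases
    case 1
    then have "\<bar>indicator (cball 0 1) z - cutoff \<alpha> z\<bar> = indicator (cball 0 1) z" for z :: 'a
      by (simp add: cutoff_def)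
    then show ?thesis using integrable_powr_unit_ball[of "1 - \<alpha>", where 'a='a] 1 by simp
  next
    case 2
    then have "\<bar>indicator (cball 0 1) z - cutoff \<alpha> z\<bar> = 0" for z :: 'a
      by (simp add: cutoff_def indicator_def)
    then show ?thesis by simp
  next
    case 3
    then have "\<bar>indicator (cball 0 1) z - cutoff \<alpha> z\<bar> = indicator {z. 1 < norm z} z" for z :: 'a
      using \<alpha> by (simp add: cutoff_def indicator_def)
    then show ?thesis using integrable_powr_outside_ball[of "\<alpha> - 1", where 'a='a] 3 by simp
  qed
qed

lemma drift_integrand_bound:
  fixes k :: "'a::euclidean_space \<Rightarrow> real"
  assumes k: "kernel_le \<alpha> c k"
  shows "norm (((indicator (cball 0 1) z - cutoff \<alpha> z) * k z) *\<^sub>R z)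
    \<le> c * (\<bar>indicator (cball 0 1) z - cutoff \<alpha> z\<bar> * norm z powr (1 - \<alpha> - DIM('a)))"
proof (cases "z = 0")
  case False
  let ?d = "\<bar>indicator (cball 0 1) z - cutoff \<alpha> z\<bar>"
  have kz: "0 \<le> k z" "k z \<le> c * stable_weight \<alpha> z" using k by (auto simp: kernel_le_def)
  have "norm z powr (1 - \<alpha> - DIM('a)) = stable_weight \<alpha> z * norm z"
    using False powr_add[of "norm z" "- \<alpha> - DIM('a)" 1] by (simp add: algebra_simps)
  moreover have "?d * (k z * norm z) \<le> ?d * (c * stable_weight \<alpha> z * norm z)"
    using kz by (intro mult_left_mono mult_right_mono) auto
  ultimately show ?thesis using kz(1) by (simp add: abs_mult mult_ac)
qed simp

lemma integrable_drift:
  fixes k :: "'a::euclidean_space \<Rightarrow> real"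
  assumes k: "kernel_le \<alpha> c k" and \<alpha>: "0 < \<alpha>" "\<alpha> < 2"
  shows "integrable lborel (\<lambda>z. ((indicator (cball 0 1) z - cutoff \<alpha> z) * k z) *\<^sub>R z)"
proof (rule integrable_norm_le[OF _ _ drift_integrand_bound[OF k]])
  have [measurable]: "k \<in> borel_measurable borel" using k by (simp add: kernel_le_def)
  show "(\<lambda>z. ((indicator (cball 0 1) z - cutoff \<alpha> z) * k z) *\<^sub>R z) \<in> borel_measurable lborel" by measurable
  show "integrable lborel (\<lambda>z::'a. c * (\<bar>indicator (cball 0 1) z - cutoff \<alpha> z\<bar> * norm z powr (1 - \<alpha> - DIM('a))))"
    by (intro integrable_mult_right integrable_drift_bound \<alpha>)
qed

lemma norm_drift_le:
  fixes k :: "'a::euclidean_space \<Rightarrow> real"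
  assumes k: "kernel_le \<alpha> c k" and \<alpha>: "0 < \<alpha>" "\<alpha> < 2"
  shows "norm (drift \<alpha> k) \<le> c * drift_bound \<alpha> TYPE('a)"
proof -
  have "norm (drift \<alpha> k) \<le> (\<integral>z. c * (\<bar>indicator (cball 0 1) z - cutoff \<alpha> z\<bar> * norm (z::'a) powr (1 - \<alpha> - DIM('a))) \<partial>lborel)"
    unfolding drift_def
    by (intro order_trans[OF integral_norm_bound] integral_mono integrable_norm integrable_drift[OF k \<alpha>]
        drift_integrand_bound[OF k] integrable_mult_right integrable_drift_bound \<alpha>)
  then show ?thesis unfolding drift_bound_def by simp
qed

lemma comp_phase_integral:
  fixes k :: "'a::euclidean_space \<Rightarrow> real"
  assumes k: "kernel_le \<alpha> c k" and \<alpha>: "0 < \<alpha>" "\<alpha> < 2" and c: "0 < c"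
  shows "integrable lborel (\<lambda>z. comp_phase \<alpha> \<xi> z * of_real (k z))"
    and "(\<integral>z. comp_phase \<alpha> \<xi> z * of_real (k z) \<partial>lborel) = jump_exponent k \<xi> + \<i> * of_real (\<xi> \<bullet> drift \<alpha> k)"
proof -
  let ?s = "\<lambda>z. small_integrand k 0 \<xi> z"
  let ?l = "\<lambda>z. cis (\<xi> \<bullet> z) * of_real (large_part k z)"
  let ?m = "\<lambda>z. of_real (large_part k z) :: complex"
  let ?v = "\<lambda>z. ((indicator (cball 0 1) z - cutoff \<alpha> z) * k z) *\<^sub>R z"
  let ?d = "\<lambda>z. \<i> * of_real (\<xi> \<bullet> ?v z)"
  note lp = large_part_bounds[OF k \<alpha>(1) c]
  have eq: "comp_phase \<alpha> \<xi> z * of_real (k z) = ?s z + (?l z - ?m z) + ?d z" for z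
  proof -
    have tp: "tilted_phase 0 \<xi> z = \<i> * of_real (\<xi> \<bullet> z)" by (simp add: complex_eq_iff)
    have ex: "cis (\<xi> \<bullet> z) = exp (\<i> * of_real (\<xi> \<bullet> z))" by (simp add: cis_conv_exp)
    show ?thesis
      unfolding tp ex comp_phase_def large_part_def
      by (cases "norm z \<le> 1") (simp_all add: inner_scaleR_right ring_distribs mult_ac)
  qed
  have s: "integrable lborel ?s" by (rule integrable_small_integrand[OF k \<alpha>(2)])
  have l: "integrable lborel ?l"
    using integrable_cis_mult[OF integrable_of_real[OF lp(5)], of \<xi>] by (simp only: inner_commute[of \<xi>])
  have m: "integrable lborel ?m" by (rule integrable_of_real[OF lp(5)])
  have d: "integrable lborel ?d"
    by (intro integrable_mult_right integrable_of_real integrable_inner_right integrable_drift[OF k \<alpha>])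
  show "integrable lborel (\<lambda>z. comp_phase \<alpha> \<xi> z * of_real (k z))"
    unfolding eq by (intro Bochner_Integration.integrable_add Bochner_Integration.integrable_diff s l m d)
  have "(\<integral>z. \<xi> \<bullet> ?v z \<partial>lborel) = \<xi> \<bullet> drift \<alpha> k"
    unfolding drift_def by (rule integral_inner_right) (rule integrable_drift[OF k \<alpha>])
  then have "(\<integral>z. ?d z \<partial>lborel) = \<i> * of_real (\<xi> \<bullet> drift \<alpha> k)"
    by (simp only: integral_mult_right_zero integral_complex_of_real)
  then show "(\<integral>z. comp_phase \<alpha> \<xi> z * of_real (k z) \<partial>lborel) = jump_exponent k \<xi> + \<i> * of_real (\<xi> \<bullet> drift \<alpha> k)"
    unfolding eq jump_exponent_def small_exponent_def fourier_def
    by (simp only: Bochner_Integration.integral_add Bochner_Integration.integral_diff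
        Bochner_Integration.integrable_add Bochner_Integration.integrable_diff s l m d integral_complex_of_real)
qed

lemma sphere_null: "AE z::'a::euclidean_space in lborel. norm z \<noteq> a"
proof -
  have "sphere (0::'a) a \<in> null_sets lebesgue"
    using negligible_sphere[of "0::'a" a] by (simp only: negligible_iff_null_sets)
  moreover have "sphere (0::'a) a \<in> sets lborel" by (simp add: borel_closed)
  ultimately have "sphere (0::'a) a \<in> null_sets lborel" by (simp add: null_sets_completion_iff)
  then show ?thesis by (rule AE_not_in[THEN AE_mp]) (auto intro!: AE_I2)
qed

lemma cutoff_difference_one:
  "cutoff 1 z - cutoff 1 (inverse R *\<^sub>R z) = (if R \<le> 1
     then indicator {z. R < norm z \<and> norm z \<le> 1} z else - indicator {z. 1 < norm z \<and> norm z \<le> R} z)"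
  if "0 < R" for z :: "'a::euclidean_space"
proof -
  have "norm (inverse R *\<^sub>R z) \<le> 1 \<longleftrightarrow> norm z \<le> R"
    using that by (simp add: field_simps)
  then show ?thesis using that by (auto simp: cutoff_def indicator_def)
qed

lemma inner_rescale: "R \<noteq> 0 \<Longrightarrow> (R *\<^sub>R \<xi>) \<bullet> (inverse R *\<^sub>R z) = \<xi> \<bullet> z"
  by (simp add: mult.assoc[symmetric])

text \<open>Scaling by \<open>R\<close> moves the cutoff of the compensator from \<open>1\<close> to \<open>R\<close> when \<open>\<alpha> = 1\<close>. The two
  exponents differ by the mean of the jumps in an annulus between these radii, which vanishes by
  symmetry.\<close>

lemma comp_phase_rescale_cutoff:
  fixes g :: "'a::euclidean_space \<Rightarrow> real"
  assumes g: "integrable lborel (\<lambda>z. comp_phase \<alpha> \<xi> z * of_real (g z))"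
      "integrable lborel (\<lambda>z. comp_phase \<alpha> (R *\<^sub>R \<xi>) (inverse R *\<^sub>R z) * of_real (g z))"
    and gm: "g \<in> borel_measurable borel" and \<alpha>: "0 < \<alpha>" "\<alpha> < 2" and R: "0 < R"
    and bd: "\<And>z. 0 \<le> g z" "\<And>z. g z \<le> C * stable_weight \<alpha> z" and C: "0 \<le> C"
    and sym: "\<And>a b. \<alpha> = 1 \<Longrightarrow> 0 < a \<Longrightarrow> a < b \<Longrightarrow> (LINT z:{z. a \<le> norm z \<and> norm z \<le> b}|lborel. g z *\<^sub>R z) = 0"
  shows "(\<integral>z. comp_phase \<alpha> \<xi> z * of_real (g z) \<partial>lborel)
    = (\<integral>z. comp_phase \<alpha> (R *\<^sub>R \<xi>) (inverse R *\<^sub>R z) * of_real (g z) \<partial>lborel)"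
proof -
  note [measurable] = gm
  have diff: "comp_phase \<alpha> (R *\<^sub>R \<xi>) (inverse R *\<^sub>R z) - comp_phase \<alpha> \<xi> z
      = \<i> * of_real ((cutoff \<alpha> z - cutoff \<alpha> (inverse R *\<^sub>R z)) * (\<xi> \<bullet> z))" for z
  proof -
    have "(R *\<^sub>R \<xi>) \<bullet> (cutoff \<alpha> (inverse R *\<^sub>R z) *\<^sub>R inverse R *\<^sub>R z) = cutoff \<alpha> (inverse R *\<^sub>R z) * (\<xi> \<bullet> z)"
      using inner_rescale[of R \<xi> z] R by (simp only: inner_scaleR_right[of _ "cutoff _ _"])
    then show ?thesis
      using inner_rescale[of R \<xi> z] R unfolding comp_phase_def
      by (simp only: inner_scaleR_right[of \<xi>]) (simp add: algebra_simps)
  qed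
  show ?thesis
  proof (cases "\<alpha> = 1")
    case False
    then have "cutoff \<alpha> z = cutoff \<alpha> (inverse R *\<^sub>R z)" for z :: 'a by (simp add: cutoff_def)
    then have "comp_phase \<alpha> (R *\<^sub>R \<xi>) (inverse R *\<^sub>R z) = comp_phase \<alpha> \<xi> z" for z
      using diff[of z] by simp
    then show ?thesis by simp
  next
    case True
    have ring: "integrable lborel (\<lambda>z. (indicator {z. a < norm z \<and> norm z \<le> b} z * g z) *\<^sub>R z)"
      "(\<integral>z. (indicator {z. a < norm z \<and> norm z \<le> b} z * g z) *\<^sub>R z \<partial>lborel) = 0"
      if ab: "0 < a" "a \<le> b" for a b
    proof -
      let ?I = "\<lambda>z. (indicator {z. a < norm z \<and> norm z \<le> b} z * g z) *\<^sub>R z"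
      have le: "norm (?I z) \<le> C * a powr (- \<alpha> - DIM('a)) * b * indicator (cball 0 b) z" for z
      proof (cases "a < norm z \<and> norm z \<le> b")
        case True
        have "stable_weight \<alpha> z \<le> a powr (- \<alpha> - DIM('a))"
          using True ab \<alpha> by (intro powr_mono2') auto
        then have "g z \<le> C * a powr (- \<alpha> - DIM('a))"
          using bd(2)[of z] C by (meson mult_left_mono order_trans)
        then have "g z * norm z \<le> C * a powr (- \<alpha> - DIM('a)) * b"
          using True bd(1)[of z] ab C by (intro mult_mono) auto
        then show ?thesis using True bd(1)[of z] by simp
      qed (use ab C in auto)
      show int: "integrable lborel ?I"
      proof (rule integrable_norm_le[OF _ _ le])
        show "integrable lborel (\<lambda>z::'a. C * a powr (- \<alpha> - DIM('a)) * b * indicator (cball 0 b) z)"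
          by (intro integrable_mult_right integrable_real_indicator emeasure_lborel_cball_finite) simp
      qed measurable
      show "(\<integral>z. ?I z \<partial>lborel) = 0"
      proof (cases "a = b")
        case True
        then have "?I = (\<lambda>z. 0)" by (auto simp: indicator_def)
        then show ?thesis by (simp only: Bochner_Integration.integral_zero)
      next
        case False
        have "(\<integral>z. ?I z \<partial>lborel) = (LINT z:{z. a \<le> norm z \<and> norm z \<le> b}|lborel. g z *\<^sub>R z)"
          unfolding set_lebesgue_integral_def
        proof (rule integral_cong_AE)
          show "AE z in lborel. ?I z = indicator {z. a \<le> norm z \<and> norm z \<le> b} z *\<^sub>R g z *\<^sub>R z"
            using sphere_null[of a] by eventually_elim (auto simp: indicator_def)
        qed measurable
        also have "\<dots> = 0" using sym[of a b] True ab False \<open>\<alpha> = 1\<close> by simp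
        finally show ?thesis .
      qed
    qed
    let ?D = "\<lambda>z. ((cutoff \<alpha> z - cutoff \<alpha> (inverse R *\<^sub>R z)) * g z) *\<^sub>R z"
    have D: "integrable lborel ?D \<and> (\<integral>z. ?D z \<partial>lborel) = 0"
    proof (cases "R \<le> 1")
      case R1: True
      then have "?D = (\<lambda>z. (indicator {z. R < norm z \<and> norm z \<le> 1} z * g z) *\<^sub>R z)"
        by (simp add: True cutoff_difference_one[OF R])
      then show ?thesis using ring[of R 1] R R1 by simp
    next
      case R1: False
      then have "?D = (\<lambda>z. - ((indicator {z. 1 < norm z \<and> norm z \<le> R} z * g z) *\<^sub>R z))"
        by (simp add: True cutoff_difference_one[OF R])
      then show ?thesis using ring[of 1 R] R1 by simp
    qed
    have "(\<integral>z. comp_phase \<alpha> (R *\<^sub>R \<xi>) (inverse R *\<^sub>R z) * of_real (g z) \<partial>lborel)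
       - (\<integral>z. comp_phase \<alpha> \<xi> z * of_real (g z) \<partial>lborel)
       = (\<integral>z. (comp_phase \<alpha> (R *\<^sub>R \<xi>) (inverse R *\<^sub>R z) - comp_phase \<alpha> \<xi> z) * of_real (g z) \<partial>lborel)"
      using g by (simp add: left_diff_distrib Bochner_Integration.integral_diff)
    also have "\<dots> = (\<integral>z. \<i> * of_real (\<xi> \<bullet> ?D z) \<partial>lborel)"
      unfolding diff by (simp add: mult_ac)
    also have "\<dots> = \<i> * of_real (\<integral>z. \<xi> \<bullet> ?D z \<partial>lborel)"
      by (simp only: integral_mult_right_zero integral_complex_of_real)
    also have "(\<integral>z. \<xi> \<bullet> ?D z \<partial>lborel) = \<xi> \<bullet> (\<integral>z. ?D z \<partial>lborel)"
      using D by (intro integral_inner_right) auto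
    finally show ?thesis using D by simp
  qed
qed

section \<open>Scaling\<close>

lemma inv_fourier_rescale:
  fixes \<Psi> :: "'a::euclidean_space \<Rightarrow> complex"
  assumes [measurable]: "\<Psi> \<in> borel_measurable borel" and R: "0 < R"
  shows "inv_fourier (\<lambda>\<xi>. \<Psi> (R *\<^sub>R \<xi>)) x = of_real (inverse (R ^ DIM('a))) * inv_fourier \<Psi> (inverse R *\<^sub>R x)"
proof -
  let ?G = "\<lambda>\<zeta>. cis (- (\<zeta> \<bullet> (inverse R *\<^sub>R x))) * \<Psi> \<zeta>"
  have "(\<integral>\<zeta>. ?G \<zeta> \<partial>lborel) = \<bar>R\<bar> ^ DIM('a) *\<^sub>R (\<integral>\<xi>. ?G (0 + R *\<^sub>R \<xi>) \<partial>lborel)"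
    using R by (intro lborel_integral_affine) auto
  also have "(\<integral>\<xi>. ?G (0 + R *\<^sub>R \<xi>) \<partial>lborel) = (\<integral>\<xi>. cis (- (\<xi> \<bullet> x)) * \<Psi> (R *\<^sub>R \<xi>) \<partial>lborel)"
    using R by (simp only: add_0_left inner_rescale)
  finally have "(\<integral>\<xi>. cis (- (\<xi> \<bullet> x)) * \<Psi> (R *\<^sub>R \<xi>) \<partial>lborel) = of_real (inverse (R ^ DIM('a))) * (\<integral>\<zeta>. ?G \<zeta> \<partial>lborel)"
    using R by (simp add: scaleR_conv_of_real)
  then show ?thesis by (simp only: inv_fourier_def times_divide_eq_right)
qed

lemma integrable_exp_jump_exponent:
  fixes k :: "'a::euclidean_space \<Rightarrow> real"
  assumes k: "stable_like \<alpha> c k" and \<alpha>: "0 < \<alpha>" "\<alpha> < 2" and c: "0 < c"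
  shows "integrable lborel (\<lambda>\<xi>. exp (jump_exponent k \<xi>))"
proof -
  have kl: "kernel_le \<alpha> c k" using k by (simp add: stable_like_def)
  note lp = large_part_bounds[OF kl \<alpha>(1) c]
  note [measurable] = lp(4)
  have "norm (exp (fourier (large_part k) \<xi>)) \<le> exp (\<integral>y. \<bar>large_part k y\<bar> \<partial>lborel)" for \<xi>
    using order_trans[OF complex_Re_le_cmod norm_fourier_le] by simp
  then have "integrable lborel (\<lambda>\<xi>. exp (small_exponent k 0 \<xi>) * exp (fourier (large_part k) \<xi>))"
    by (intro integrable_mult_bounded integrable_exp_small_exponent[OF k \<alpha> c]) auto
  then show ?thesis unfolding exp_jump_exponent by (rule integrable_mult_right)
qed

text \<open>A density with the transform of a stable-like law at the scale \<open>R\<close> is, up to scaling and the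
  drift, the density studied above.\<close>

lemma scaled_density:
  fixes g :: "'a::euclidean_space \<Rightarrow> real" and p :: "'a \<Rightarrow> real"
  assumes \<alpha>: "0 < \<alpha>" "\<alpha> < 2" and c: "0 < c" and R: "0 < R"
    and k: "stable_like \<alpha> c (\<lambda>w. R ^ DIM('a) * g (R *\<^sub>R w))" and g: "g \<in> borel_measurable borel"
    and p: "integrable lborel p" "continuous_on UNIV p"
    and hat: "\<And>\<xi>. fourier p \<xi> = exp (\<integral>z. comp_phase \<alpha> (R *\<^sub>R \<xi>) (inverse R *\<^sub>R z) * of_real (g z) \<partial>lborel)"
  defines "k \<equiv> \<lambda>w. R ^ DIM('a) * g (R *\<^sub>R w)"
  shows "of_real (p x) = of_real (inverse (R ^ DIM('a)))
    * inv_fourier (\<lambda>\<zeta>. exp (jump_exponent k \<zeta>)) (inverse R *\<^sub>R x - drift \<alpha> k)"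
proof -
  note k' = k[folded k_def]
  have kl: "kernel_le \<alpha> c k" using k' by (simp add: stable_like_def)
  note [measurable] = g
  let ?\<Psi> = "\<lambda>\<zeta>. exp (\<i> * of_real (\<zeta> \<bullet> drift \<alpha> k)) * exp (jump_exponent k \<zeta>)"
  have int: "integrable lborel ?\<Psi>"
    using integrable_cis_mult[OF integrable_exp_jump_exponent[OF k' \<alpha> c]] by (simp add: cis_conv_exp)
  have hat': "fourier p \<xi> = ?\<Psi> (R *\<^sub>R \<xi>)" for \<xi>
  proof -
    have "(\<integral>z. comp_phase \<alpha> (R *\<^sub>R \<xi>) (inverse R *\<^sub>R z) * of_real (g z) \<partial>lborel)
      = \<bar>R\<bar> ^ DIM('a) *\<^sub>R (\<integral>w. comp_phase \<alpha> (R *\<^sub>R \<xi>) (inverse R *\<^sub>R (0 + R *\<^sub>R w)) * of_real (g (0 + R *\<^sub>R w)) \<partial>lborel)"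
      using R by (intro lborel_integral_affine) auto
    also have "\<dots> = (\<integral>w. comp_phase \<alpha> (R *\<^sub>R \<xi>) w * of_real (k w) \<partial>lborel)"
      using R by (simp add: k_def scaleR_conv_of_real mult.left_commute flip: integral_mult_right_zero)
    also have "\<dots> = jump_exponent k (R *\<^sub>R \<xi>) + \<i> * of_real ((R *\<^sub>R \<xi>) \<bullet> drift \<alpha> k)"
      by (rule comp_phase_integral(2)[OF kl \<alpha> c])
    finally show ?thesis unfolding hat by (simp add: exp_add)
  qed
  have "integrable lborel (\<lambda>\<xi>. ?\<Psi> (0 + R *\<^sub>R \<xi>))"
    using R by (intro lborel_integrable_affine[OF int]) simp
  then have "integrable lborel (fourier p)" unfolding hat'[abs_def] by simp
  moreover have "isCont p x" using p(2) by (simp add: continuous_on_eq_continuous_at)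
  ultimately have "of_real (p x) = inv_fourier (fourier p) x"
    by (intro fourier_inversion[symmetric] p)
  also have "\<dots> = inv_fourier (\<lambda>\<xi>. ?\<Psi> (R *\<^sub>R \<xi>)) x" by (simp only: hat'[abs_def])
  also have "\<dots> = of_real (inverse (R ^ DIM('a))) * inv_fourier ?\<Psi> (inverse R *\<^sub>R x)"
    by (rule inv_fourier_rescale[OF _ R]) (use borel_measurable_integrable[OF int] in simp)
  also have "inv_fourier ?\<Psi> (inverse R *\<^sub>R x) = inv_fourier (\<lambda>\<zeta>. exp (jump_exponent k \<zeta>)) (inverse R *\<^sub>R x - drift \<alpha> k)"
    by (rule inv_fourier_drift)
  finally show ?thesis .
qed

lemma scaled_density_bounds:
  assumes \<alpha>: "0 < \<alpha>" "\<alpha> < 2" and c: "0 < c"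
  defines "q \<equiv> \<alpha> + real DIM('a::euclidean_space)"
  shows "\<exists>U L. 0 < U \<and> 0 < L \<and> (\<forall>(g :: 'a \<Rightarrow> real) p R x.
    0 < R \<longrightarrow> stable_like \<alpha> c (\<lambda>w. R ^ DIM('a) * g (R *\<^sub>R w)) \<longrightarrow> g \<in> borel_measurable borel \<longrightarrow>
    integrable lborel p \<longrightarrow> continuous_on UNIV p \<longrightarrow>
    (\<forall>\<xi>. fourier p \<xi> = exp (\<integral>z. comp_phase \<alpha> (R *\<^sub>R \<xi>) (inverse R *\<^sub>R z) * of_real (g z) \<partial>lborel)) \<longrightarrow>
    p x \<le> U * (inverse (R ^ DIM('a)) * poly_weight q (inverse R *\<^sub>R x))
    \<and> L * (inverse (R ^ DIM('a)) * poly_weight q (inverse R *\<^sub>R x)) \<le> p x)"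
proof -
  have q: "0 < q" using \<alpha> by (auto simp: q_def add_pos_nonneg)
  obtain U L where UL: "0 < U" "0 < L" and core: "\<And>(k :: 'a \<Rightarrow> real) x. stable_like \<alpha> c k \<Longrightarrow>
      norm (inv_fourier (\<lambda>\<xi>. exp (jump_exponent k \<xi>)) x) \<le> U * poly_weight q x
      \<and> L * poly_weight q x \<le> Re (inv_fourier (\<lambda>\<xi>. exp (jump_exponent k \<xi>)) x)"
    using jump_density_bounds[OF \<alpha> c, where 'a='a] unfolding q_def by blast
  define B where "B = c * drift_bound \<alpha> TYPE('a)"
  have B0: "0 \<le> B"
    unfolding B_def drift_bound_def using c by (intro mult_nonneg_nonneg lebesgue_integral_nonneg) auto
  have main: "p x \<le> (U * (1 + B) powr q) * (inverse (R ^ DIM('a)) * poly_weight q (inverse R *\<^sub>R x))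
    \<and> (L * (1 + B) powr (- q)) * (inverse (R ^ DIM('a)) * poly_weight q (inverse R *\<^sub>R x)) \<le> p x"
    if R: "0 < R" and k: "stable_like \<alpha> c (\<lambda>w. R ^ DIM('a) * g (R *\<^sub>R w))" and g: "g \<in> borel_measurable borel"
    and p: "integrable lborel p" "continuous_on UNIV p"
    and hat: "\<forall>\<xi>. fourier p \<xi> = exp (\<integral>z. comp_phase \<alpha> (R *\<^sub>R \<xi>) (inverse R *\<^sub>R z) * of_real (g z) \<partial>lborel)"
    for g p R and x :: 'a
  proof -
    define k' where "k' = (\<lambda>w. R ^ DIM('a) * g (R *\<^sub>R w))"
    define y where "y = inverse R *\<^sub>R x"
    define F where "F = inv_fourier (\<lambda>\<zeta>. exp (jump_exponent k' \<zeta>)) (y - drift \<alpha> k')"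
    define r where "r = inverse (R ^ DIM('a))"
    have r: "0 \<le> r" using R by (simp add: r_def)
    have b: "norm (drift \<alpha> k') \<le> B"
      unfolding B_def using k by (intro norm_drift_le \<alpha>) (simp add: stable_like_def k'_def)
    have "complex_of_real (p x) = of_real r * F"
      unfolding F_def y_def k'_def r_def using hat by (intro scaled_density[OF \<alpha> c R k g p]) auto
    then have "Re (complex_of_real (p x)) = Re (of_real r * F)" by simp
    then have px: "p x = r * Re F" by simp
    have "Re F \<le> norm F" by (rule complex_Re_le_cmod)
    also have "\<dots> \<le> U * poly_weight q (y - drift \<alpha> k')"
      unfolding F_def using core k by (simp add: k'_def)
    also have "\<dots> \<le> U * ((1 + B) powr q * poly_weight q y)"
      using UL poly_weight_shift(1)[OF b q] by (intro mult_left_mono) auto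
    finally have "r * Re F \<le> r * (U * ((1 + B) powr q * poly_weight q y))" using r by (rule mult_left_mono)
    moreover have "L * ((1 + B) powr (- q) * poly_weight q y) \<le> Re F"
    proof -
      have "L * ((1 + B) powr (- q) * poly_weight q y) \<le> L * poly_weight q (y - drift \<alpha> k')"
        using UL poly_weight_shift(2)[OF b q] by (intro mult_left_mono) auto
      also have "\<dots> \<le> Re F" unfolding F_def using core k by (simp add: k'_def)
      finally show ?thesis .
    qed
    then have "r * (L * ((1 + B) powr (- q) * poly_weight q y)) \<le> r * Re F" using r by (rule mult_left_mono)
    ultimately show ?thesis unfolding px r_def[symmetric] y_def[symmetric] by (simp only: mult_ac)
  qed
  have "0 < U * (1 + B) powr q" "0 < L * (1 + B) powr (- q)" using UL B0 by auto
  with main show ?thesis by blast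
qed

section \<open>Averaging in time\<close>

lemma compensator_eq_cutoff: "compensator \<alpha> z = cutoff \<alpha> z *\<^sub>R (z :: real ^ 'd)"
  by (simp add: compensator_def cutoff_def)

lemma rho0_eq_poly_weight:
  fixes x :: "real ^ 'd"
  assumes T: "0 < T" and \<alpha>: "0 < \<alpha>"
  defines "R \<equiv> T powr (1 / \<alpha>)"
  shows "rho0 \<alpha> T x = inverse (R ^ CARD('d)) * poly_weight (\<alpha> + CARD('d)) (inverse R *\<^sub>R x)"
proof -
  have R: "0 < R" using T by (simp add: R_def)
  have RT: "R powr \<alpha> = T" using T \<alpha> by (simp add: R_def powr_powr)
  have "R + norm x = R * (1 + norm (inverse R *\<^sub>R x))"
    using R by (simp add: field_simps)
  then have "(R + norm x) powr (CARD('d) + \<alpha>) = R powr CARD('d) * T * (1 + norm (inverse R *\<^sub>R x)) powr (\<alpha> + CARD('d))"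
    using R RT by (simp only: powr_mult powr_add mult_ac add.commute[of \<alpha>])
  then show ?thesis
    using T R unfolding rho0_def R_def[symmetric] poly_weight_def
    by (simp only: powr_minus powr_realpow) (simp add: field_simps)
qed

text \<open>The change of cutoff is made at each fixed time, since the cancellation is a hypothesis on each
  \<open>\<kappa> r\<close>; the exchange of the integrals over time and space comes afterwards and only involves
  the rescaled phase.\<close>

lemma levy_exponent_rescaled:
  fixes \<kappa> :: "real \<Rightarrow> real ^ 'd \<Rightarrow> real"
  assumes \<alpha>: "0 < \<alpha>" "\<alpha> < 2" and c: "1 < c" and adm: "admissible_kernel \<alpha> c \<kappa>"
    and ts: "0 \<le> t" "t < s"
  defines "R \<equiv> (s - t) powr (1 / \<alpha>)"
    and "g \<equiv> \<lambda>z. (\<integral>r. indicator {t..s} r * \<kappa> r z \<partial>lborel) * norm z powr (- \<alpha> - CARD('d))"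
  shows "g \<in> borel_measurable borel" and "stable_like \<alpha> c (\<lambda>w. R ^ CARD('d) * g (R *\<^sub>R w))"
    and "levy_exponent \<alpha> \<kappa> t s \<xi> = (\<integral>z. comp_phase \<alpha> (R *\<^sub>R \<xi>) (inverse R *\<^sub>R z) * of_real (g z) \<partial>lborel)"
proof -
  let ?D = "real CARD('d)"
  have T: "0 < s - t" using ts by simp
  have R: "0 < R" using ts by (simp add: R_def)
  have c0: "0 < c" using c by simp
  \<comment> \<open>the kernel is only known to be measurable for nonnegative times, so it is extended by 0 to negative ones\<close>
  define \<kappa>' where "\<kappa>' = (\<lambda>(r, z). indicator {0..} r * \<kappa> r z)"
  have \<kappa>'m[measurable]: "\<kappa>' \<in> borel_measurable (borel \<Otimes>\<^sub>M borel)"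
  proof -
    have "(\<lambda>(t, z). \<kappa> t z) \<in> borel_measurable (restrict_space borel ({0..} \<times> UNIV))"
      using adm by (simp add: admissible_kernel_def)
    moreover have S: "{0..} \<times> UNIV \<in> sets (borel :: (real \<times> (real ^ 'd)) measure)"
      by (intro borel_closed closed_Times) auto
    ultimately have "(\<lambda>x. indicator ({0..} \<times> UNIV) x *\<^sub>R (case x of (t, z) \<Rightarrow> \<kappa> t z)) \<in> borel_measurable (borel :: (real \<times> (real ^ 'd)) measure)"
      by (subst (asm) borel_measurable_restrict_space_iff) auto
    moreover have "(\<lambda>x. indicator ({0..} \<times> UNIV) x *\<^sub>R (case x of (t, z) \<Rightarrow> \<kappa> t z)) = \<kappa>'"
      by (auto simp: \<kappa>'_def fun_eq_iff indicator_def)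
    ultimately show ?thesis by (simp add: borel_prod)
  qed
  have \<kappa>b: "inverse c \<le> \<kappa> r z" "\<kappa> r z \<le> c" if "0 \<le> r" for r z
    using adm that by (auto simp: admissible_kernel_def)
  have \<kappa>eq: "indicator {t..s} r * \<kappa> r z = indicator {t..s} r * \<kappa>' (r, z)" for r z
    using ts by (auto simp: \<kappa>'_def indicator_def)
  define m where "m z = (\<integral>r. indicator {t..s} r * \<kappa> r z \<partial>lborel)" for z
  have m[measurable]: "m \<in> borel_measurable borel"
    unfolding m_def \<kappa>eq by measurable
  have Ii: "integrable lborel (indicator {t..s} :: real \<Rightarrow> real)"
    using ts by (intro integrable_real_indicator) auto
  have \<kappa>i: "integrable lborel (\<lambda>r. indicator {t..s} r * \<kappa> r z)" for z
  proof (rule integrable_norm_le)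
    show "integrable lborel (\<lambda>r. c * indicator {t..s} r :: real)" using Ii by simp
    show "(\<lambda>r. indicator {t..s} r * \<kappa> r z) \<in> borel_measurable lborel" unfolding \<kappa>eq by measurable
    have "\<bar>\<kappa> r z\<bar> \<le> c" if "0 \<le> r" for r
      using \<kappa>b[OF that, of z] c0 by (smt (verit) inverse_positive_iff_positive)
    then show "norm (indicator {t..s} r * \<kappa> r z) \<le> c * indicator {t..s} r" for r
      using ts by (cases "r \<in> {t..s}") auto
  qed
  have mb: "inverse c * (s - t) \<le> m z \<and> m z \<le> c * (s - t)" for z
  proof
    have I: "(\<integral>r. indicator {t..s} r \<partial>lborel) = s - t" using ts by simp
    have "inverse c * (s - t) = (\<integral>r. inverse c * indicator {t..s} r \<partial>lborel)" using I by simp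
    also have "\<dots> \<le> m z" unfolding m_def
      by (intro integral_mono \<kappa>i integrable_mult_right Ii) (use \<kappa>b ts in \<open>auto simp: indicator_def\<close>)
    finally show "inverse c * (s - t) \<le> m z" .
    have "m z \<le> (\<integral>r. c * indicator {t..s} r \<partial>lborel)" unfolding m_def
      by (intro integral_mono \<kappa>i integrable_mult_right Ii) (use \<kappa>b ts in \<open>auto simp: indicator_def\<close>)
    also have "\<dots> = c * (s - t)" using I by simp
    finally show "m z \<le> c * (s - t)" .
  qed
  have gm: "g = (\<lambda>z. m z * norm z powr (- \<alpha> - ?D))" by (simp add: g_def m_def)
  show g: "g \<in> borel_measurable borel" unfolding gm by measurable
  have g0: "0 \<le> g z" for z
  proof -
    have "0 \<le> inverse c * (s - t)" using c0 T by simp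
    then have "0 \<le> m z" using mb[of z] by linarith
    then show ?thesis by (simp add: gm)
  qed
  have keq: "R ^ CARD('d) * g (R *\<^sub>R w) = m (R *\<^sub>R w) / (s - t) * norm w powr (- \<alpha> - ?D)" for w
  proof -
    have "R ^ CARD('d) * R powr (- \<alpha> - ?D) = R powr (- \<alpha>)"
      using R by (simp add: powr_realpow[symmetric] flip: powr_add)
    also have "\<dots> = 1 / (s - t)"
      using T \<alpha> by (simp add: R_def powr_powr powr_minus divide_inverse)
    finally have "R ^ CARD('d) * R powr (- \<alpha> - ?D) = 1 / (s - t)" .
    moreover have "R ^ CARD('d) * g (R *\<^sub>R w) = m (R *\<^sub>R w) * (R ^ CARD('d) * R powr (- \<alpha> - ?D)) * norm w powr (- \<alpha> - ?D)"
      using R by (simp add: gm powr_mult)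
    ultimately show ?thesis by simp
  qed
  have mT: "inverse c \<le> m z / (s - t)" "m z / (s - t) \<le> c" for z
    using mb[of z] T by (simp_all add: pos_le_divide_eq pos_divide_le_eq)
  have dim: "real DIM(real ^ 'd) = ?D" by simp
  show k: "stable_like \<alpha> c (\<lambda>w. R ^ CARD('d) * g (R *\<^sub>R w))"
    unfolding stable_like_def kernel_le_def
  proof (intro conjI allI)
    show "(\<lambda>w. R ^ CARD('d) * g (R *\<^sub>R w)) \<in> borel_measurable borel" using g by measurable
    fix w :: "real ^ 'd"
    show "0 \<le> R ^ CARD('d) * g (R *\<^sub>R w)" using R g0 by simp
    show "R ^ CARD('d) * g (R *\<^sub>R w) \<le> c * norm w powr (- \<alpha> - DIM(real ^ 'd))"
      unfolding keq dim by (intro mult_right_mono mT) simp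
    show "inverse c * norm w powr (- \<alpha> - DIM(real ^ 'd)) \<le> R ^ CARD('d) * g (R *\<^sub>R w)"
      unfolding keq dim by (intro mult_right_mono mT) simp
  qed
  \<comment> \<open>Integrability against any kernel dominated by the stable one, after rescaling.\<close>
  have int: "integrable lborel (\<lambda>z. comp_phase \<alpha> (r *\<^sub>R \<xi>) (inverse r *\<^sub>R z) * of_real (h z))"
    if r: "0 < r" and h: "h \<in> borel_measurable borel" "\<And>z. 0 \<le> h z" "\<And>z. h z \<le> C * norm z powr (- \<alpha> - ?D)" and C: "0 < C"
    for r C and h :: "real ^ 'd \<Rightarrow> real"
  proof -
    have "kernel_le \<alpha> (C * r powr (- \<alpha> - ?D)) (\<lambda>w. h (r *\<^sub>R w))"
      unfolding kernel_le_def
    proof (intro conjI allI)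
      show "(\<lambda>w. h (r *\<^sub>R w)) \<in> borel_measurable borel" using h(1) by measurable
      fix w :: "real ^ 'd"
      show "0 \<le> h (r *\<^sub>R w)" by (rule h)
      show "h (r *\<^sub>R w) \<le> C * r powr (- \<alpha> - ?D) * norm w powr (- \<alpha> - DIM(real ^ 'd))"
        using h(3)[of "r *\<^sub>R w"] r by (simp add: powr_mult mult.assoc)
    qed
    then have "integrable lborel (\<lambda>w. comp_phase \<alpha> (r *\<^sub>R \<xi>) w * of_real (h (r *\<^sub>R w)))"
      by (rule comp_phase_integral(1)[OF _ \<alpha>]) (use C r in simp)
    from lborel_integrable_affine[OF this, of "inverse r" 0] show ?thesis using r by simp
  qed
  define e where "e = (\<lambda>z. comp_phase \<alpha> (R *\<^sub>R \<xi>) (inverse R *\<^sub>R z))"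
  have [measurable]: "e \<in> borel_measurable borel" unfolding e_def by measurable
  have slice: "(CLINT z|lborel. (exp (\<i> * of_real (\<xi> \<bullet> z)) - 1 - \<i> * of_real (\<xi> \<bullet> compensator \<alpha> z))
        * of_real (\<kappa> r z / norm z powr (?D + \<alpha>)))
      = (\<integral>z. e z * of_real (\<kappa> r z * norm z powr (- \<alpha> - ?D)) \<partial>lborel)" if r: "0 \<le> r" for r
  proof -
    let ?h = "\<lambda>z. \<kappa> r z * norm z powr (- \<alpha> - ?D)"
    have "\<kappa> r = (\<lambda>z. \<kappa>' (r, z))" using r by (simp add: \<kappa>'_def)
    then have km[measurable]: "\<kappa> r \<in> borel_measurable borel" by simp
    have k0: "0 \<le> \<kappa> r z" for z using \<kappa>b(1)[OF r, of z] c0 by (smt (verit) inverse_positive_iff_positive)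
    have h: "?h \<in> borel_measurable borel" "\<And>z. 0 \<le> ?h z" "\<And>z. ?h z \<le> c * norm z powr (- \<alpha> - ?D)"
      using k0 \<kappa>b(2)[OF r] by (auto intro!: mult_right_mono)
    have pe: "\<kappa> r z / norm z powr (?D + \<alpha>) = ?h z" for z
    proof -
      have "- \<alpha> - ?D = - (?D + \<alpha>)" by simp
      then show ?thesis by (simp only: powr_minus divide_inverse)
    qed
    have "(\<integral>z. comp_phase \<alpha> \<xi> z * of_real (?h z) \<partial>lborel) = (\<integral>z. e z * of_real (?h z) \<partial>lborel)"
      unfolding e_def
    proof (rule comp_phase_rescale_cutoff[OF _ _ h(1) \<alpha> R h(2) _ less_imp_le[OF c0]])
      show "integrable lborel (\<lambda>z. comp_phase \<alpha> \<xi> z * of_real (?h z))"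
        using int[of 1, OF _ h c0] by simp
      show "integrable lborel (\<lambda>z. comp_phase \<alpha> (R *\<^sub>R \<xi>) (inverse R *\<^sub>R z) * of_real (?h z))"
        by (rule int[OF R h c0])
      show "?h z \<le> c * norm z powr (- \<alpha> - DIM(real ^ 'd))" for z using h(3)[of z] by simp
      fix a b :: real assume ab: "\<alpha> = 1" "0 < a" "a < b"
      have "(LINT z:{z. a \<le> norm z \<and> norm z \<le> b}|lborel. (\<kappa> r z / norm z ^ (CARD('d) + 1)) *\<^sub>R z) = 0"
        using adm ab r unfolding admissible_kernel_def by blast
      moreover have "(\<kappa> r z / norm z ^ (CARD('d) + 1)) *\<^sub>R z = ?h z *\<^sub>R z" for z
      proof (cases "z = 0")
        case False
        have "- \<alpha> - ?D = - real (CARD('d) + 1)" using ab(1) by simp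
        then have "norm z powr (- \<alpha> - ?D) = inverse (norm z ^ (CARD('d) + 1))"
          using powr_realpow[of "norm z" "CARD('d) + 1"] False by (simp only: powr_minus) simp
        then show ?thesis by (simp only: divide_inverse)
      qed simp
      ultimately show "(LINT z:{z. a \<le> norm z \<and> norm z \<le> b}|lborel. ?h z *\<^sub>R z) = 0"
        by (simp only:)
    qed
    then show ?thesis
      unfolding comp_phase_def compensator_eq_cutoff[symmetric] pe .
  qed
  let ?f = "\<lambda>z r. e z * of_real (indicator {t..s} r * \<kappa> r z * norm z powr (- \<alpha> - ?D))"
  have gb: "g z \<le> c * (s - t) * norm z powr (- \<alpha> - ?D)" for z
    unfolding gm using mb[of z] by (intro mult_right_mono) auto
  have fr: "(\<integral>r. indicator {t..s} r * \<kappa> r z * norm z powr (- \<alpha> - ?D) \<partial>lborel) = g z" for z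
    unfolding gm m_def by simp
  have eg: "integrable lborel (\<lambda>z. e z * of_real (g z))"
    unfolding e_def by (rule int[OF R g g0 gb]) (use c0 T in simp)
  have joint: "integrable (lborel \<Otimes>\<^sub>M lborel) (case_prod ?f)"
  proof (rule lborel_pair.Fubini_integrable)
    show "case_prod ?f \<in> borel_measurable (lborel \<Otimes>\<^sub>M lborel)" unfolding \<kappa>eq by measurable
    have "(\<integral>r. norm (?f z r) \<partial>lborel) = norm (e z * of_real (g z))" for z
    proof -
      have "norm (?f z r) = norm (e z) * (indicator {t..s} r * \<kappa> r z * norm z powr (- \<alpha> - ?D))" for r
      proof (cases "r \<in> {t..s}")
        case True
        then have "0 \<le> r" using ts by simp
        then have "0 \<le> \<kappa> r z" using \<kappa>b(1)[of r z] c0 by (smt (verit) inverse_positive_iff_positive)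
        then show ?thesis by (simp add: norm_mult)
      qed simp
      then have "(\<integral>r. norm (?f z r) \<partial>lborel) = norm (e z) * g z"
        by (simp only: integral_mult_right_zero fr)
      then show ?thesis using g0[of z] by (simp add: norm_mult)
    qed
    then show "integrable lborel (\<lambda>z. \<integral>r. norm (case (z, r) of (z, r) \<Rightarrow> ?f z r) \<partial>lborel)"
      using eg by (simp only: prod.case) (rule integrable_norm)
    show "AE z in lborel. integrable lborel (\<lambda>r. case (z, r) of (z, r) \<Rightarrow> ?f z r)"
      unfolding prod.case by (intro AE_I2 integrable_mult_right integrable_of_real integrable_mult_left \<kappa>i)
  qed
  have "levy_exponent \<alpha> \<kappa> t s \<xi> = (\<integral>r. \<integral>z. ?f z r \<partial>lborel \<partial>lborel)"
    unfolding levy_exponent_def set_lebesgue_integral_def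
  proof (rule Bochner_Integration.integral_cong[OF refl])
    fix r
    show "indicator {t..s} r *\<^sub>R (CLINT z|lborel. (exp (\<i> * of_real (\<xi> \<bullet> z)) - 1 - \<i> * of_real (\<xi> \<bullet> compensator \<alpha> z))
        * of_real (\<kappa> r z / norm z powr (?D + \<alpha>))) = (\<integral>z. ?f z r \<partial>lborel)"
      using slice[of r] ts by (cases "r \<in> {t..s}") simp_all
  qed
  also have "\<dots> = (\<integral>z. \<integral>r. ?f z r \<partial>lborel \<partial>lborel)"
    by (rule lborel_pair.Fubini_integral[OF joint])
  also have "\<dots> = (\<integral>z. e z * of_real (g z) \<partial>lborel)"
    by (simp only: integral_mult_right_zero integral_complex_of_real fr)
  finally show "levy_exponent \<alpha> \<kappa> t s \<xi> = (\<integral>z. comp_phase \<alpha> (R *\<^sub>R \<xi>) (inverse R *\<^sub>R z) * of_real (g z) \<partial>lborel)"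
    unfolding e_def .
qed

lemma increment_density_fourier:
  fixes p :: "real ^ 'd \<Rightarrow> real"
  assumes law: "increment_law \<alpha> \<kappa> t s \<mu>" and dens: "continuous_density \<mu> p"
  shows "integrable lborel p" and "continuous_on UNIV p"
    and "fourier p \<xi> = exp (levy_exponent \<alpha> \<kappa> t s \<xi>)"
proof -
  show cont: "continuous_on UNIV p" using dens by (simp add: continuous_density_def)
  then have [measurable]: "p \<in> borel_measurable borel" by (rule borel_measurable_continuous_onI)
  have p0: "0 \<le> p x" for x using dens by (simp add: continuous_density_def)
  have \<mu>: "\<mu> = density lborel (\<lambda>x. ennreal (p x))" using dens by (simp add: continuous_density_def)
  interpret prob_space \<mu> using law by (simp add: increment_law_def)
  have "(\<integral>\<^sup>+ x. ennreal (p x) \<partial>lborel) = 1"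
    using emeasure_space_1 unfolding \<mu> by (simp add: emeasure_density)
  then show "integrable lborel p"
    using p0 by (intro integrableI_bounded) (auto simp: )
  have "exp (levy_exponent \<alpha> \<kappa> t s \<xi>) = (CLINT x|\<mu>. exp (\<i> * of_real (\<xi> \<bullet> x)))"
    using law by (simp add: increment_law_def)
  also have "\<dots> = (\<integral>x. p x *\<^sub>R exp (\<i> * of_real (\<xi> \<bullet> x)) \<partial>lborel)"
    unfolding \<mu> using p0 by (subst integral_density) auto
  also have "\<dots> = fourier p \<xi>"
    by (simp add: fourier_def cis_conv_exp scaleR_conv_of_real mult.commute)
  finally show "fourier p \<xi> = exp (levy_exponent \<alpha> \<kappa> t s \<xi>)" by simp
qed

theorem theorem2p1:
  fixes \<alpha> \<kappa>\<^sub>0 :: real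
  assumes "0 < \<alpha>" and "\<alpha> < 2" and "1 < \<kappa>\<^sub>0"
  shows "\<exists>c\<^sub>0>1. \<forall>\<kappa> :: real \<Rightarrow> real ^ 'd \<Rightarrow> real. admissible_kernel \<alpha> \<kappa>\<^sub>0 \<kappa> \<longrightarrow>
           (\<forall>t s \<mu> p. 0 \<le> t \<and> t < s \<and> increment_law \<alpha> \<kappa> t s \<mu> \<and> continuous_density \<mu> p \<longrightarrow>
             (\<forall>x. inverse c\<^sub>0 * rho0 \<alpha> (s - t) x \<le> p x \<and> p x \<le> c\<^sub>0 * rho0 \<alpha> (s - t) x))"
proof -
  obtain U L where UL: "0 < U" "0 < L" and bounds: "\<And>(g :: real ^ 'd \<Rightarrow> real) p R x.
    0 < R \<Longrightarrow> stable_like \<alpha> \<kappa>\<^sub>0 (\<lambda>w. R ^ CARD('d) * g (R *\<^sub>R w)) \<Longrightarrow> g \<in> borel_measurable borel \<Longrightarrow>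
    integrable lborel p \<Longrightarrow> continuous_on UNIV p \<Longrightarrow>
    (\<And>\<xi>. fourier p \<xi> = exp (\<integral>z. comp_phase \<alpha> (R *\<^sub>R \<xi>) (inverse R *\<^sub>R z) * of_real (g z) \<partial>lborel)) \<Longrightarrow>
    p x \<le> U * (inverse (R ^ CARD('d)) * poly_weight (\<alpha> + CARD('d)) (inverse R *\<^sub>R x))
    \<and> L * (inverse (R ^ CARD('d)) * poly_weight (\<alpha> + CARD('d)) (inverse R *\<^sub>R x)) \<le> p x"
    using scaled_density_bounds[OF assms(1,2), of \<kappa>\<^sub>0, where 'a="real ^ 'd"] assms(3) by auto
  \<comment> \<open>the summand 1 makes the constant larger than 1; the others dominate the two one-sided constants\<close>
  define c\<^sub>0 where "c\<^sub>0 = 1 + U + inverse L"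
  have c0: "1 < c\<^sub>0" "U \<le> c\<^sub>0" "inverse c\<^sub>0 \<le> L"
  proof -
    show "1 < c\<^sub>0" "U \<le> c\<^sub>0" using UL by (simp_all add: c\<^sub>0_def add_pos_pos)
    have "inverse L \<le> c\<^sub>0" using UL by (simp add: c\<^sub>0_def)
    then show "inverse c\<^sub>0 \<le> L" using UL le_imp_inverse_le[of "inverse L" c\<^sub>0] by simp
  qed
  show ?thesis
  proof (intro exI[of _ c\<^sub>0] conjI allI impI c0(1))
    fix \<kappa> :: "real \<Rightarrow> real ^ 'd \<Rightarrow> real" and t s \<mu> p and x :: "real ^ 'd"
    assume adm: "admissible_kernel \<alpha> \<kappa>\<^sub>0 \<kappa>"
      and "0 \<le> t \<and> t < s \<and> increment_law \<alpha> \<kappa> t s \<mu> \<and> continuous_density \<mu> p"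
    then have ts: "0 \<le> t" "t < s" and law: "increment_law \<alpha> \<kappa> t s \<mu>" "continuous_density \<mu> p" by auto
    note le = levy_exponent_rescaled[OF assms adm ts]
    note dens = increment_density_fourier[OF law]
    have T: "0 < s - t" using ts by simp
    let ?\<rho> = "rho0 \<alpha> (s - t) x"
    have \<rho>: "0 \<le> ?\<rho>" using ts by (simp add: rho0_def)
    have b: "p x \<le> U * ?\<rho> \<and> L * ?\<rho> \<le> p x"
      unfolding rho0_eq_poly_weight[OF T assms(1)]
      using ts by (intro bounds[OF _ le(2,1) dens(1,2)]) (simp_all add: dens(3) le(3))
    have "inverse c\<^sub>0 * ?\<rho> \<le> L * ?\<rho>" "U * ?\<rho> \<le> c\<^sub>0 * ?\<rho>"
      using \<rho> c0 by (auto intro: mult_right_mono)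
    with b show "inverse c\<^sub>0 * ?\<rho> \<le> p x" "p x \<le> c\<^sub>0 * ?\<rho>" by linarith+
  qed
qed

end
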